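(* Let $\mathcal{K}$ be a simplicial complex. Then: (1) The inclusion map $L(\Omega,\mathcal{K}) \to \bar{L}(\Omega,\mathcal{K})$ is a weak homotopy equivalence. (2) The probability law map $\Psi_{\mathcal K} : L(\Omega,\mathcal{K}) \to |\mathcal{K}|_1$ is a Serre fibration and a weak homotopy equivalence. It admits a continuous global section. (3) The probability law map $\overline{\Psi}_{\mathcal K} : \bar{L}(\Omega,\mathcal{K}) \to \overline{|\mathcal{K}|_1}$ is a Serre fibration and a weak homotopy equivalence. It admits a continuous global section. (4) $L(\Omega,\mathcal{K})$ and $\bar{L}(\Omega,\mathcal{K})$ have the same weak homotopy type as the geometric realization $|\mathcal{K}|$ of $\mathcal{K}$.
   Context: $(\Omega,\lambda)$ is a nonatomic standard probability space (all of these are isomorphic modulo null sets to $[0,1]$ with Lebesgue measure). For a set $S$, endowed with the discrete metric ($d(s,s')=1$ if $s\neq s'$) and its Borel $\sigma$-algebra (all subsets), $L(\Omega,S)$ is the set of measurable maps $\Omega\to S$ modulo almost everywhere equality, with the metric $d(f,g)=\lambda(\{t\in\Omega : f(t)\neq g(t)\})$. The essential image of $f\in L(\Omega,S)$ is $f(\Omega)=\{s\in S : \lambda(f^{-1}(\{s\}))>0\}$. $\mathcal{P}_{\mathrm f}^*(S)$ is the set of nonempty finite subsets of $S$. A simplicial complex is a collection $\mathcal{K}\subset\mathcal{P}_{\mathrm f}^*(S)$ such that $X\in\mathcal{K}$, $Y\in\mathcal{P}_{\mathrm f}^*(S)$ and $Y\subset X$ imply $Y\in\mathcal{K}$; its vertex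 set is the union of its elements. $L(\Omega,\mathcal{K})=\{f\in L(\Omega,S) : f(\Omega)\in\mathcal{K}\}$, and $\bar{L}(\Omega,\mathcal{K})$ is its closure in $L(\Omega,S)$; both carry the induced metric. As a set, $|\mathcal{K}|=\{\alpha:S\to[0,1] : \{s : \alpha(s)>0\}\in\mathcal{K},\ \sum_{s\in S}\alpha(s)=1\}$. The geometric realization $|\mathcal{K}|$ carries the weak topology: $U$ is open iff $U\cap|F|$ is open in $|F|$ for every $F\in\mathcal{K}$, where $|F|=\{\alpha:F\to[0,1] : \sum_{s\in F}\alpha(s)=1\}$ has the topology induced from $[0,1]^F$ (functions on $F$ being extended by $0$). $|\mathcal{K}|_1$ is the same set with the metric $d_1(\alpha,\beta)=\sum_{s\in S}|\alpha(s)-\beta(s)|$, and $\overline{|\mathcal{K}|_1}$ is its metric completion, which identifies with the set of $\alpha:S\to[0,1]$ with $\sum_s\alpha(s)=1$ such that every nonempty finite subset of $\{s : \alpha(s)\neq 0\}$ belongs to $\mathcal{K}$, with the same formula for the metric. The probability law maps $\Psi_{\mathcal K}$ and $\overline{\Psi}_{\mathcal K}$ send $f$ to $s\mapsto\lambda(f^{-1}(\{s\}))$. A Serre fibration is a continuous map having the homotopy lifting property with respect to all $n$-spheres (equivalently, all CW-complexes). *)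

theory Defs
  imports "HOL-Analysis.Analysis" "HOL-Probability.Probability"
begin

section \<open>Nonatomic standard probability spaces\<close>

definition isomorphic_mod_null :: "'a measure \<Rightarrow> 'b measure \<Rightarrow> bool" where
  "isomorphic_mod_null M N \<longleftrightarrow>
     (\<exists>A\<in>null_sets M. \<exists>B\<in>null_sets N. \<exists>\<phi>.
        bij_betw \<phi> (space M - A) (space N - B) \<and>
        \<phi> \<in> measurable (restrict_space M (space M - A)) (restrict_space N (space N - B)) \<and>
        the_inv_into (space M - A) \<phi>
          \<in> measurable (restrict_space N (space N - B)) (restrict_space M (space M - A)) \<and>
        (\<forall>E\<in>sets N. E \<subseteq> space N - B \<longrightarrow>
            emeasure M (\<phi> -` E \<inter> (space M - A)) = emeasure N E))"

text \<open>Passing to the completion covers both common conventions: complete (Lebesgue-Rokhlin)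
  spaces, and Borel probability measures on Polish spaces.\<close>

definition nonatomic_standard_prob_space :: "'w measure \<Rightarrow> bool" where
  "nonatomic_standard_prob_space M \<longleftrightarrow>
     prob_space M \<and> isomorphic_mod_null (completion M) (lebesgue_on {0..1::real})"


section \<open>Spaces of random variables\<close>

text \<open>A point of \<open>L(\<Omega>,S)\<close> is a class of measurable maps for almost everywhere equality;
  \<open>count_space S\<close> carries the \<open>\<sigma>\<close>-algebra of all subsets of \<open>S\<close>.\<close>

definition ae_eq_rel :: "'w measure \<Rightarrow> 's set \<Rightarrow> (('w \<Rightarrow> 's) \<times> ('w \<Rightarrow> 's)) set" where
  "ae_eq_rel M S = {(f, g). f \<in> measurable M (count_space S) \<and> g \<in> measurable M (count_space S)
                            \<and> (AE t in M. f t = g t)}"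

definition rv_space :: "'w measure \<Rightarrow> 's set \<Rightarrow> ('w \<Rightarrow> 's) set set" where
  "rv_space M S = measurable M (count_space S) // ae_eq_rel M S"

definition rv_rep :: "('w \<Rightarrow> 's) set \<Rightarrow> 'w \<Rightarrow> 's" where
  "rv_rep F = (SOME f. f \<in> F)"

text \<open>The completion matters only when \<open>M\<close> is not complete: for uncountable \<open>S\<close> the set where
  two measurable maps differ may then be measurable only up to a null set.\<close>

definition rv_dist :: "'w measure \<Rightarrow> ('w \<Rightarrow> 's) set \<Rightarrow> ('w \<Rightarrow> 's) set \<Rightarrow> real" where
  "rv_dist M F G = measure (completion M) {t \<in> space M. rv_rep F t \<noteq> rv_rep G t}"

definition rv_topology :: "'w measure \<Rightarrow> 's set \<Rightarrow> ('w \<Rightarrow> 's) set topology" where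
  "rv_topology M S = Metric_space.mtopology (rv_space M S) (rv_dist M)"

definition prob_law :: "'w measure \<Rightarrow> ('w \<Rightarrow> 's) set \<Rightarrow> 's \<Rightarrow> real" where
  "prob_law M F = (\<lambda>s. measure M (rv_rep F -` {s} \<inter> space M))"

definition ess_image :: "'w measure \<Rightarrow> 's set \<Rightarrow> ('w \<Rightarrow> 's) set \<Rightarrow> 's set" where
  "ess_image M S F = {s \<in> S. measure M (rv_rep F -` {s} \<inter> space M) > 0}"

lemma equiv_ae_eq_rel: "equiv (measurable M (count_space S)) (ae_eq_rel M S)"
proof (rule equivI)
  show "ae_eq_rel M S \<subseteq> measurable M (count_space S) \<times> measurable M (count_space S)"
    by (auto simp: ae_eq_rel_def)
  show "refl_on (measurable M (count_space S)) (ae_eq_rel M S)"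
    by (auto simp: ae_eq_rel_def refl_on_def)
  show "sym (ae_eq_rel M S)"
    by (auto simp: ae_eq_rel_def sym_def eq_commute)
  show "trans (ae_eq_rel M S)"
  proof (rule transI)
    fix f g h assume fg: "(f, g) \<in> ae_eq_rel M S" and gh: "(g, h) \<in> ae_eq_rel M S"
    have "AE t in M. f t = g t" "AE t in M. g t = h t"
      using fg gh by (auto simp: ae_eq_rel_def)
    then have "AE t in M. f t = h t" by eventually_elim simp
    then show "(f, h) \<in> ae_eq_rel M S" using fg gh by (auto simp: ae_eq_rel_def)
  qed
qed

lemma rv_rep_in: "F \<in> rv_space M S \<Longrightarrow> rv_rep F \<in> F"
  unfolding rv_rep_def rv_space_def
  using in_quotient_imp_non_empty[OF equiv_ae_eq_rel, of F M S] by (simp add: some_in_eq)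

lemma prob_law_eq:
  assumes "F \<in> rv_space M S" "f \<in> F" "s \<in> S"
  shows "prob_law M F s = measure M (f -` {s} \<inter> space M)"
proof -
  have "(rv_rep F, f) \<in> ae_eq_rel M S"
    using assms rv_rep_in[OF assms(1)] quotient_eq_iff[OF equiv_ae_eq_rel]
    unfolding rv_space_def by metis
  then have m: "rv_rep F \<in> measurable M (count_space S)" "f \<in> measurable M (count_space S)"
    and ae: "AE t in M. rv_rep F t = f t"
    by (auto simp: ae_eq_rel_def)
  have s: "{s} \<in> sets (count_space S)" using assms(3) by simp
  show ?thesis unfolding prob_law_def
    by (rule measure_eq_AE) (use ae in \<open>auto intro: measurable_sets[OF _ s] m\<close>)
qed


section \<open>Simplicial complexes and their realizations\<close>

definition abstract_simplicial_complex :: "'s set \<Rightarrow> 's set set \<Rightarrow> bool" where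
  "abstract_simplicial_complex S K \<longleftrightarrow>
     (\<forall>X\<in>K. finite X \<and> X \<noteq> {} \<and> X \<subseteq> S) \<and>
     (\<forall>X\<in>K. \<forall>Y. finite Y \<and> Y \<noteq> {} \<and> Y \<subseteq> X \<longrightarrow> Y \<in> K)"

definition rv_complex :: "'w measure \<Rightarrow> 's set \<Rightarrow> 's set set \<Rightarrow> ('w \<Rightarrow> 's) set set" where
  "rv_complex M S K = {F \<in> rv_space M S. ess_image M S F \<in> K}"

definition L_top :: "'w measure \<Rightarrow> 's set \<Rightarrow> 's set set \<Rightarrow> ('w \<Rightarrow> 's) set topology" where
  "L_top M S K = subtopology (rv_topology M S) (rv_complex M S K)"

definition Lbar_top :: "'w measure \<Rightarrow> 's set \<Rightarrow> 's set set \<Rightarrow> ('w \<Rightarrow> 's) set topology" where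
  "Lbar_top M S K = subtopology (rv_topology M S) (rv_topology M S closure_of rv_complex M S K)"

text \<open>Functions \<open>S \<rightarrow> [0,1]\<close> are represented by their extension by zero to the whole type.\<close>

definition realization :: "'s set \<Rightarrow> 's set set \<Rightarrow> ('s \<Rightarrow> real) set" where
  "realization S K = {\<alpha>. (\<forall>s\<in>S. 0 \<le> \<alpha> s \<and> \<alpha> s \<le> 1) \<and> (\<forall>s. s \<notin> S \<longrightarrow> \<alpha> s = 0) \<and>
                         {s. \<alpha> s > 0} \<in> K \<and> (\<alpha> has_sum 1) S}"

definition d1 :: "'s set \<Rightarrow> ('s \<Rightarrow> real) \<Rightarrow> ('s \<Rightarrow> real) \<Rightarrow> real" where
  "d1 S \<alpha> \<beta> = (\<Sum>\<^sub>\<infinity>s\<in>S. \<bar>\<alpha> s - \<beta> s\<bar>)"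

definition realization1_top :: "'s set \<Rightarrow> 's set set \<Rightarrow> ('s \<Rightarrow> real) topology" where
  "realization1_top S K = Metric_space.mtopology (realization S K) (d1 S)"

text \<open>The concrete model of the metric completion of \<open>|K|\<^sub>1\<close>; completeness and density of
  \<open>|K|\<^sub>1\<close> are proved below.\<close>

definition realization1_completion :: "'s set \<Rightarrow> 's set set \<Rightarrow> ('s \<Rightarrow> real) set" where
  "realization1_completion S K =
     {\<alpha>. (\<forall>s\<in>S. 0 \<le> \<alpha> s \<and> \<alpha> s \<le> 1) \<and> (\<forall>s. s \<notin> S \<longrightarrow> \<alpha> s = 0) \<and> (\<alpha> has_sum 1) S \<and>
         (\<forall>F. finite F \<and> F \<noteq> {} \<and> F \<subseteq> {s. \<alpha> s \<noteq> 0} \<longrightarrow> F \<in> K)}"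

definition realization1_completion_top :: "'s set \<Rightarrow> 's set set \<Rightarrow> ('s \<Rightarrow> real) topology" where
  "realization1_completion_top S K = Metric_space.mtopology (realization1_completion S K) (d1 S)"

definition std_simplex :: "'s set \<Rightarrow> ('s \<Rightarrow> real) set" where
  "std_simplex F = {\<alpha>. (\<forall>s\<in>F. 0 \<le> \<alpha> s \<and> \<alpha> s \<le> 1) \<and> (\<forall>s. s \<notin> F \<longrightarrow> \<alpha> s = 0) \<and> sum \<alpha> F = 1}"

text \<open>\<open>product_topology\<close> lives on functions that are \<open>undefined\<close> outside \<open>F\<close>, so the topology
  induced from \<open>[0,1]\<^sup>F\<close> is pulled back along the restriction map.\<close>

definition simplex_top :: "'s set \<Rightarrow> ('s \<Rightarrow> real) topology" where
  "simplex_top F = pullback_topology (std_simplex F) (\<lambda>\<alpha>. restrict \<alpha> F)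
                     (product_topology (\<lambda>_. top_of_set {0..1::real}) F)"

definition weak_topology :: "'s set \<Rightarrow> 's set set \<Rightarrow> ('s \<Rightarrow> real) topology" where
  "weak_topology S K =
     topology (\<lambda>U. U \<subseteq> realization S K \<and> (\<forall>F\<in>K. openin (simplex_top F) (U \<inter> std_simplex F)))"


section \<open>Notions of homotopy theory\<close>

definition sphere_base :: "nat \<Rightarrow> real" where
  "sphere_base = (\<lambda>i. if i = 0 then 1 else 0)"

definition pointed_sphere_maps :: "nat \<Rightarrow> 'a topology \<Rightarrow> 'a \<Rightarrow> ((nat \<Rightarrow> real) \<Rightarrow> 'a) set" where
  "pointed_sphere_maps n X x = {g. continuous_map (nsphere n) X g \<and> g sphere_base = x}"

definition pointed_homotopy_rel ::
    "nat \<Rightarrow> 'a topology \<Rightarrow> 'a \<Rightarrow> (((nat \<Rightarrow> real) \<Rightarrow> 'a) \<times> ((nat \<Rightarrow> real) \<Rightarrow> 'a)) set" where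
  "pointed_homotopy_rel n X x =
     {(g, h). g \<in> pointed_sphere_maps n X x \<and> h \<in> pointed_sphere_maps n X x \<and>
              homotopic_with (\<lambda>k. k sphere_base = x) (nsphere n) X g h}"

text \<open>The underlying set of \<open>\<pi>\<^sub>n(X,x)\<close>. The group structure is not needed: the map induced by a
  continuous map is always a homomorphism, so it is an isomorphism iff it is bijective.\<close>

definition homotopy_group_set :: "nat \<Rightarrow> 'a topology \<Rightarrow> 'a \<Rightarrow> ((nat \<Rightarrow> real) \<Rightarrow> 'a) set set" where
  "homotopy_group_set n X x = pointed_sphere_maps n X x // pointed_homotopy_rel n X x"

definition homotopy_group_map ::
    "nat \<Rightarrow> 'b topology \<Rightarrow> ('a \<Rightarrow> 'b) \<Rightarrow> 'a \<Rightarrow> ((nat \<Rightarrow> real) \<Rightarrow> 'a) set \<Rightarrow> ((nat \<Rightarrow> real) \<Rightarrow> 'b) set" where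
  "homotopy_group_map n Y f x C = pointed_homotopy_rel n Y (f x) `` ((\<lambda>g. f \<circ> g) ` C)"

definition path_components_map :: "'b topology \<Rightarrow> ('a \<Rightarrow> 'b) \<Rightarrow> 'a set \<Rightarrow> 'b set" where
  "path_components_map Y f C = (\<Union>x\<in>C. path_component_of_set Y (f x))"

definition weak_homotopy_equivalence ::
    "'a topology \<Rightarrow> 'b topology \<Rightarrow> ('a \<Rightarrow> 'b) \<Rightarrow> bool" where
  "weak_homotopy_equivalence X Y f \<longleftrightarrow>
     continuous_map X Y f \<and>
     bij_betw (path_components_map Y f) (path_components_of X) (path_components_of Y) \<and>
     (\<forall>x\<in>topspace X. \<forall>n\<ge>1.
        bij_betw (homotopy_group_map n Y f x) (homotopy_group_set n X x) (homotopy_group_set n Y (f x)))"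

definition homotopy_lifting_property ::
    "'z topology \<Rightarrow> 'a topology \<Rightarrow> 'b topology \<Rightarrow> ('a \<Rightarrow> 'b) \<Rightarrow> bool" where
  "homotopy_lifting_property Z E B p \<longleftrightarrow>
     (\<forall>g H. continuous_map Z E g \<and>
            continuous_map (prod_topology (top_of_set {0..1::real}) Z) B H \<and>
            (\<forall>z\<in>topspace Z. H (0, z) = p (g z)) \<longrightarrow>
        (\<exists>G. continuous_map (prod_topology (top_of_set {0..1::real}) Z) E G \<and>
             (\<forall>z\<in>topspace Z. G (0, z) = g z) \<and>
             (\<forall>t\<in>{0..1}. \<forall>z\<in>topspace Z. p (G (t, z)) = H (t, z))))"

definition serre_fibration :: "'a topology \<Rightarrow> 'b topology \<Rightarrow> ('a \<Rightarrow> 'b) \<Rightarrow> bool" where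
  "serre_fibration E B p \<longleftrightarrow>
     continuous_map E B p \<and> (\<forall>n. homotopy_lifting_property (nsphere n) E B p)"

definition has_continuous_section :: "'a topology \<Rightarrow> 'b topology \<Rightarrow> ('a \<Rightarrow> 'b) \<Rightarrow> bool" where
  "has_continuous_section E B p \<longleftrightarrow>
     (\<exists>\<sigma>. continuous_map B E \<sigma> \<and> (\<forall>b\<in>topspace B. p (\<sigma> b) = b))"

definition weakly_equivalent_step :: "'a topology \<Rightarrow> 'b topology \<Rightarrow> bool" where
  "weakly_equivalent_step X Y \<longleftrightarrow>
     (\<exists>f. weak_homotopy_equivalence X Y f) \<or> (\<exists>g. weak_homotopy_equivalence Y X g)"

text \<open>\<open>X\<close> and \<open>Y\<close> are joined by a finite zigzag of weak homotopy equivalences. The points of the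
  intermediate spaces have the type given by the first argument, as one cannot quantify over types.\<close>

definition same_weak_homotopy_type :: "'c itself \<Rightarrow> 'a topology \<Rightarrow> 'b topology \<Rightarrow> bool" where
  "same_weak_homotopy_type _ X Y \<longleftrightarrow>
     (\<exists>(Z :: 'c topology) (Z' :: 'c topology).
        weakly_equivalent_step X Z \<and> equivclp weakly_equivalent_step Z Z' \<and> weakly_equivalent_step Z' Y)"


section \<open>Sanity checks for the definitions\<close>

lemma sphere_base_in: "sphere_base \<in> topspace (nsphere n)"
proof -
  have "(\<Sum>i\<le>n. (sphere_base i)\<^sup>2) = (\<Sum>i\<le>n. if i = 0 then 1 else 0)"
    by (rule sum.cong) (auto simp: sphere_base_def)
  then show ?thesis by (auto simp: nsphere sphere_base_def)
qed

lemma topspace_simplex_top: "topspace (simplex_top F) = std_simplex F"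
  by (auto simp: simplex_top_def topspace_pullback_topology std_simplex_def PiE_def Pi_def)

lemma istopology_weak:
  "istopology (\<lambda>U. U \<subseteq> realization S K \<and> (\<forall>F\<in>K. openin (simplex_top F) (U \<inter> std_simplex F)))"
  unfolding istopology_def
proof (intro conjI allI impI, goal_cases)
  case (1 U V) then show ?case by blast
next
  case (2 U V)
  show ?case
  proof
    fix F assume "F \<in> K"
    then have "openin (simplex_top F) ((U \<inter> std_simplex F) \<inter> (V \<inter> std_simplex F))"
      using 2 \<open>F \<in> K\<close> by (metis openin_Int)
    moreover have "(U \<inter> std_simplex F) \<inter> (V \<inter> std_simplex F) = U \<inter> V \<inter> std_simplex F" by blast
    ultimately show "openin (simplex_top F) (U \<inter> V \<inter> std_simplex F)" by simp
  qed
next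
  case (3 \<U>) then show ?case by blast
next
  case (4 \<U>)
  show ?case
  proof
    fix F assume F: "F \<in> K"
    have "openin (simplex_top F) (\<Union>((\<lambda>U. U \<inter> std_simplex F) ` \<U>))"
      using 4 F by (intro openin_Union) auto
    then show "openin (simplex_top F) (\<Union>\<U> \<inter> std_simplex F)"
      by (simp add: Int_commute Int_Union)
  qed
qed

lemma openin_weak_topology:
  "openin (weak_topology S K) U \<longleftrightarrow>
     U \<subseteq> realization S K \<and> (\<forall>F\<in>K. openin (simplex_top F) (U \<inter> std_simplex F))"
  by (simp add: weak_topology_def istopology_weak topology_inverse')

lemma simplex_subset_realization:
  assumes K: "abstract_simplicial_complex S K" and F: "F \<in> K"
  shows "std_simplex F \<subseteq> realization S K"
proof
  fix \<alpha> assume a: "\<alpha> \<in> std_simplex F"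
  have F': "finite F" "F \<noteq> {}" "F \<subseteq> S" using K F by (auto simp: abstract_simplicial_complex_def)
  have sub: "{s. \<alpha> s > 0} \<subseteq> F" using a by (force simp: std_simplex_def)
  have "{s. \<alpha> s > 0} \<noteq> {}"
  proof
    assume "{s. \<alpha> s > 0} = {}"
    then have "\<not> \<alpha> s > 0" for s by blast
    then have "\<forall>s\<in>F. \<alpha> s = 0" using a by (simp add: std_simplex_def order.antisym not_less)
    then have "sum \<alpha> F = 0" by simp
    then show False using a by (simp add: std_simplex_def)
  qed
  then have "{s. \<alpha> s > 0} \<in> K"
    using K F F' sub finite_subset[OF sub] unfolding abstract_simplicial_complex_def by blast
  moreover have "(\<alpha> has_sum 1) S"
    by (rule has_sum_finite_neutralI[of F]) (use a F' in \<open>auto simp: std_simplex_def\<close>)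
  moreover have "\<alpha> s = 0" if "s \<notin> S" for s using a that F' by (auto simp: std_simplex_def)
  moreover have "0 \<le> \<alpha> s \<and> \<alpha> s \<le> 1" for s
    using a by (cases "s \<in> F") (auto simp: std_simplex_def)
  ultimately show "\<alpha> \<in> realization S K" by (simp add: realization_def)
qed

lemma topspace_weak_topology:
  assumes "abstract_simplicial_complex S K"
  shows "topspace (weak_topology S K) = realization S K"
proof -
  have "openin (weak_topology S K) (realization S K)"
    unfolding openin_weak_topology
    using simplex_subset_realization[OF assms]
    by (metis inf.absorb_iff2 openin_topspace order_refl topspace_simplex_top)
  then show ?thesis
    by (metis openin_subset openin_topspace openin_weak_topology subset_antisym)
qed

lemma realization_subset_completion:
  assumes "abstract_simplicial_complex S K"
  shows "realization S K \<subseteq> realization1_completion S K"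
proof
  fix \<alpha> assume a: "\<alpha> \<in> realization S K"
  then have "{s. \<alpha> s \<noteq> 0} = {s. \<alpha> s > 0}"
    unfolding realization_def by (smt (verit) Collect_cong mem_Collect_eq)
  with a show "\<alpha> \<in> realization1_completion S K"
    using assms unfolding realization_def realization1_completion_def abstract_simplicial_complex_def
    by auto
qed

lemma summable_d1:
  assumes "\<alpha> \<in> realization1_completion S K" "\<beta> \<in> realization1_completion S K"
  shows "(\<lambda>s. \<bar>\<alpha> s - \<beta> s\<bar>) summable_on S"
proof -
  have "(\<alpha> has_sum 1) S" "(\<beta> has_sum 1) S"
    using assms by (auto simp: realization1_completion_def)
  then have "(\<lambda>s. \<alpha> s + - \<beta> s) summable_on S"
    by (intro summable_on_add) (auto simp: summable_on_uminus intro: has_sum_imp_summable)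
  then have "(\<lambda>s. \<alpha> s - \<beta> s) summable_on S" by simp
  then show ?thesis using iffD1[OF summable_on_iff_abs_summable_on_real] by fastforce
qed

lemma Metric_space_completion: "Metric_space (realization1_completion S K) (d1 S)"
proof
  show "0 \<le> d1 S \<alpha> \<beta>" for \<alpha> \<beta> by (simp add: d1_def infsum_nonneg)
  show "d1 S \<alpha> \<beta> = d1 S \<beta> \<alpha>" for \<alpha> \<beta> by (simp add: d1_def abs_minus_commute)
next
  fix \<alpha> \<beta> assume a: "\<alpha> \<in> realization1_completion S K" and b: "\<beta> \<in> realization1_completion S K"
  show "d1 S \<alpha> \<beta> = 0 \<longleftrightarrow> \<alpha> = \<beta>"
  proof
    assume 0: "d1 S \<alpha> \<beta> = 0"
    have "\<bar>\<alpha> s - \<beta> s\<bar> = 0" if "s \<in> S" for s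
      using nonneg_infsum_le_0D[of "\<lambda>s. \<bar>\<alpha> s - \<beta> s\<bar>" S s] 0 summable_d1[OF a b] that
      by (simp add: d1_def)
    moreover have "\<alpha> s = \<beta> s" if "s \<notin> S" for s
      using a b that by (simp add: realization1_completion_def)
    ultimately show "\<alpha> = \<beta>" by fastforce
  qed (simp add: d1_def)
next
  fix \<alpha> \<beta> \<gamma> assume a: "\<alpha> \<in> realization1_completion S K" and b: "\<beta> \<in> realization1_completion S K"
    and c: "\<gamma> \<in> realization1_completion S K"
  have "d1 S \<alpha> \<gamma> \<le> (\<Sum>\<^sub>\<infinity>s\<in>S. \<bar>\<alpha> s - \<beta> s\<bar> + \<bar>\<beta> s - \<gamma> s\<bar>)"
    unfolding d1_def by (intro infsum_mono summable_on_add summable_d1[OF a c] summable_d1[OF a b] summable_d1[OF b c]) simp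
  also have "\<dots> = d1 S \<alpha> \<beta> + d1 S \<beta> \<gamma>"
    unfolding d1_def by (intro infsum_add summable_d1[OF a b] summable_d1[OF b c])
  finally show "d1 S \<alpha> \<gamma> \<le> d1 S \<alpha> \<beta> + d1 S \<beta> \<gamma>" .
qed

lemma sum_le_d1:
  assumes "\<alpha> \<in> realization1_completion S K" "\<beta> \<in> realization1_completion S K"
    and "finite F" "F \<subseteq> S"
  shows "(\<Sum>s\<in>F. \<bar>\<alpha> s - \<beta> s\<bar>) \<le> d1 S \<alpha> \<beta>"
  unfolding d1_def
  by (rule finite_sum_le_infsum) (use assms summable_d1 in auto)

lemma mcomplete_completion: "Metric_space.mcomplete (realization1_completion S K) (d1 S)"
proof -
  interpret Metric_space "realization1_completion S K" "d1 S"
    by (rule Metric_space_completion)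
  show ?thesis unfolding mcomplete_def
  proof (intro allI impI)
    fix \<sigma> assume C: "MCauchy \<sigma>"
    have inC: "\<sigma> n \<in> realization1_completion S K" for n
      using C by (auto simp: MCauchy_def)
    have cau: "\<exists>N. \<forall>m n. N \<le> m \<longrightarrow> N \<le> n \<longrightarrow> d1 S (\<sigma> m) (\<sigma> n) < e" if "e > 0" for e
      using C that by (auto simp: MCauchy_def)
    have out: "\<sigma> n s = 0" if "s \<notin> S" for n s
      using inC[of n] that by (simp add: realization1_completion_def)
    have "Cauchy (\<lambda>n. \<sigma> n s)" if "s \<in> S" for s
    proof (rule metric_CauchyI)
      fix e :: real assume "e > 0"
      then obtain N where N: "\<forall>m n. N \<le> m \<longrightarrow> N \<le> n \<longrightarrow> d1 S (\<sigma> m) (\<sigma> n) < e" using cau by blast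
      have "dist (\<sigma> m s) (\<sigma> n s) < e" if "N \<le> m" "N \<le> n" for m n
        using sum_le_d1[OF inC[of m] inC[of n], of "{s}"] N that \<open>s \<in> S\<close>
        by (fastforce simp: dist_real_def)
      then show "\<exists>M. \<forall>m\<ge>M. \<forall>n\<ge>M. dist (\<sigma> m s) (\<sigma> n s) < e" by blast
    qed
    then have "convergent (\<lambda>n. \<sigma> n s)" for s
      by (cases "s \<in> S") (auto simp: out convergent_const intro: Cauchy_convergent)
    then have "\<exists>l. (\<lambda>n. \<sigma> n s) \<longlonglongrightarrow> l" for s
      by (simp add: convergent_def)
    then obtain a where lim: "\<And>s. (\<lambda>n. \<sigma> n s) \<longlonglongrightarrow> a s" by metis
    have tail: "\<exists>N. \<forall>n\<ge>N. \<forall>F. finite F \<longrightarrow> F \<subseteq> S \<longrightarrow> (\<Sum>s\<in>F. \<bar>\<sigma> n s - a s\<bar>) \<le> e"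
      if e: "e > 0" for e
    proof -
      obtain N where N: "\<forall>m n. N \<le> m \<longrightarrow> N \<le> n \<longrightarrow> d1 S (\<sigma> m) (\<sigma> n) < e" using cau e by blast
      have "(\<Sum>s\<in>F. \<bar>\<sigma> n s - a s\<bar>) \<le> e" if n: "n \<ge> N" and F: "finite F" "F \<subseteq> S" for n F
      proof (rule LIMSEQ_le_const2)
        show "(\<lambda>m. \<Sum>s\<in>F. \<bar>\<sigma> n s - \<sigma> m s\<bar>) \<longlonglongrightarrow> (\<Sum>s\<in>F. \<bar>\<sigma> n s - a s\<bar>)"
          by (intro tendsto_intros lim)
        show "\<exists>M. \<forall>m\<ge>M. (\<Sum>s\<in>F. \<bar>\<sigma> n s - \<sigma> m s\<bar>) \<le> e"
          using sum_le_d1[OF inC[of n] inC F] N n by (meson less_imp_le order_trans)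
      qed
      then show ?thesis by blast
    qed
    have summ: "(\<lambda>s. \<bar>\<sigma> n s - a s\<bar>) summable_on S \<and> d1 S (\<sigma> n) a \<le> e"
      if "\<forall>F. finite F \<longrightarrow> F \<subseteq> S \<longrightarrow> (\<Sum>s\<in>F. \<bar>\<sigma> n s - a s\<bar>) \<le> e" for n e
    proof
      show *: "(\<lambda>s. \<bar>\<sigma> n s - a s\<bar>) summable_on S"
        using that by (intro nonneg_bdd_above_summable_on bdd_aboveI[of _ e]) auto
      show "d1 S (\<sigma> n) a \<le> e"
        unfolding d1_def by (rule infsum_le_finite_sums[OF *]) (use that in auto)
    qed
    have aS: "a summable_on S \<and> \<bar>1 - infsum a S\<bar> \<le> e" if e: "e > 0" for e
    proof -
      obtain n where n: "\<forall>F. finite F \<longrightarrow> F \<subseteq> S \<longrightarrow> (\<Sum>s\<in>F. \<bar>\<sigma> n s - a s\<bar>) \<le> e"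
        using tail[OF e] by blast
      have s1: "(\<lambda>s. \<bar>\<sigma> n s - a s\<bar>) summable_on S" and le: "d1 S (\<sigma> n) a \<le> e"
        using summ[OF n] by auto
      then have s2: "(\<lambda>s. \<sigma> n s - a s) summable_on S"
        using summable_on_iff_abs_summable_on_real by force
      have s3: "(\<sigma> n has_sum 1) S" using inC[of n] by (simp add: realization1_completion_def)
      have "(\<lambda>s. \<sigma> n s + - (\<sigma> n s - a s)) summable_on S"
        by (rule summable_on_add[OF has_sum_imp_summable[OF s3] iffD2[OF summable_on_uminus s2]])
      then have s4: "a summable_on S" by simp
      have "infsum (\<sigma> n) S = (\<Sum>\<^sub>\<infinity>s\<in>S. (\<sigma> n s - a s) + a s)" by simp
      also have "\<dots> = (\<Sum>\<^sub>\<infinity>s\<in>S. \<sigma> n s - a s) + infsum a S"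
        by (rule infsum_add[OF s2 s4])
      finally have "1 - infsum a S = (\<Sum>\<^sub>\<infinity>s\<in>S. \<sigma> n s - a s)"
        using infsumI[OF s3] by simp
      also have "\<bar>\<dots>\<bar> \<le> d1 S (\<sigma> n) a"
        using norm_infsum_bound[of "\<lambda>s. \<sigma> n s - a s" S] s1 by (simp add: d1_def)
      finally show ?thesis using s4 le by simp
    qed
    have "infsum a S = 1"
    proof (rule ccontr)
      assume "infsum a S \<noteq> 1"
      then have "\<bar>1 - infsum a S\<bar> / 2 > 0" by simp
      then have "\<bar>1 - infsum a S\<bar> \<le> \<bar>1 - infsum a S\<bar> / 2" using aS by blast
      with \<open>\<bar>1 - infsum a S\<bar> / 2 > 0\<close> show False by simp
    qed
    then have sum1: "(a has_sum 1) S" using aS[of 1] by (metis has_sum_infsum zero_less_one)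
    have "0 \<le> a s \<and> a s \<le> 1" if "s \<in> S" for s
      using LIMSEQ_le_const[OF lim, of 0 s] LIMSEQ_le_const2[OF lim, of s 1] inC that
      by (auto simp: realization1_completion_def)
    moreover have "a s = 0" if "s \<notin> S" for s
      using lim[of s] by (simp add: out[OF that] LIMSEQ_const_iff)
    moreover have "F \<in> K" if F: "finite F" "F \<noteq> {}" "F \<subseteq> {s. a s \<noteq> 0}" for F
    proof -
      have "\<forall>\<^sub>F n in sequentially. \<forall>s\<in>F. \<sigma> n s \<noteq> 0"
      proof (rule eventually_ball_finite[OF F(1)], rule ballI)
        fix s assume "s \<in> F"
        then have "a s \<noteq> 0" using F by auto
        then show "\<forall>\<^sub>F n in sequentially. \<sigma> n s \<noteq> 0"
          using tendsto_imp_eventually_ne[OF lim] by blast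
      qed
      then obtain n where "\<forall>s\<in>F. \<sigma> n s \<noteq> 0" using eventually_happens' by force
      then show ?thesis using inC[of n] F unfolding realization1_completion_def by blast
    qed
    ultimately have ain: "a \<in> realization1_completion S K"
      using sum1 by (simp add: realization1_completion_def)
    have "\<exists>N. \<forall>n\<ge>N. d1 S (\<sigma> n) a < e" if "e > 0" for e
    proof -
      have "e / 2 > 0" using that by simp
      then obtain N where N: "\<forall>n\<ge>N. \<forall>F. finite F \<longrightarrow> F \<subseteq> S \<longrightarrow> (\<Sum>s\<in>F. \<bar>\<sigma> n s - a s\<bar>) \<le> e / 2"
        using tail by blast
      have "d1 S (\<sigma> n) a \<le> e / 2" if "n \<ge> N" for n
        using summ[OF mp[OF spec[OF N] that]] by simp
      moreover have "e / 2 < e" using that by simp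
      ultimately show ?thesis using order_le_less_trans by blast
    qed
    then have "limitin mtopology \<sigma> a sequentially"
      using ain inC by (auto simp: limitin_metric eventually_sequentially)
    then show "\<exists>x. limitin mtopology \<sigma> x sequentially" by blast
  qed
qed

lemma realization_dense_in_completion:
  assumes K: "abstract_simplicial_complex S K"
  shows "realization1_completion_top S K closure_of realization S K = realization1_completion S K"
proof -
  interpret Metric_space "realization1_completion S K" "d1 S"
    by (rule Metric_space_completion)
  have "\<exists>\<beta>\<in>realization S K. d1 S \<alpha> \<beta> < r"
    if a: "\<alpha> \<in> realization1_completion S K" and r: "r > 0" for \<alpha> r
  proof -
    have sum1: "(\<alpha> has_sum 1) S" and out: "\<And>s. s \<notin> S \<Longrightarrow> \<alpha> s = 0"
      using a by (auto simp: realization1_completion_def)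
    have nn: "0 \<le> \<alpha> s" for s
      using a by (cases "s \<in> S") (auto simp: realization1_completion_def)
    define e where "e = min (r / 4) (1 / 2)"
    have e: "e > 0" "e < 1" "2 * e < r" using r by (auto simp: e_def min_def)
    obtain F' where F': "finite F'" "F' \<subseteq> S" "dist (sum \<alpha> F') 1 \<le> e"
      using has_sum_finite_approximation[OF sum1 e(1)] by blast
    define F where "F = F' \<inter> {s. \<alpha> s \<noteq> 0}"
    have F: "finite F" "F \<subseteq> S" using F' by (auto simp: F_def)
    define c where "c = sum \<alpha> F"
    have "c = sum \<alpha> F'" unfolding c_def F_def by (rule sum.mono_neutral_left) (use F' in auto)
    then have c: "c > 0" "1 - c \<le> e" using F'(3) e by (auto simp: dist_real_def)
    have pos: "\<alpha> s > 0" if "s \<in> F" for s using that nn[of s] by (auto simp: F_def less_le)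
    have "F \<noteq> {}" using c by (auto simp: c_def)
    then have FK: "F \<in> K" using a F by (auto simp: realization1_completion_def F_def)
    define \<beta> where "\<beta> s = (if s \<in> F then \<alpha> s / c else 0)" for s
    have "sum \<beta> F = sum \<alpha> F / c" unfolding sum_divide_distrib
      by (rule sum.cong) (auto simp: \<beta>_def)
    then have sb: "sum \<beta> F = 1" using c by (simp add: c_def)
    have b0: "\<beta> s \<ge> 0" for s using nn c by (simp add: \<beta>_def)
    have "\<beta> s \<le> 1" if "s \<in> F" for s
      using member_le_sum[OF that, of \<beta>] b0 F(1) sb by simp
    then have "\<beta> \<in> std_simplex F"
      using sb b0 by (simp add: std_simplex_def) (simp add: \<beta>_def)
    then have br: "\<beta> \<in> realization S K" using simplex_subset_realization[OF K FK] by blast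
    have c1: "c \<le> 1" unfolding c_def
      using finite_sum_le_has_sum[OF sum1 F(1,2)] nn by auto
    have eq: "\<bar>\<alpha> s - \<beta> s\<bar> = \<alpha> s + (if s \<in> F then \<beta> s - 2 * \<alpha> s else 0)" for s
    proof (cases "s \<in> F")
      case True
      then have "\<alpha> s \<le> \<beta> s"
        using c c1 nn[of s] mult_left_le[of c "\<alpha> s"] by (simp add: \<beta>_def pos_le_divide_eq)
      then show ?thesis using True by simp
    qed (simp add: \<beta>_def nn)
    have "((\<lambda>s. if s \<in> F then \<beta> s - 2 * \<alpha> s else 0) has_sum (1 - 2 * c)) S"
      by (rule has_sum_finite_neutralI[of F])
         (use F sb in \<open>auto simp: sum_subtractf sum_distrib_left[symmetric] c_def\<close>)
    then have "((\<lambda>s. \<bar>\<alpha> s - \<beta> s\<bar>) has_sum (1 + (1 - 2 * c))) S"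
      unfolding eq by (intro has_sum_add sum1)
    then have "d1 S \<alpha> \<beta> = 2 * (1 - c)" unfolding d1_def by (simp add: infsumI)
    also have "\<dots> \<le> 2 * e" using c by simp
    finally have "d1 S \<alpha> \<beta> < r" using e by simp
    then show ?thesis using br by blast
  qed
  then show ?thesis
    unfolding realization1_completion_top_def metric_closure_of
    using realization_subset_completion[OF K] by (simp add: set_eq_iff) blast
qed

end

(*
  Write P f for the law of a random variable f. Everything follows from one construction: there is a
  jointly continuous map (f, b) |-> T(f, b) such that T(f, b) has law b and T(f, P f) = f. Indeed,
  fix a linear order on S and a uniformly distributed u on Omega. The lexicographic rank J(f) of the
  pair (f, u) is uniformly distributed, f is the quantile function of P f evaluated at J(f), and T(f, b)
  is the quantile function of b evaluated at J(f).

  Then (t, z) |-> T(g z, H(t, z)) lifts a homotopy H of laws that starts at P g, and T(f, .) is a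
  section of P through f. Replacing f by T(x, P f) on the event u <= t, for t from 0 to 1, is a homotopy
  from the identity to T(x, .) o P that fixes x and does not enlarge the support of the law; so P is a
  pointed homotopy equivalence at each x.

  The remaining equivalences come from a retraction r of the completed realization onto finitely
  supported laws: truncate a law at half of its maximum and normalise. Locally r takes values in
  finitely many simplices, hence it is continuous for the weak topology, and the segment from a to r a
  stays in every simplex that contains a. Applying T(f, .) to that segment at a = P f deforms
  the closure of L(Omega, K) into L(Omega, K).

  That P f has total mass 1 is not automatic: it requires that a measurable map on [0,1] to a discrete
  space is essentially countably valued, which is shown with Lusin's theorem and a Vitali partition.
*)
theory Submission
  imports Defs
begin

section \<open>Weak homotopy equivalences from pointed homotopy inverses\<close>

text \<open>Homotopy groups are based, so a weak equivalence has to be detected by homotopies that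
  fix the base point. A section of P passes through just one point of each fibre, so one inverse
  cannot serve all base points. The inverse therefore depends on the base point x: T(x, .) sends the
  law of x back to x, and truncation spares the coordinates charged by x.

  The continuity of T rests on two Lipschitz bounds. Where f and g agree, J(f) and J(g) differ by at
  most the probability that f and g disagree; cumulative masses of two laws differ by at most their
  l1-distance. Hence each event {T = s} changes little, although the chosen representatives vary
  without any continuity.

  While f is replaced on the event u <= t, the law may leave the law of f; only its support is
  controlled. This is why sets of laws closed under shrinking the support are the natural setting.

  The obstacle in measure theory is an uncountable S. A map into a discrete space makes every
  preimage measurable, so a map with only null fibres would pull back even a Vitali set to a
  measurable set.\<close>

lemma homotopic_with_imp_path_component_of:
  assumes "homotopic_with P X Y h k" "x \<in> topspace X"
  shows "path_component_of Y (h x) (k x)"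
proof -
  obtain H where H: "continuous_map (prod_topology (top_of_set {0..1::real}) X) Y H"
    and H0: "\<And>x. H (0, x) = h x" "\<And>x. H (1, x) = k x"
    using assms(1) by (auto simp: homotopic_with_def)
  have "continuous_map (top_of_set {0..1}) Y (H \<circ> (\<lambda>t. (t, x)))"
    using assms(2) by (intro continuous_map_compose[OF _ H]) (simp add: continuous_map_pairwise o_def)
  then show ?thesis
    unfolding path_component_of_def pathin_def using H0 by (intro exI[of _ "H \<circ> (\<lambda>t. (t, x))"]) auto
qed

lemma path_component_of_continuous_image:
  assumes "continuous_map X Y f" "path_component_of X x y"
  shows "path_component_of Y (f x) (f y)"
proof -
  obtain p where "pathin X p" "p 0 = x" "p 1 = y"
    using assms(2) by (auto simp: path_component_of_def)
  then show ?thesis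
    unfolding path_component_of_def using pathin_compose[OF _ assms(1)]
    by (intro exI[of _ "f \<circ> p"]) auto
qed

lemma path_components_map_eq:
  assumes "continuous_map X Y f" "x \<in> topspace X"
  shows "path_components_map Y f (path_component_of_set X x) = path_component_of_set Y (f x)"
proof -
  have "path_component_of_set Y (f y) = path_component_of_set Y (f x)" if "path_component_of X x y" for y
    using path_component_of_continuous_image[OF assms(1) that]
    by (metis path_component_of_equiv)
  moreover have "x \<in> path_component_of_set X x"
    using assms(2) by (simp add: path_component_of_refl)
  ultimately show ?thesis unfolding path_components_map_def by blast
qed

section \<open>Pointed sphere maps and the maps induced on homotopy groups\<close>

lemma equiv_pointed_homotopy_rel:
  "equiv (pointed_sphere_maps n X x) (pointed_homotopy_rel n X x)"
proof (rule equivI)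
  show "pointed_homotopy_rel n X x \<subseteq> pointed_sphere_maps n X x \<times> pointed_sphere_maps n X x"
    by (auto simp: pointed_homotopy_rel_def)
  show "refl_on (pointed_sphere_maps n X x) (pointed_homotopy_rel n X x)"
    by (auto simp: pointed_homotopy_rel_def refl_on_def pointed_sphere_maps_def)
  show "sym (pointed_homotopy_rel n X x)"
    by (auto simp: pointed_homotopy_rel_def sym_def homotopic_with_symD)
  show "trans (pointed_homotopy_rel n X x)"
    by (auto simp: pointed_homotopy_rel_def trans_def intro: homotopic_with_trans)
qed

lemma pointed_homotopy_rel_compose:
  assumes f: "continuous_map X Y f" and gh: "(g, h) \<in> pointed_homotopy_rel n X x"
  shows "(f \<circ> g, f \<circ> h) \<in> pointed_homotopy_rel n Y (f x)"
proof -
  have "homotopic_with (\<lambda>k. k sphere_base = f x) (nsphere n) Y (f \<circ> g) (f \<circ> h)"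
    by (rule homotopic_with_compose_continuous_map_left[where p="\<lambda>k. k sphere_base = x", OF _ f])
      (use gh in \<open>auto simp: pointed_homotopy_rel_def\<close>)
  then show ?thesis
    using gh f continuous_map_compose[OF _ f]
    by (auto simp: pointed_homotopy_rel_def pointed_sphere_maps_def)
qed

lemma pointed_homotopy_rel_compose_left:
  assumes h: "homotopic_with (\<lambda>k. k x = y) X Y h k" and g: "g \<in> pointed_sphere_maps n X x"
  shows "(h \<circ> g, k \<circ> g) \<in> pointed_homotopy_rel n Y y"
proof -
  have g': "continuous_map (nsphere n) X g" "g sphere_base = x"
    using g by (auto simp: pointed_sphere_maps_def)
  have *: "homotopic_with (\<lambda>k. k sphere_base = y) (nsphere n) Y (h \<circ> g) (k \<circ> g)"
    by (rule homotopic_with_compose_continuous_map_right[OF h g'(1)]) (use g' in auto)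
  then show ?thesis
    using homotopic_with_imp_continuous_maps[OF *] homotopic_with_imp_property[OF *]
    by (simp add: pointed_homotopy_rel_def pointed_sphere_maps_def)
qed

text \<open>\<open>homotopy_group_map\<close> takes the image of a whole class, so that no
  representative is chosen. Pointed homotopic representatives have pointed homotopic images, hence
  any one of them determines the value.\<close>

lemma homotopy_group_map_class:
  assumes f: "continuous_map X Y f" and g: "g \<in> pointed_sphere_maps n X x"
  shows "homotopy_group_map n Y f x (pointed_homotopy_rel n X x `` {g})
           = pointed_homotopy_rel n Y (f x) `` {f \<circ> g}"
proof -
  let ?R = "pointed_homotopy_rel n X x" and ?Q = "pointed_homotopy_rel n Y (f x)"
  have "?Q `` {f \<circ> h} = ?Q `` {f \<circ> g}" if "(g, h) \<in> ?R" for h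
    using equiv_class_eq[OF equiv_pointed_homotopy_rel] pointed_homotopy_rel_compose[OF f that]
    by metis
  moreover have "(g, g) \<in> ?R"
    using equiv_pointed_homotopy_rel g by (metis equiv_def refl_onD)
  ultimately show ?thesis unfolding homotopy_group_map_def by blast
qed

text \<open>The bijection on homotopy groups at \<open>x\<close> only needs an inverse and
  homotopies that are pointed at \<open>x\<close>, so the inverse may vary with \<open>x\<close>.
  Path components have no base point: there the inverse of an arbitrary point serves, and
  \<open>empty\<close> covers the case without any point.\<close>

lemma weak_homotopy_equivalenceI:
  assumes f: "continuous_map X Y f"
    and empty: "topspace X = {} \<Longrightarrow> topspace Y = {}"
    and inverse: "\<And>x. x \<in> topspace X \<Longrightarrow> \<exists>g. continuous_map Y X g \<and>
       homotopic_with (\<lambda>k. k x = x) X X (g \<circ> f) id \<and>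
       homotopic_with (\<lambda>k. k (f x) = f x) Y Y (f \<circ> g) id"
  shows "weak_homotopy_equivalence X Y f"
  unfolding weak_homotopy_equivalence_def
proof (intro conjI ballI allI impI f)
  show "bij_betw (path_components_map Y f) (path_components_of X) (path_components_of Y)"
  proof (rule bij_betw_imageI)
    show "inj_on (path_components_map Y f) (path_components_of X)"
    proof (rule inj_onI)
      fix C D assume CD: "C \<in> path_components_of X" "D \<in> path_components_of X"
        and eq: "path_components_map Y f C = path_components_map Y f D"
      obtain x where x: "x \<in> topspace X" "C = path_component_of_set X x"
        using CD(1) by (auto simp: path_components_of_def)
      obtain y where y: "y \<in> topspace X" "D = path_component_of_set X y"
        using CD(2) by (auto simp: path_components_of_def)
      have "path_component_of_set Y (f x) = path_component_of_set Y (f y)"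
        using eq x y by (simp add: path_components_map_eq[OF f])
      then have p: "path_component_of Y (f x) (f y)"
        using y f by (metis continuous_map_image_subset_topspace image_subset_iff mem_Collect_eq path_component_of_refl)
      obtain g where g: "continuous_map Y X g" "homotopic_with (\<lambda>k. k x = x) X X (g \<circ> f) id"
        using inverse[OF x(1)] by blast
      \<comment> \<open>The homotopy chosen for \<open>x\<close> also traces a path from
        \<open>g (f y)\<close> to \<open>y\<close>, although it need not fix
        \<open>y\<close>.\<close>
      have "path_component_of X ((g \<circ> f) x) (id x)" "path_component_of X ((g \<circ> f) y) (id y)"
        using homotopic_with_imp_path_component_of[OF g(2)] x y by auto
      then have "path_component_of X x y"
        using path_component_of_continuous_image[OF g(1) p]
        by (metis comp_apply id_apply path_component_of_sym path_component_of_trans)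
      then show "C = D" using x y by (metis path_component_of_equiv)
    qed
    show "path_components_map Y f ` path_components_of X = path_components_of Y"
    proof
      show "path_components_map Y f ` path_components_of X \<subseteq> path_components_of Y"
        using f continuous_map_image_subset_topspace[OF f]
        by (auto simp: path_components_of_def path_components_map_eq)
      show "path_components_of Y \<subseteq> path_components_map Y f ` path_components_of X"
      proof
        fix D assume "D \<in> path_components_of Y"
        then obtain y where y: "y \<in> topspace Y" "D = path_component_of_set Y y"
          by (auto simp: path_components_of_def)
        obtain x where x: "x \<in> topspace X" using y empty by blast
        obtain g where g: "continuous_map Y X g" "homotopic_with (\<lambda>k. k (f x) = f x) Y Y (f \<circ> g) id"
          using inverse[OF x] by blast
        have gy: "g y \<in> topspace X" using g(1) y by (meson continuous_map_image_subset_topspace image_subset_iff)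
        have "path_component_of Y ((f \<circ> g) y) (id y)"
          using homotopic_with_imp_path_component_of[OF g(2) y(1)] .
        then have "path_components_map Y f (path_component_of_set X (g y)) = D"
          unfolding path_components_map_eq[OF f gy] y by (metis comp_apply id_apply path_component_of_equiv)
        then show "D \<in> path_components_map Y f ` path_components_of X"
          using gy by (auto simp: path_components_of_def)
      qed
    qed
  qed
next
  fix x n assume x: "x \<in> topspace X" and "(n::nat) \<ge> 1"
  let ?R = "pointed_homotopy_rel n X x" and ?Q = "pointed_homotopy_rel n Y (f x)"
  obtain r where r: "continuous_map Y X r" "homotopic_with (\<lambda>k. k x = x) X X (r \<circ> f) id"
    "homotopic_with (\<lambda>k. k (f x) = f x) Y Y (f \<circ> r) id"
    using inverse[OF x] by blast
  have rx: "r (f x) = x" using homotopic_with_imp_property[OF r(2)] by simp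
  have eqv: "equiv (pointed_sphere_maps n X x) ?R" "equiv (pointed_sphere_maps n Y (f x)) ?Q"
    by (rule equiv_pointed_homotopy_rel)+
  have fg: "f \<circ> g \<in> pointed_sphere_maps n Y (f x)" if "g \<in> pointed_sphere_maps n X x" for g
    using that continuous_map_compose[OF _ f] by (auto simp: pointed_sphere_maps_def)
  have rg: "r \<circ> g \<in> pointed_sphere_maps n X x" if "g \<in> pointed_sphere_maps n Y (f x)" for g
    using that continuous_map_compose[OF _ r(1)] by (auto simp: pointed_sphere_maps_def rx)
  show "bij_betw (homotopy_group_map n Y f x) (homotopy_group_set n X x) (homotopy_group_set n Y (f x))"
  proof (rule bij_betw_imageI)
    show "inj_on (homotopy_group_map n Y f x) (homotopy_group_set n X x)"
    proof (rule inj_onI)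
      fix C D assume CD: "C \<in> homotopy_group_set n X x" "D \<in> homotopy_group_set n X x"
        and eq: "homotopy_group_map n Y f x C = homotopy_group_map n Y f x D"
      obtain g where g: "g \<in> pointed_sphere_maps n X x" "C = ?R `` {g}"
        using CD(1) unfolding homotopy_group_set_def by (rule quotientE)
      obtain h where h: "h \<in> pointed_sphere_maps n X x" "D = ?R `` {h}"
        using CD(2) unfolding homotopy_group_set_def by (rule quotientE)
      have "(f \<circ> g, f \<circ> h) \<in> ?Q"
        using eq fg[OF g(1)] fg[OF h(1)] unfolding g(2) h(2)
          homotopy_group_map_class[OF f g(1)] homotopy_group_map_class[OF f h(1)]
        by (metis eqv(2) eq_equiv_class)
      then have "(r \<circ> (f \<circ> g), r \<circ> (f \<circ> h)) \<in> ?R"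
        using pointed_homotopy_rel_compose[OF r(1)] rx by metis
      moreover have "((r \<circ> f) \<circ> g, id \<circ> g) \<in> ?R" "((r \<circ> f) \<circ> h, id \<circ> h) \<in> ?R"
        using pointed_homotopy_rel_compose_left[OF r(2)] g h by blast+
      ultimately have "(g, h) \<in> ?R"
        using eqv(1) by (metis comp_assoc equiv_def id_comp symD transD)
      then show "C = D" using g h equiv_class_eq[OF eqv(1)] by metis
    qed
    show "homotopy_group_map n Y f x ` homotopy_group_set n X x = homotopy_group_set n Y (f x)"
    proof
      show "homotopy_group_map n Y f x ` homotopy_group_set n X x \<subseteq> homotopy_group_set n Y (f x)"
      proof
        fix D assume "D \<in> homotopy_group_map n Y f x ` homotopy_group_set n X x"
        then obtain g where "g \<in> pointed_sphere_maps n X x" "D = homotopy_group_map n Y f x (?R `` {g})"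
          unfolding homotopy_group_set_def by (auto elim!: quotientE)
        then show "D \<in> homotopy_group_set n Y (f x)"
          using fg by (simp add: homotopy_group_map_class[OF f] homotopy_group_set_def quotientI)
      qed
      show "homotopy_group_set n Y (f x) \<subseteq> homotopy_group_map n Y f x ` homotopy_group_set n X x"
      proof
        fix D assume "D \<in> homotopy_group_set n Y (f x)"
        then obtain g where g: "g \<in> pointed_sphere_maps n Y (f x)" "D = ?Q `` {g}"
          unfolding homotopy_group_set_def by (rule quotientE)
        have "((f \<circ> r) \<circ> g, id \<circ> g) \<in> ?Q"
          by (rule pointed_homotopy_rel_compose_left[OF r(3) g(1)])
        then have "homotopy_group_map n Y f x (?R `` {r \<circ> g}) = D"
          unfolding homotopy_group_map_class[OF f rg[OF g(1)]] g(2)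
          by (metis comp_assoc eqv(2) equiv_class_eq id_comp)
        then show "D \<in> homotopy_group_map n Y f x ` homotopy_group_set n X x"
          using rg[OF g(1)] by (auto simp: homotopy_group_set_def intro: quotientI)
      qed
    qed
  qed
qed

section \<open>Null sets and totally measurable functions\<close>

text \<open>Probability integral transform. The sublevel set of the continuous monotone
  \<open>cdf M\<close> is a closed half-line, and the value at its end point is \<open>t\<close>.
  The total mass is arbitrary because the lemma is later applied to restrictions to an
  event.\<close>

lemma (in finite_borel_measure) cdf_transform:
  assumes atomless: "\<And>x. measure M {x} = 0" and t: "0 \<le> t" "t \<le> measure M (space M)"
  shows "measure M {x. cdf M x \<le> t} = t"
proof -
  have cont: "isCont (cdf M) x" for x by (simp add: isCont_cdf atomless)
  have sp: "space M = UNIV" using M_is_borel by (metis sets_eq_imp_space_eq space_borel)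
  show ?thesis
  \<comment> \<open>A half-line with a finite end point arises only if the sublevel set is nonempty
    and \<open>t\<close> is exceeded somewhere; the two degenerate cases are settled
    directly.\<close>
  proof (cases "t = measure M (space M) \<or> {x. cdf M x \<le> t} = {}")
    case True
    then show ?thesis
    proof
      assume "t = measure M (space M)"
      moreover from this have "{x. cdf M x \<le> t} = space M" using cdf_bounded sp by auto
      ultimately show ?thesis by simp
    next
      assume e: "{x. cdf M x \<le> t} = {}"
      have "t = 0"
      proof (rule ccontr)
        assume "t \<noteq> 0"
        then have "eventually (\<lambda>x. cdf M x < t) at_bot"
          using t order_tendstoD(2)[OF cdf_lim_at_bot] by simp
        then obtain x where "cdf M x < t" by (metis eventually_happens trivial_limit_at_bot_linorder)
        with e show False using less_imp_le by blast
      qed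
      with e show ?thesis by simp
    qed
  next
    case False
    let ?A = "{x. cdf M x \<le> t}"
    have "eventually (\<lambda>x. t < cdf M x) at_top"
      using False t order_tendstoD(1)[OF cdf_lim_at_top] by simp
    then obtain b where b: "t < cdf M b" by (metis eventually_happens trivial_limit_at_top_linorder)
    have bdd: "bdd_above ?A"
      using b cdf_nondecreasing by (intro bdd_aboveI[of _ b]) (smt (verit) mem_Collect_eq)
    have "closed ?A"
      by (intro closed_Collect_le continuous_intros continuous_at_imp_continuous_on ballI cont)
    then have S: "Sup ?A \<in> ?A" using False bdd by (intro closed_contains_Sup) auto
    have "?A = {..Sup ?A}"
      using S cdf_nondecreasing bdd by (auto intro: cSup_upper order_trans)
    then have eq: "measure M ?A = cdf M (Sup ?A)" by (simp add: cdf_def)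
    \<comment> \<open>To the right of the end point the values exceed \<open>t\<close>, so by
      continuity the value at the end point cannot be smaller than \<open>t\<close>.\<close>
    have "t \<le> cdf M (Sup ?A)"
    proof (rule tendsto_lowerbound)
      show "(cdf M \<longlongrightarrow> cdf M (Sup ?A)) (at_right (Sup ?A))"
        using cont by (meson filterlim_at_split isCont_def)
      show "eventually (\<lambda>x. t \<le> cdf M x) (at_right (Sup ?A))"
        using bdd cSup_upper[OF _ bdd] unfolding eventually_at_filter
        by (intro always_eventually) (smt (verit) greaterThan_iff mem_Collect_eq)
    qed simp
    with S eq show ?thesis by simp
  qed
qed

text \<open>Lusin's theorem. For each basic open set, its preimage in \<open>E\<close> and the
  complement of that preimage are approximated from inside by closed sets. On the intersection
  \<open>D\<close> of these approximations every basic preimage is relatively open.\<close>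

lemma lusin_closed:
  fixes h :: "real \<Rightarrow> real"
  assumes E: "E \<in> sets lebesgue"
    and h: "\<And>U. open U \<Longrightarrow> {y \<in> E. h y \<in> U} \<in> sets lebesgue" and e: "e > 0"
  obtains D where "closed D" "D \<subseteq> E" "continuous_on D h" "E - D \<in> lmeasurable" "measure lebesgue (E - D) \<le> e"
proof -
  obtain B :: "real set set" where B: "countable B" "topological_basis B"
    using ex_countable_basis by blast
  have "B \<noteq> {}" using B(2) unfolding topological_basis_def by (metis Union_empty empty_iff open_UNIV subset_empty UNIV_I)
  define U where "U = from_nat_into B"
  have U: "open (U n)" for n
    using B(2) \<open>B \<noteq> {}\<close> by (simp add: U_def from_nat_into topological_basis_open)
  define A where "A n = {y \<in> E. h y \<in> U n}" for n
  have A: "A n \<in> sets lebesgue" "E - A n \<in> sets lebesgue" for n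
    using h[OF U] E by (auto simp: A_def)
  \<comment> \<open>Each index spends this amount twice, for the preimage and for its complement;
    the total over all indices is \<open>e\<close>.\<close>
  have e': "e / 2 * (1/2) ^ Suc n > 0" for n using e by simp
  have "\<exists>C. closed C \<and> C \<subseteq> A n \<and> A n - C \<in> lmeasurable \<and> measure lebesgue (A n - C) < e / 2 * (1/2) ^ Suc n" for n
    using sets_lebesgue_inner_closed[OF A(1) e'] e'
    by (metis emeasure_eq_measure2 ennreal_less_iff measure_nonneg)
  then obtain C where C: "\<And>n. closed (C n)" "\<And>n. C n \<subseteq> A n" "\<And>n. A n - C n \<in> lmeasurable"
    "\<And>n. measure lebesgue (A n - C n) < e / 2 * (1/2) ^ Suc n" by metis
  have "\<exists>C. closed C \<and> C \<subseteq> E - A n \<and> (E - A n) - C \<in> lmeasurable \<and> measure lebesgue ((E - A n) - C) < e / 2 * (1/2) ^ Suc n" for n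
    using sets_lebesgue_inner_closed[OF A(2) e'] e'
    by (metis emeasure_eq_measure2 ennreal_less_iff measure_nonneg)
  then obtain C' where C': "\<And>n. closed (C' n)" "\<And>n. C' n \<subseteq> E - A n" "\<And>n. (E - A n) - C' n \<in> lmeasurable"
    "\<And>n. measure lebesgue ((E - A n) - C' n) < e / 2 * (1/2) ^ Suc n" by metis
  define D where "D = (\<Inter>n. C n \<union> C' n)"
  define X where "X n = (A n - C n) \<union> ((E - A n) - C' n)" for n
  have DE: "D \<subseteq> E" using C(2)[of 0] C'(2)[of 0] by (auto simp: D_def A_def)
  have ED: "E - D = (\<Union>n. X n)"
  proof (rule set_eqI)
    fix y
    have "y \<in> C n \<union> C' n \<longleftrightarrow> y \<in> E \<and> y \<notin> X n" for n
      unfolding X_def using C(2)[of n] C'(2)[of n] by (auto simp: A_def)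
    then show "y \<in> E - D \<longleftrightarrow> y \<in> (\<Union>n. X n)"
      unfolding D_def X_def using A_def by fastforce
  qed
  have Xm: "X n \<in> lmeasurable" for n unfolding X_def using C(3) C'(3) by (intro fmeasurable.Un)
  have Xs: "measure lebesgue (X n) \<le> e * (1/2) ^ Suc n" for n
    using measure_Un_le[of "A n - C n" lebesgue "(E - A n) - C' n"] C(3,4)[of n] C'(3,4)[of n]
    unfolding X_def by (auto dest!: fmeasurableD)
  have s: "(\<lambda>n. e * (1/2) ^ Suc n) sums e"
    using sums_mult[OF power_half_series, of e] by simp
  have summ: "summable (\<lambda>n. measure lebesgue (X n))"
    by (rule summable_comparison_test'[OF sums_summable[OF s], of 0]) (use Xs in simp)
  have fin: "(\<Union>n. X n) \<in> lmeasurable" "measure lebesgue (\<Union>n. X n) \<le> e"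
  proof -
    have "measure lebesgue (\<Union> (X ` I)) \<le> e" if "finite I" for I
    proof -
      have "measure lebesgue (\<Union> (X ` I)) \<le> (\<Sum>i\<in>I. measure lebesgue (X i))"
        using measure_UNION_le[OF that] Xm by (auto dest: fmeasurableD)
      also have "\<dots> \<le> (\<Sum>i\<in>I. e * (1/2) ^ Suc i)" by (intro sum_mono Xs)
      also have "\<dots> \<le> (\<Sum>n. e * (1/2) ^ Suc n)"
        using e by (intro sum_le_suminf sums_summable[OF s] that) auto
      finally show ?thesis using sums_unique[OF s] by simp
    qed
    then show "(\<Union>n. X n) \<in> lmeasurable" "measure lebesgue (\<Union>n. X n) \<le> e"
      using fmeasurable_UN_bound[of UNIV X lebesgue e] measure_UN_bound[of UNIV X lebesgue e] Xm by auto
  qed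
  have "continuous_on D h"
    unfolding continuous_on_open_invariant
  proof (intro allI impI)
    fix V :: "real set" assume "open V"
    then obtain B' where B': "B' \<subseteq> B" "\<Union>B' = V" using B(2) unfolding topological_basis_def by blast
    have op: "\<exists>T. open T \<and> T \<inter> D = {y \<in> D. h y \<in> W}" if "W \<in> B" for W
    proof -
      obtain n where n: "W = U n"
        using from_nat_into_surj[OF B(1) \<open>W \<in> B\<close>] by (auto simp: U_def)
      \<comment> \<open>Points of \<open>D\<close> lie in \<open>C n\<close> or \<open>C' n\<close>,
        according to whether they belong to \<open>A n\<close>. Removing the closed set
        \<open>C' n\<close> therefore leaves exactly the preimage.\<close>
      have "(- C' n) \<inter> D = {y \<in> D. h y \<in> W}"
        using C(2)[of n] C'(2)[of n] DE unfolding n by (fastforce simp: D_def A_def)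
      then show ?thesis using C'(1) by (intro exI[of _ "- C' n"]) auto
    qed
    then obtain T where T: "\<And>W. W \<in> B \<Longrightarrow> open (T W) \<and> T W \<inter> D = {y \<in> D. h y \<in> W}" by metis
    have "open (\<Union>(T ` B'))" using T B' by (intro open_UN) auto
    moreover have "\<Union>(T ` B') \<inter> D = h -` V \<inter> D" using T B' by blast
    ultimately show "\<exists>A. open A \<and> A \<inter> D = h -` V \<inter> D" by blast
  qed
  moreover have "closed D" unfolding D_def by (intro closed_INT ballI closed_Un C C')
  ultimately show ?thesis using that[of D] DE ED fin by simp
qed

text \<open>Vitali's argument: infinitely many rational translates of \<open>C\<close> are disjoint,
  have equal measure and stay in a bounded set.\<close>

lemma rational_translates_null:
  fixes C :: "real set"
  assumes C: "compact C" and inj: "\<And>x y. x \<in> C \<Longrightarrow> y \<in> C \<Longrightarrow> x - y \<in> \<rat> \<Longrightarrow> x = y"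
  shows "measure lebesgue C = 0"
proof (rule ccontr)
  assume "measure lebesgue C \<noteq> 0"
  then have pos: "measure lebesgue C > 0" by (simp add: zero_less_measure_iff)
  obtain a where a: "C \<subseteq> {-a..a}"
  proof -
    obtain a where "\<forall>x\<in>C. \<bar>x\<bar> \<le> a" using compact_imp_bounded[OF C] by (auto simp: bounded_iff)
    then have "C \<subseteq> {-a..a}" by (auto simp: abs_le_iff minus_le_iff)
    then show ?thesis by (rule that)
  qed
  \<comment> \<open>The shifts 1, 1/2, 1/3, ... are distinct rationals in (0,1], so all translates
    stay in \<open>{-a..a+1}\<close>.\<close>
  define X where "X i = (\<lambda>x. (1 / real (Suc i)) + x) ` C" for i
  have Cm: "C \<in> lmeasurable" using C by (simp add: lmeasurable_compact)
  have Xm: "X i \<in> lmeasurable" for i unfolding X_def using Cm by (rule measurable_translation)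
  have disj: "X i \<inter> X j = {}" if "i \<noteq> j" for i j
  proof (rule ccontr)
    assume "X i \<inter> X j \<noteq> {}"
    then obtain x y where xy: "x \<in> C" "y \<in> C" "1 / real (Suc i) + x = 1 / real (Suc j) + y"
      by (auto simp: X_def)
    then have "x - y = 1 / real (Suc j) - 1 / real (Suc i)" by simp
    then have "x - y \<in> \<rat>" by simp
    then have "x = y" using inj xy by blast
    with xy that show False by simp
  qed
  obtain n where n: "real n * measure lebesgue C > \<bar>2 * a + 1\<bar>"
    using pos by (metis reals_Archimedean3)
  have "real n * measure lebesgue C = (\<Sum>i<n. measure lebesgue (X i))"
    by (simp add: X_def measure_translation)
  also have "\<dots> = measure lebesgue (\<Union>i<n. X i)"
    using disj Xm by (intro measure_UNION'[symmetric]) (auto simp: pairwise_def disjnt_def)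
  also have "\<dots> \<le> measure lebesgue {-a..a+1}"
  proof (rule measure_mono_fmeasurable)
    have "1 / real (Suc i) + x \<in> {-a..a+1}" if "x \<in> C" for i x
    proof -
      have "-a \<le> x" "x \<le> a" using a that by auto
      moreover have "0 \<le> 1 / real (Suc i)" "1 / real (Suc i) \<le> 1" by simp_all
      ultimately show ?thesis unfolding atLeastAtMost_iff by linarith
    qed
    then show "(\<Union>i<n. X i) \<subseteq> {-a..a+1}" by (auto simp: X_def)
    show "(\<Union>i<n. X i) \<in> sets lebesgue" using Xm by (auto dest: fmeasurableD)
  qed simp
  also have "\<dots> \<le> \<bar>2 * a + 1\<bar>" by simp
  finally show False using n by simp
qed

text \<open>If \<open>E\<close> had positive measure, composing \<open>k\<close> with its own
  distribution function would give a map \<open>h\<close> with uniform law and with all preimages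
  measurable, including those of the translates of a Vitali transversal. One of these has positive
  measure, and Lusin's theorem finds in it a closed set \<open>D\<close> of positive measure on
  which \<open>h\<close> is continuous. The image of \<open>D\<close> is compact and meets each
  rational class at most once, hence is null; but a map with uniform law cannot send a set of
  positive measure into a null set.\<close>

lemma null_of_all_preimages_measurable:
  fixes k :: "real \<Rightarrow> real"
  assumes E: "E \<in> sets lebesgue" "E \<subseteq> {0..1}"
    and meas: "\<And>X. {y \<in> E. k y \<in> X} \<in> sets lebesgue"
    and fibres: "\<And>x. measure lebesgue {y \<in> E. k y = x} = 0"
  shows "measure lebesgue E = 0"
proof (rule ccontr)
  assume m0: "measure lebesgue E \<noteq> 0"
  have Efin: "A \<in> lmeasurable" if "A \<in> sets lebesgue" "A \<subseteq> E" for A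
    using that E(2) bounded_subset[OF bounded_closed_interval, of A 0 1]
    by (intro bounded_set_imp_lmeasurable) auto
  define P where "P = uniform_measure lebesgue E"
  have Elm: "E \<in> lmeasurable" using Efin E by blast
  have em: "emeasure lebesgue E \<noteq> 0" "emeasure lebesgue E \<noteq> \<infinity>"
    using m0 fmeasurableD2[OF Elm] by (auto simp: measure_def)
  interpret P: prob_space P unfolding P_def using em by (rule prob_space_uniform_measure)
  have Pmeas: "measure P A = measure lebesgue (E \<inter> A) / measure lebesgue E" if "A \<in> sets lebesgue" for A
    unfolding P_def using E em that by (intro measure_uniform_measure) auto
  have [simp]: "sets P = sets lebesgue" "space P = UNIV" by (auto simp: P_def)
  \<comment> \<open>The value off \<open>E\<close> is invisible to \<open>P\<close>, which gives no
    mass there; a constant keeps all preimages measurable.\<close>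
  define k' where "k' y = (if y \<in> E then k y else 0)" for y
  have k'm: "k' -` X \<in> sets lebesgue" for X
  proof -
    have "k' -` X = {y \<in> E. k y \<in> X} \<union> (if 0 \<in> X then UNIV - E else {})"
      by (auto simp: k'_def split: if_splits)
    moreover have "UNIV - E \<in> sets lebesgue" using sets.compl_sets[OF E(1)] by simp
    ultimately show ?thesis using meas[of X] by (cases "0 \<in> X") (simp_all add: sets.Un)
  qed
  have k'b: "k' \<in> borel_measurable P" using k'm by (intro measurableI) auto
  define N where "N = distr P borel k'"
  interpret N: real_distribution N unfolding N_def using k'b by (intro P.real_distribution_distr)
  define F where "F = cdf N"
  define h where "h y = F (k y)" for y
  have Fb: "F \<in> borel_measurable borel" unfolding F_def
    by (intro borel_measurable_mono monoI N.cdf_nondecreasing)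
  have Nx: "measure N {x} = 0" for x
  proof -
    have "measure N {x} = measure lebesgue (E \<inter> k' -` {x}) / measure lebesgue E"
      unfolding N_def using k'm by (subst measure_distr[OF k'b]) (auto simp: Pmeas)
    also have "E \<inter> k' -` {x} = {y \<in> E. k y = x}" by (auto simp: k'_def)
    finally show ?thesis by (simp add: fibres)
  qed
  have Fk: "F \<circ> k' \<in> borel_measurable P" using k'b Fb by (rule measurable_comp)
  \<comment> \<open>This is the purpose of \<open>F\<close>: the uniform law is absolutely
    continuous, so preimages of null sets are null, which may fail for \<open>k\<close>
    itself.\<close>
  have unif: "distributed P lborel (F \<circ> k') (\<lambda>x. indicator {0..1} x / measure lborel {0..1::real})"
  proof (rule P.uniform_distrI_borel_atLeastAtMost)
    fix t :: real assume t: "0 \<le> t" "t \<le> 1"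
    have "measure N {x. F x \<le> t} = t"
      unfolding F_def using N.cdf_transform[OF Nx] t N.prob_space by simp
    then show "P.prob {x \<in> space P. (F \<circ> k') x \<le> t} = (t - 0) / (1 - 0)"
      unfolding N_def using Fb by (subst (asm) measure_distr[OF k'b]) (auto simp: vimage_def)
  qed (use Fk in auto)
  have null: "measure lebesgue {y \<in> E. h y \<in> Z} = 0" if Z: "Z \<in> null_sets lborel" for Z
  proof -
    have "Z \<in> null_sets (distr P lborel (F \<circ> k'))"
      unfolding distributed_distr_eq_density[OF unif]
      by (rule subsetD[OF absolutely_continuousI_density[unfolded absolutely_continuous_def] Z]) measurable
    then have "emeasure (distr P lborel (F \<circ> k')) Z = 0" by auto
    then have "emeasure P ((F \<circ> k') -` Z) = 0"
      using Z Fk by (subst (asm) emeasure_distr) (auto simp: null_sets_def)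
    then have "measure P ((F \<circ> k') -` Z) = 0" by (simp add: measure_def)
    moreover have "(F \<circ> k') -` Z \<in> sets lebesgue" using k'm[of "F -` Z"] by (simp add: vimage_comp)
    ultimately have "measure lebesgue (E \<inter> (F \<circ> k') -` Z) = 0" using m0 by (simp add: Pmeas)
    also have "E \<inter> (F \<circ> k') -` Z = {y \<in> E. h y \<in> Z}" by (auto simp: k'_def h_def)
    finally show ?thesis .
  qed
  have h01: "h y \<in> {0..1}" for y
    unfolding h_def F_def using N.cdf_nonneg N.cdf_bounded_prob by auto
  have hm: "{y \<in> E. h y \<in> X} \<in> sets lebesgue" for X
    using meas[of "F -` X"] by (simp add: h_def)
  define \<rho> where "\<rho> x = (SOME y. x - y \<in> \<rat>)" for x :: real
  have \<rho>: "x - \<rho> x \<in> \<rat>" for x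
    unfolding \<rho>_def by (rule someI[of _ x]) simp
  have \<rho>_eq: "\<rho> x = \<rho> y" if "x - y \<in> \<rat>" for x y
  proof -
    have "x - z \<in> \<rat> \<longleftrightarrow> y - z \<in> \<rat>" for z
      using Rats_diff[OF _ that, of "x - z"] Rats_add[OF _ that, of "y - z"] by auto
    then show ?thesis by (simp add: \<rho>_def)
  qed
  \<comment> \<open>\<open>{x. x - \<rho> x = q}\<close> is the translate by \<open>q\<close> of the
    transversal chosen by \<open>\<rho>\<close>. For rational \<open>q\<close> these translates
    partition the reals, so countably many sets \<open>W q\<close> cover \<open>E\<close>.\<close>
  define W where "W q = {y \<in> E. h y \<in> {x. x - \<rho> x = q}}" for q
  have Wm: "W q \<in> lmeasurable" for q unfolding W_def by (rule Efin[OF hm]) auto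
  have "E = (\<Union>q\<in>\<rat>. W q)" using \<rho> by (auto simp: W_def)
  moreover have "(\<Union>q\<in>\<rat>. W q) \<in> null_sets lebesgue" if "\<forall>q\<in>\<rat>. W q \<in> null_sets lebesgue"
    using that countable_rat by (intro null_sets_UN') auto
  moreover have "E \<notin> null_sets lebesgue" using em(1) by auto
  ultimately obtain q where q: "W q \<notin> null_sets lebesgue" by auto
  have "measure lebesgue (W q) \<noteq> 0"
  proof
    assume "measure lebesgue (W q) = 0"
    then have "emeasure lebesgue (W q) = 0" using emeasure_eq_measure2[OF Wm] by simp
    with q show False using fmeasurableD[OF Wm] by (auto intro: null_setsI)
  qed
  then have Wq: "measure lebesgue (W q) > 0" using zero_less_measure_iff by blast
  have hW: "{y \<in> W q. h y \<in> U} \<in> sets lebesgue" for U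
  proof -
    have "{y \<in> W q. h y \<in> U} = {y \<in> E. h y \<in> U \<inter> {x. x - \<rho> x = q}}" by (auto simp: W_def)
    then show ?thesis using hm by metis
  qed
  obtain D where D: "closed D" "D \<subseteq> W q" "continuous_on D h"
    and small: "W q - D \<in> lmeasurable" "measure lebesgue (W q - D) \<le> measure lebesgue (W q) / 2"
    using lusin_closed[OF fmeasurableD[OF Wm] hW half_gt_zero[OF Wq]] .
  have "D \<subseteq> {0..1}" using D(2) E(2) by (auto simp: W_def)
  then have "compact D" using D(1) bounded_subset[OF bounded_closed_interval, of D 0 1]
    by (simp add: compact_eq_bounded_closed)
  then have cC: "compact (h ` D)" using D(3) by (rule compact_continuous_image[rotated])
  have "measure lebesgue (h ` D) = 0"
  proof (rule rational_translates_null[OF cC])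
    fix x y assume xy: "x \<in> h ` D" "y \<in> h ` D" "x - y \<in> \<rat>"
    then have "x - \<rho> x = q" "y - \<rho> y = q" using D(2) by (auto simp: W_def)
    with \<rho>_eq[OF xy(3)] show "x = y" by simp
  qed
  then have "h ` D \<in> null_sets lborel"
    using cC emeasure_compact_finite[OF cC]
    by (auto simp: null_sets_def measure_def enn2real_eq_0_iff borel_compact)
  then have "measure lebesgue {y \<in> E. h y \<in> h ` D} = 0" by (rule null)
  moreover have "measure lebesgue D \<le> measure lebesgue {y \<in> E. h y \<in> h ` D}"
    using D(1,2) hm by (intro measure_mono_fmeasurable Efin) (auto simp: W_def)
  moreover have "measure lebesgue (W q) = measure lebesgue (W q - D) + measure lebesgue D"
    using measurable_measure_Diff[of "W q" lebesgue D] Wm D(1,2) by simp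
  ultimately show False using small(2) Wq by simp
qed

section \<open>The simplex of probability laws\<close>

text \<open>The full simplex on \<open>S\<close>. Its completed realization consists of all laws, so
  the metric facts about completions apply to \<open>prob_simplex\<close>.\<close>

definition simplex_complex :: "'s set \<Rightarrow> 's set set" where
  "simplex_complex S = {F. finite F \<and> F \<noteq> {} \<and> F \<subseteq> S}"

text \<open>The common ambient space of both realizations: limits and continuity are treated here
  once, and the two cases arise as subspaces.\<close>

definition prob_simplex :: "'s set \<Rightarrow> ('s \<Rightarrow> real) set" where
  "prob_simplex S = {\<alpha>. (\<forall>s. 0 \<le> \<alpha> s) \<and> (\<forall>s. s \<notin> S \<longrightarrow> \<alpha> s = 0) \<and> (\<alpha> has_sum 1) S}"

definition prob_simplex_top :: "'s set \<Rightarrow> ('s \<Rightarrow> real) topology" where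
  "prob_simplex_top S = Metric_space.mtopology (prob_simplex S) (d1 S)"

lemma prob_simplex_nonneg: "\<alpha> \<in> prob_simplex S \<Longrightarrow> 0 \<le> \<alpha> s"
  and prob_simplex_outside: "\<alpha> \<in> prob_simplex S \<Longrightarrow> s \<notin> S \<Longrightarrow> \<alpha> s = 0"
  and prob_simplex_has_sum: "\<alpha> \<in> prob_simplex S \<Longrightarrow> (\<alpha> has_sum 1) S"
  by (auto simp: prob_simplex_def)

lemma prob_simplex_sum_le_1:
  assumes "\<alpha> \<in> prob_simplex S" "finite F"
  shows "sum \<alpha> F \<le> 1"
proof -
  have "sum \<alpha> F = sum \<alpha> (F \<inter> S)"
    using assms by (intro sum.mono_neutral_right) (auto simp: prob_simplex_outside)
  also have "\<dots> \<le> 1"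
    using finite_sum_le_has_sum[OF prob_simplex_has_sum[OF assms(1)], of "F \<inter> S"] assms
    by (auto simp: prob_simplex_nonneg)
  finally show ?thesis .
qed

lemma prob_simplex_le_1: "\<alpha> \<in> prob_simplex S \<Longrightarrow> \<alpha> s \<le> 1"
  using prob_simplex_sum_le_1[of \<alpha> S "{s}"] by simp

lemma prob_simplex_eq_completion: "prob_simplex S = realization1_completion S (simplex_complex S)"
  unfolding realization1_completion_def simplex_complex_def
proof (intro subset_antisym subsetI, goal_cases)
  case (1 \<alpha>)
  then show ?case using prob_simplex_le_1[OF 1] prob_simplex_outside[OF 1]
    by (auto simp: prob_simplex_def)
next
  case (2 \<alpha>)
  then have "0 \<le> \<alpha> s" for s by (cases "s \<in> S") auto
  with 2 show ?case by (auto simp: prob_simplex_def)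
qed

lemma completion_subset_prob_simplex: "realization1_completion S K \<subseteq> prob_simplex S"
proof
  fix \<alpha> assume "\<alpha> \<in> realization1_completion S K"
  then have "0 \<le> \<alpha> s" for s by (cases "s \<in> S") (auto simp: realization1_completion_def)
  then show "\<alpha> \<in> prob_simplex S"
    using \<open>\<alpha> \<in> _\<close> by (auto simp: prob_simplex_def realization1_completion_def)
qed

lemma realization_eq: "realization S K = {\<alpha> \<in> prob_simplex S. {s. \<alpha> s \<noteq> 0} \<in> K}"
proof (intro subset_antisym subsetI, goal_cases)
  case (1 \<alpha>)
  then have nn: "0 \<le> \<alpha> s" for s by (cases "s \<in> S") (auto simp: realization_def)
  then have "{s. \<alpha> s \<noteq> 0} = {s. \<alpha> s > 0}" by (auto simp: less_le)
  with 1 nn show ?case by (auto simp: prob_simplex_def realization_def)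
next
  case (2 \<alpha>)
  then have a: "\<alpha> \<in> prob_simplex S" by simp
  then have "{s. \<alpha> s \<noteq> 0} = {s. \<alpha> s > 0}" using prob_simplex_nonneg[OF a] by (auto simp: less_le)
  with 2 show ?case using prob_simplex_le_1[OF a] by (auto simp: prob_simplex_def realization_def)
qed

lemma completion_eq:
  "realization1_completion S K =
     {\<alpha> \<in> prob_simplex S. \<forall>F. finite F \<and> F \<noteq> {} \<and> F \<subseteq> {s. \<alpha> s \<noteq> 0} \<longrightarrow> F \<in> K}"
proof (intro subset_antisym subsetI, goal_cases)
  case (1 \<alpha>)
  then show ?case using subsetD[OF completion_subset_prob_simplex 1] by (simp add: realization1_completion_def)
next
  case (2 \<alpha>)
  then have a: "\<alpha> \<in> prob_simplex S" by simp
  with 2 show ?case using prob_simplex_le_1[OF a] by (auto simp: prob_simplex_def realization1_completion_def)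
qed

interpretation prob_simplex: Metric_space "prob_simplex S" "d1 S" for S
  unfolding prob_simplex_eq_completion by (rule Metric_space_completion)

lemma topspace_prob_simplex_top [simp]: "topspace (prob_simplex_top S) = prob_simplex S"
  by (simp add: prob_simplex_top_def)

lemma mtopology_subset_prob_simplex:
  assumes "A \<subseteq> prob_simplex S"
  shows "Metric_space.mtopology A (d1 S) = subtopology (prob_simplex_top S) A"
proof -
  interpret Submetric "prob_simplex S" "d1 S" A
    using assms by unfold_locales
  show ?thesis using mtopology_submetric by (simp add: prob_simplex_top_def)
qed

lemma realization1_top_eq: "realization1_top S K = subtopology (prob_simplex_top S) (realization S K)"
  unfolding realization1_top_def by (rule mtopology_subset_prob_simplex) (auto simp: realization_eq)

lemma completion_top_eq:
  "realization1_completion_top S K = subtopology (prob_simplex_top S) (realization1_completion S K)"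
  unfolding realization1_completion_top_def
  by (rule mtopology_subset_prob_simplex[OF completion_subset_prob_simplex])

lemma summable_prob_simplex:
  "\<alpha> \<in> prob_simplex S \<Longrightarrow> \<beta> \<in> prob_simplex S \<Longrightarrow> (\<lambda>s. \<bar>\<alpha> s - \<beta> s\<bar>) summable_on S"
  unfolding prob_simplex_eq_completion by (rule summable_d1)

lemma abs_diff_le_d1:
  assumes "\<alpha> \<in> prob_simplex S" "\<beta> \<in> prob_simplex S"
  shows "\<bar>\<alpha> s - \<beta> s\<bar> \<le> d1 S \<alpha> \<beta>"
proof (cases "s \<in> S")
  case True
  then show ?thesis
    using sum_le_d1[of \<alpha> S "simplex_complex S" \<beta> "{s}"] assms by (simp add: prob_simplex_eq_completion)
next
  case False
  then show ?thesis using assms by (simp add: prob_simplex_outside prob_simplex.nonneg)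
qed

text \<open>Since both total masses are \<open>1\<close>, mass that is missing outside of \<open>F\<close> is controlled by mass
  inside of \<open>F\<close>.\<close>
lemma d1_le_finite:
  assumes a: "\<alpha> \<in> prob_simplex S" and b: "\<beta> \<in> prob_simplex S" and F: "finite F" "F \<subseteq> S"
  shows "d1 S \<alpha> \<beta> \<le> 2 * (\<Sum>s\<in>F. \<bar>\<alpha> s - \<beta> s\<bar>) + 2 * (1 - sum \<beta> F)"
proof -
  \<comment> \<open>Off \<open>F\<close> the difference is majorised by
    \<open>\<alpha> + \<beta>\<close>; adding \<open>?r\<close> turns this bound into an equality on
    \<open>F\<close>.\<close>
  let ?r = "\<lambda>s. if s \<in> F then \<bar>\<alpha> s - \<beta> s\<bar> - \<alpha> s - \<beta> s else 0"
  have "(?r has_sum (sum ?r F)) S"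
    by (rule has_sum_finite_neutralI[of F]) (use F in auto)
  then have s: "((\<lambda>s. (\<alpha> s + \<beta> s) + ?r s) has_sum ((1 + 1) + sum ?r F)) S"
    by (intro has_sum_add prob_simplex_has_sum[OF a] prob_simplex_has_sum[OF b])
  have "((\<lambda>s. \<bar>\<alpha> s - \<beta> s\<bar>) has_sum d1 S \<alpha> \<beta>) S"
    unfolding d1_def using summable_prob_simplex[OF a b] by simp
  moreover have "\<bar>\<alpha> s - \<beta> s\<bar> \<le> (\<alpha> s + \<beta> s) + ?r s" for s
    using prob_simplex_nonneg[OF a, of s] prob_simplex_nonneg[OF b, of s] by (auto simp: abs_le_iff)
  ultimately have "d1 S \<alpha> \<beta> \<le> (1 + 1) + sum ?r F"
    by (intro has_sum_mono[OF _ s]) blast+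
  then have "d1 S \<alpha> \<beta> \<le> 2 + sum ?r F" by simp
  also have "sum ?r F = (\<Sum>s\<in>F. \<bar>\<alpha> s - \<beta> s\<bar> - (\<alpha> s - \<beta> s) - 2 * \<beta> s)" by (intro sum.cong) auto
  also have "\<dots> = (\<Sum>s\<in>F. \<bar>\<alpha> s - \<beta> s\<bar>) - (\<Sum>s\<in>F. \<alpha> s - \<beta> s) - 2 * sum \<beta> F"
    by (simp add: sum_subtractf sum_distrib_left)
  finally have "d1 S \<alpha> \<beta> \<le> 2 + ((\<Sum>s\<in>F. \<bar>\<alpha> s - \<beta> s\<bar>) - (\<Sum>s\<in>F. \<alpha> s - \<beta> s) - 2 * sum \<beta> F)" .
  moreover have "- (\<Sum>s\<in>F. \<alpha> s - \<beta> s) \<le> (\<Sum>s\<in>F. \<bar>\<alpha> s - \<beta> s\<bar>)"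
    by (subst sum_negf[symmetric], rule sum_mono) auto
  moreover have "d \<le> 2 + (x - y - 2 * b) \<Longrightarrow> - y \<le> x \<Longrightarrow> d \<le> 2 * x + 2 * (1 - b)" for d x y b :: real
    by simp
  ultimately show ?thesis by blast
qed

lemma prob_simplex_finite_approx:
  assumes "\<alpha> \<in> prob_simplex S" "e > 0"
  obtains F where "finite F" "F \<subseteq> S" "1 - sum \<alpha> F < e"
proof -
  obtain F where F: "finite F" "F \<subseteq> S" "dist (sum \<alpha> F) 1 \<le> e / 2"
    using has_sum_finite_approximation[OF prob_simplex_has_sum[OF assms(1)], of "e / 2"] assms(2) by auto
  have "\<bar>sum \<alpha> F - 1\<bar> \<le> e / 2" using F(3) by (simp add: dist_real_def)
  then have "1 - sum \<alpha> F < e" using assms(2) by linarith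
  then show ?thesis using F(1,2) that by blast
qed

text \<open>Scheffe's lemma along an arbitrary filter. A finite set \<open>G\<close> misses less
  than e/4 of the mass of \<open>\<beta>\<close>, and convergence on \<open>G\<close> makes the
  distance smaller than 2 * e/4 + 2 * e/4. Continuity of maps into the simplex thus becomes a matter
  of single coordinates.\<close>

lemma limitin_prob_simplex_iff:
  "limitin (prob_simplex_top S) f \<beta> F \<longleftrightarrow>
     \<beta> \<in> prob_simplex S \<and> (\<forall>\<^sub>F z in F. f z \<in> prob_simplex S) \<and> (\<forall>s. ((\<lambda>z. f z s) \<longlongrightarrow> \<beta> s) F)"
  (is "?L \<longleftrightarrow> ?R")
proof
  assume L: ?L
  then have b: "\<beta> \<in> prob_simplex S"
    and ev: "\<And>e. e > 0 \<Longrightarrow> \<forall>\<^sub>F z in F. f z \<in> prob_simplex S \<and> d1 S (f z) \<beta> < e"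
    by (auto simp: prob_simplex_top_def prob_simplex.limitin_metric)
  have "((\<lambda>z. f z s) \<longlongrightarrow> \<beta> s) F" for s
  proof (rule tendstoI)
    fix e :: real assume "e > 0"
    from ev[OF this] show "\<forall>\<^sub>F z in F. dist (f z s) (\<beta> s) < e"
      by eventually_elim (unfold dist_real_def, use abs_diff_le_d1[OF _ b] le_less_trans in blast)
  qed
  moreover have "\<forall>\<^sub>F z in F. f z \<in> prob_simplex S" using ev[of 1] by (auto elim: eventually_mono)
  ultimately show ?R using b by blast
next
  assume R: ?R
  have "\<forall>\<^sub>F z in F. f z \<in> prob_simplex S \<and> d1 S (f z) \<beta> < e" if e: "e > 0" for e
  proof -
    have "e / 4 > 0" using e by simp
    then obtain G where G: "finite G" "G \<subseteq> S" "1 - sum \<beta> G < e / 4"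
      using prob_simplex_finite_approx R by blast
    have "((\<lambda>z. \<Sum>s\<in>G. \<bar>f z s - \<beta> s\<bar>) \<longlongrightarrow> (\<Sum>s\<in>G. \<bar>\<beta> s - \<beta> s\<bar>)) F"
      using R by (intro tendsto_intros) auto
    then have "\<forall>\<^sub>F z in F. (\<Sum>s\<in>G. \<bar>f z s - \<beta> s\<bar>) < e / 4"
      using e by (intro order_tendstoD) auto
    with R have "\<forall>\<^sub>F z in F. f z \<in> prob_simplex S \<and> (\<Sum>s\<in>G. \<bar>f z s - \<beta> s\<bar>) < e / 4"
      by (auto intro: eventually_conj)
    then show ?thesis
    proof eventually_elim
      case (elim z)
      then have "d1 S (f z) \<beta> \<le> 2 * (\<Sum>s\<in>G. \<bar>f z s - \<beta> s\<bar>) + 2 * (1 - sum \<beta> G)"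
        using R G by (intro d1_le_finite) auto
      with elim G(3) show ?case by auto
    qed
  qed
  with R show ?L by (auto simp: prob_simplex_top_def prob_simplex.limitin_metric)
qed

lemma eventually_atin_topspace: "\<forall>\<^sub>F z in atin X a. z \<in> topspace X"
  using openin_topspace by (auto simp: eventually_atin)

lemma continuous_map_prob_simplex_iff:
  "continuous_map X (prob_simplex_top S) f \<longleftrightarrow>
     f \<in> topspace X \<rightarrow> prob_simplex S \<and> (\<forall>s. continuous_map X euclideanreal (\<lambda>z. f z s))"
proof -
  have "\<forall>\<^sub>F z in atin X a. f z \<in> prob_simplex S" if "f \<in> topspace X \<rightarrow> prob_simplex S" for a
    by (rule eventually_mono[OF eventually_atin_topspace]) (use that in auto)
  then show ?thesis
    unfolding continuous_map_atin limitin_prob_simplex_iff by (auto simp: Pi_iff)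
qed

section \<open>Contraction onto finitely supported laws\<close>

lemma prob_simplex_Collect_ge_finite:
  assumes "\<alpha> \<in> prob_simplex S" "c > 0"
  shows "finite {s. c \<le> \<alpha> s}"
proof (rule ccontr)
  assume inf: "infinite {s. c \<le> \<alpha> s}"
  obtain n where n: "real n * c > 1" using assms(2) reals_Archimedean3 by blast
  obtain F where F: "finite F" "card F = n" "F \<subseteq> {s. c \<le> \<alpha> s}"
    using infinite_arbitrarily_large[OF inf] by blast
  have "real n * c = (\<Sum>s\<in>F. c)" using F by simp
  also have "\<dots> \<le> sum \<alpha> F" by (rule sum_mono) (use F in auto)
  finally show False using n prob_simplex_sum_le_1[OF assms(1) F(1)] by simp
qed

lemma prob_simplex_support_nonempty:
  assumes "\<alpha> \<in> prob_simplex S" shows "{s. \<alpha> s \<noteq> 0} \<noteq> {}"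
proof
  assume "{s. \<alpha> s \<noteq> 0} = {}"
  then have "\<alpha> = (\<lambda>s. 0)" by auto
  then have "(\<alpha> has_sum 0) S" by (auto intro: has_sum_0)
  then show False using prob_simplex_has_sum[OF assms] has_sum_unique by fastforce
qed

lemma prob_simplex_finite_support:
  assumes "\<alpha> \<in> prob_simplex S" "finite F" "{s. \<alpha> s \<noteq> 0} \<subseteq> F"
  shows "sum \<alpha> F = 1"
proof -
  have "{s. \<alpha> s \<noteq> 0} \<subseteq> S" using prob_simplex_outside[OF assms(1)] by auto
  then have "(\<alpha> has_sum (sum \<alpha> {s. \<alpha> s \<noteq> 0})) S"
    by (intro has_sum_finite_neutralI) (use assms finite_subset in auto)
  then have "sum \<alpha> {s. \<alpha> s \<noteq> 0} = 1" using prob_simplex_has_sum[OF assms(1)] has_sum_unique by blast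
  moreover have "sum \<alpha> {s. \<alpha> s \<noteq> 0} = sum \<alpha> F"
    by (rule sum.mono_neutral_left) (use assms in auto)
  ultimately show ?thesis by simp
qed

lemma prob_simplexI_finite:
  assumes "finite F" "F \<subseteq> S" "\<And>s. 0 \<le> \<alpha> s" "\<And>s. s \<notin> F \<Longrightarrow> \<alpha> s = 0" "sum \<alpha> F = 1"
  shows "\<alpha> \<in> prob_simplex S"
proof -
  have "(\<alpha> has_sum 1) S" by (rule has_sum_finite_neutralI[of F]) (use assms in auto)
  then show ?thesis using assms by (auto simp: prob_simplex_def)
qed

section \<open>The largest atom and the truncation of a law\<close>

definition peak :: "('s \<Rightarrow> real) \<Rightarrow> real" where
  "peak \<alpha> = (SUP s. \<alpha> s)"

lemma le_peak: "\<alpha> \<in> prob_simplex S \<Longrightarrow> \<alpha> s \<le> peak \<alpha>"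
  unfolding peak_def by (rule cSUP_upper) (auto intro: prob_simplex_le_1)

lemma peak_pos:
  assumes "\<alpha> \<in> prob_simplex S" shows "peak \<alpha> > 0"
proof -
  obtain s where "\<alpha> s \<noteq> 0" using prob_simplex_support_nonempty[OF assms] by auto
  then show ?thesis using le_peak[OF assms, of s] prob_simplex_nonneg[OF assms, of s] by linarith
qed

lemma half_peak_less:
  assumes "\<alpha> \<in> prob_simplex S" shows "\<exists>s. peak \<alpha> / 2 < \<alpha> s"
proof -
  have "peak \<alpha> / 2 < (SUP s. \<alpha> s)" using peak_pos[OF assms] by (simp add: peak_def)
  moreover have "bdd_above (range \<alpha>)"
    using prob_simplex_le_1[OF assms] by (auto intro!: bdd_aboveI2[where M=1])
  ultimately show ?thesis using less_cSUP_iff[of UNIV \<alpha>] by blast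
qed

lemma peak_le_add_d1:
  assumes "\<alpha> \<in> prob_simplex S" "\<beta> \<in> prob_simplex S"
  shows "peak \<alpha> \<le> peak \<beta> + d1 S \<alpha> \<beta>"
proof -
  have "\<alpha> s \<le> peak \<beta> + d1 S \<alpha> \<beta>" for s
    using abs_diff_le_d1[OF assms, of s] le_peak[OF assms(2), of s] by linarith
  then show ?thesis unfolding peak_def[of \<alpha>] by (intro cSUP_least) auto
qed

lemma d1_tendsto:
  assumes "limitin (prob_simplex_top S) f \<beta> F"
  shows "((\<lambda>z. d1 S (f z) \<beta>) \<longlongrightarrow> 0) F"
proof (rule tendstoI)
  fix e :: real assume "e > 0"
  then have "\<forall>\<^sub>F z in F. d1 S (f z) \<beta> < e"
    using assms by (auto simp: prob_simplex_top_def prob_simplex.limitin_metric elim!: eventually_mono)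
  then show "\<forall>\<^sub>F z in F. dist (d1 S (f z) \<beta>) 0 < e" by simp
qed

lemma peak_tendsto:
  assumes "limitin (prob_simplex_top S) f \<beta> F"
  shows "((\<lambda>z. peak (f z)) \<longlongrightarrow> peak \<beta>) F"
proof (rule tendstoI)
  fix e :: real assume e: "e > 0"
  have b: "\<beta> \<in> prob_simplex S" and ev: "\<forall>\<^sub>F z in F. f z \<in> prob_simplex S"
    using assms by (auto simp: limitin_prob_simplex_iff)
  show "\<forall>\<^sub>F z in F. dist (peak (f z)) (peak \<beta>) < e"
    using ev order_tendstoD(2)[OF d1_tendsto[OF assms] e]
  proof eventually_elim
    case (elim z)
    then show ?case
      using peak_le_add_d1[OF elim(1) b] peak_le_add_d1[OF b elim(1)]
      by (simp add: dist_real_def prob_simplex.commute abs_less_iff)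
  qed
qed

text \<open>Exempting the coordinates in \<open>E\<close> from truncation makes all points supported in \<open>E\<close> fixed.\<close>

definition truncate :: "'s set \<Rightarrow> ('s \<Rightarrow> real) \<Rightarrow> 's \<Rightarrow> real" where
  "truncate E \<alpha> s = (if s \<in> E then \<alpha> s else max 0 (\<alpha> s - peak \<alpha> / 2))"

text \<open>The normalising sum is restricted to the support, which is finite for a law and a finite
  \<open>E\<close>; a \<open>sum\<close> over all points of an infinite type would be 0.\<close>

definition retract :: "'s set \<Rightarrow> ('s \<Rightarrow> real) \<Rightarrow> 's \<Rightarrow> real" where
  "retract E \<alpha> s = truncate E \<alpha> s / (\<Sum>r | truncate E \<alpha> r \<noteq> 0. truncate E \<alpha> r)"

lemma truncate_support_subset:
  assumes "\<alpha> \<in> prob_simplex S"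
  shows "{s. truncate E \<alpha> s \<noteq> 0} \<subseteq> {s. \<alpha> s \<noteq> 0}"
  using peak_pos[OF assms] by (auto simp: truncate_def split: if_splits)

lemma truncate_nonneg: "\<alpha> \<in> prob_simplex S \<Longrightarrow> 0 \<le> truncate E \<alpha> s"
  by (simp add: truncate_def prob_simplex_nonneg)

lemma truncate_support_finite:
  assumes "\<alpha> \<in> prob_simplex S" "finite E"
  shows "finite {s. truncate E \<alpha> s \<noteq> 0}"
proof (rule finite_subset)
  show "{s. truncate E \<alpha> s \<noteq> 0} \<subseteq> E \<union> {s. peak \<alpha> / 2 \<le> \<alpha> s}"
    by (auto simp: truncate_def)
  show "finite (E \<union> {s. peak \<alpha> / 2 \<le> \<alpha> s})"
    using prob_simplex_Collect_ge_finite[OF assms(1), of "peak \<alpha> / 2"] peak_pos[OF assms(1)] assms(2) by simp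
qed

lemma truncate_sum:
  assumes "\<alpha> \<in> prob_simplex S" "finite E" "finite G" "{s. truncate E \<alpha> s \<noteq> 0} \<subseteq> G"
  shows "(\<Sum>r | truncate E \<alpha> r \<noteq> 0. truncate E \<alpha> r) = sum (truncate E \<alpha>) G"
  by (rule sum.mono_neutral_left) (use assms in auto)

lemma truncate_sum_pos:
  assumes "\<alpha> \<in> prob_simplex S" "finite E"
  shows "(\<Sum>r | truncate E \<alpha> r \<noteq> 0. truncate E \<alpha> r) > 0"
proof -
  obtain s where "peak \<alpha> / 2 < \<alpha> s" using half_peak_less[OF assms(1)] by blast
  then have "truncate E \<alpha> s > 0" using peak_pos[OF assms(1)] by (auto simp: truncate_def)
  then show ?thesis
    using truncate_nonneg[OF assms(1)]
    by (intro sum_pos2[OF truncate_support_finite[OF assms], of s]) auto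
qed

lemma retract_support:
  assumes "\<alpha> \<in> prob_simplex S" "finite E"
  shows "{s. retract E \<alpha> s \<noteq> 0} = {s. truncate E \<alpha> s \<noteq> 0}"
  using truncate_sum_pos[OF assms] by (auto simp: retract_def)

lemma retract_in:
  assumes a: "\<alpha> \<in> prob_simplex S" and E: "finite E"
  shows "retract E \<alpha> \<in> prob_simplex S"
proof (rule prob_simplexI_finite[of "{s. truncate E \<alpha> s \<noteq> 0}"])
  show "{s. truncate E \<alpha> s \<noteq> 0} \<subseteq> S"
    using truncate_support_subset[OF a] prob_simplex_outside[OF a] by blast
  show "(\<Sum>s | truncate E \<alpha> s \<noteq> 0. retract E \<alpha> s) = 1"
    unfolding retract_def sum_divide_distrib[symmetric] using truncate_sum_pos[OF assms] by simp
  show "0 \<le> retract E \<alpha> s" for s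
    unfolding retract_def using truncate_sum_pos[OF assms] truncate_nonneg[OF a] by simp
qed (use truncate_support_finite[OF assms] in \<open>auto simp: retract_def\<close>)

lemma retract_support_subset:
  assumes "\<alpha> \<in> prob_simplex S" "finite E"
  shows "{s. retract E \<alpha> s \<noteq> 0} \<subseteq> {s. \<alpha> s \<noteq> 0}"
  using retract_support[OF assms] truncate_support_subset[OF assms(1)] by simp

lemma retract_fixed:
  assumes a: "\<alpha> \<in> prob_simplex S" and E: "finite E" "{s. \<alpha> s \<noteq> 0} \<subseteq> E"
  shows "retract E \<alpha> = \<alpha>"
proof -
  have t: "truncate E \<alpha> = \<alpha>"
  proof
    fix s show "truncate E \<alpha> s = \<alpha> s"
    proof (cases "s \<in> E")
      case False
      then have "\<alpha> s = 0" using E(2) by auto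
      with False peak_pos[OF a] show ?thesis by (simp add: truncate_def)
    qed (simp add: truncate_def)
  qed
  have "finite {s. \<alpha> s \<noteq> 0}" using E finite_subset by blast
  then have "(\<Sum>r | \<alpha> r \<noteq> 0. \<alpha> r) = 1"
    using prob_simplex_finite_support[OF a, of "{s. \<alpha> s \<noteq> 0}"] by simp
  then show ?thesis by (intro ext) (simp add: retract_def t)
qed

text \<open>Outside \<open>E\<close>, a coordinate survives truncation only above half of the
  largest atom. Near \<open>\<beta>\<close> this threshold exceeds 3/8 of
  \<open>peak \<beta>\<close>, and passing to \<open>\<beta>\<close> costs less than 1/8 of it, so
  the coordinate is among the finitely many where \<open>\<beta>\<close> is at least
  \<open>peak \<beta> / 8\<close>. This local finiteness links the metric topology to the weak
  one.\<close>

lemma retract_locally_finite: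
  assumes lim: "limitin (prob_simplex_top S) f \<beta> F" and E: "finite E"
  obtains G where "finite G" "\<forall>\<^sub>F z in F. {s. truncate E (f z) s \<noteq> 0} \<subseteq> G"
    "{s. truncate E \<beta> s \<noteq> 0} \<subseteq> G"
proof -
  have b: "\<beta> \<in> prob_simplex S" and ev: "\<forall>\<^sub>F z in F. f z \<in> prob_simplex S"
    using lim by (auto simp: limitin_prob_simplex_iff)
  let ?m = "peak \<beta>"
  define G where "G = E \<union> {s. ?m / 8 \<le> \<beta> s}"
  have m: "?m > 0" by (rule peak_pos[OF b])
  have "finite G" unfolding G_def using E prob_simplex_Collect_ge_finite[OF b, of "?m / 8"] m by simp
  moreover have "\<forall>\<^sub>F z in F. {s. truncate E (f z) s \<noteq> 0} \<subseteq> G"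
  proof -
    have "?m / 8 > 0" "3 / 4 * ?m < ?m" using m by simp_all
    from ev order_tendstoD(2)[OF d1_tendsto[OF lim] this(1)]
      order_tendstoD(1)[OF peak_tendsto[OF lim] this(2)]
    show ?thesis
    proof eventually_elim
      case (elim z)
      show ?case
      proof
        fix s assume s: "s \<in> {s. truncate E (f z) s \<noteq> 0}"
        show "s \<in> G"
        proof (cases "s \<in> E")
          case False
          then have "f z s > peak (f z) / 2" using s by (auto simp: truncate_def max_def split: if_splits)
          then have "?m / 8 \<le> \<beta> s"
            using elim(2,3) abs_diff_le_d1[OF elim(1) b, of s] by linarith
          then show ?thesis by (simp add: G_def)
        qed (simp add: G_def)
      qed
    qed
  qed
  moreover have "{s. truncate E \<beta> s \<noteq> 0} \<subseteq> G"
    using m by (auto simp: truncate_def G_def)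
  ultimately show ?thesis by (rule that)
qed

text \<open>Once the supports near the limit lie in one finite set, the normalising factor is a
  fixed finite sum of convergent coordinates with a positive limit.\<close>

lemma limitin_retract:
  assumes lim: "limitin (prob_simplex_top S) f \<beta> F" and E: "finite E"
  shows "limitin (prob_simplex_top S) (\<lambda>z. retract E (f z)) (retract E \<beta>) F"
proof -
  have b: "\<beta> \<in> prob_simplex S" and ev: "\<forall>\<^sub>F z in F. f z \<in> prob_simplex S"
    and co: "\<And>s. ((\<lambda>z. f z s) \<longlongrightarrow> \<beta> s) F"
    using lim by (auto simp: limitin_prob_simplex_iff)
  obtain G where G: "finite G" "\<forall>\<^sub>F z in F. {s. truncate E (f z) s \<noteq> 0} \<subseteq> G"
    "{s. truncate E \<beta> s \<noteq> 0} \<subseteq> G" using retract_locally_finite[OF assms] .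
  have t: "((\<lambda>z. truncate E (f z) s) \<longlongrightarrow> truncate E \<beta> s) F" for s
    unfolding truncate_def by (cases "s \<in> E") (auto intro!: tendsto_intros co peak_tendsto[OF lim])
  have sb: "(\<Sum>r | truncate E \<beta> r \<noteq> 0. truncate E \<beta> r) = sum (truncate E \<beta>) G"
    using truncate_sum[OF b E G(1,3)] .
  have "((\<lambda>z. truncate E (f z) s / sum (truncate E (f z)) G) \<longlongrightarrow> retract E \<beta> s) F" for s
    unfolding retract_def sb using truncate_sum_pos[OF b E] sb
    by (intro tendsto_divide tendsto_sum t) auto
  moreover have "\<forall>\<^sub>F z in F. truncate E (f z) s / sum (truncate E (f z)) G = retract E (f z) s" for s
    using ev G(2) by eventually_elim (simp add: retract_def truncate_sum[OF _ E G(1)])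
  ultimately have "((\<lambda>z. retract E (f z) s) \<longlongrightarrow> retract E \<beta> s) F" for s
    by (rule Lim_transform_eventually)
  moreover have "\<forall>\<^sub>F z in F. retract E (f z) \<in> prob_simplex S"
    using ev by eventually_elim (rule retract_in[OF _ E])
  ultimately show ?thesis using retract_in[OF b E] by (auto simp: limitin_prob_simplex_iff)
qed

lemma retract_in_realization:
  assumes "\<alpha> \<in> realization1_completion S K" "finite E"
  shows "retract E \<alpha> \<in> realization S K"
proof -
  have a: "\<alpha> \<in> prob_simplex S" using assms(1) by (simp add: completion_eq)
  have "finite {s. retract E \<alpha> s \<noteq> 0}"
    unfolding retract_support[OF a assms(2)] by (rule truncate_support_finite[OF a assms(2)])
  then have "{s. retract E \<alpha> s \<noteq> 0} \<in> K"
    using assms(1) retract_support_subset[OF a assms(2)]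
      prob_simplex_support_nonempty[OF retract_in[OF a assms(2)]] unfolding completion_eq by blast
  then show ?thesis using retract_in[OF a assms(2)] by (simp add: realization_eq)
qed

section \<open>The segment from a law to its truncation\<close>

definition contraction :: "'s set \<Rightarrow> real \<Rightarrow> ('s \<Rightarrow> real) \<Rightarrow> 's \<Rightarrow> real" where
  "contraction E t \<alpha> = (\<lambda>s. (1 - t) * \<alpha> s + t * retract E \<alpha> s)"

lemma contraction_0 [simp]: "contraction E 0 \<alpha> = \<alpha>"
  and contraction_1 [simp]: "contraction E 1 \<alpha> = retract E \<alpha>"
  by (auto simp: contraction_def)

lemma contraction_in:
  assumes "\<alpha> \<in> prob_simplex S" "finite E" "t \<in> {0..1}"
  shows "contraction E t \<alpha> \<in> prob_simplex S"
proof -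
  have r: "retract E \<alpha> \<in> prob_simplex S" by (rule retract_in[OF assms(1,2)])
  have "(contraction E t \<alpha> has_sum ((1 - t) * 1 + t * 1)) S"
    unfolding contraction_def
    by (intro has_sum_add has_sum_cmult_right prob_simplex_has_sum[OF assms(1)] prob_simplex_has_sum[OF r])
  then show ?thesis
    using assms prob_simplex_nonneg[OF assms(1)] prob_simplex_nonneg[OF r]
      prob_simplex_outside[OF assms(1)] prob_simplex_outside[OF r]
    by (auto simp: prob_simplex_def contraction_def)
qed

lemma contraction_support_subset:
  assumes "\<alpha> \<in> prob_simplex S" "finite E"
  shows "{s. contraction E t \<alpha> s \<noteq> 0} \<subseteq> {s. \<alpha> s \<noteq> 0}"
  using retract_support_subset[OF assms] by (auto simp: contraction_def)

lemma contraction_fixed: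
  assumes "\<alpha> \<in> prob_simplex S" "finite E" "{s. \<alpha> s \<noteq> 0} \<subseteq> E"
  shows "contraction E t \<alpha> = \<alpha>"
  unfolding contraction_def retract_fixed[OF assms] by (simp add: algebra_simps)

lemma continuous_map_contraction:
  assumes E: "finite E" and t: "continuous_map X (top_of_set {0..1}) t"
    and f: "continuous_map X (prob_simplex_top S) f"
  shows "continuous_map X (prob_simplex_top S) (\<lambda>z. contraction E (t z) (f z))"
proof -
  have r: "continuous_map X (prob_simplex_top S) (\<lambda>z. retract E (f z))"
    using f limitin_retract[OF _ E] unfolding continuous_map_atin by blast
  have "continuous_map X euclideanreal t" using t continuous_map_into_fulltopology by blast
  then have "continuous_map X euclideanreal (\<lambda>z. contraction E (t z) (f z) s)" for s
    unfolding contraction_def using f r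
    by (intro continuous_intros) (auto simp: continuous_map_prob_simplex_iff)
  moreover have "contraction E (t z) (f z) \<in> prob_simplex S" if "z \<in> topspace X" for z
    using f t that E by (intro contraction_in) (auto simp: continuous_map_def Pi_iff)
  ultimately show ?thesis by (auto simp: continuous_map_prob_simplex_iff)
qed

text \<open>The property of a set of laws that makes it stable under the deformations: neither the
  segment towards the truncation nor the patching of two variables with equal laws creates new
  atoms. Both realizations have it.\<close>

definition face_closed :: "'s set \<Rightarrow> ('s \<Rightarrow> real) set \<Rightarrow> bool" where
  "face_closed S B \<longleftrightarrow> B \<subseteq> prob_simplex S \<and>
     (\<forall>\<alpha>\<in>B. \<forall>\<beta>\<in>prob_simplex S. {s. \<beta> s \<noteq> 0} \<subseteq> {s. \<alpha> s \<noteq> 0} \<longrightarrow> \<beta> \<in> B)"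

lemma face_closed_realization:
  assumes "abstract_simplicial_complex S K"
  shows "face_closed S (realization S K)"
  unfolding face_closed_def
proof (intro conjI ballI impI)
  fix \<alpha> \<beta> assume a: "\<alpha> \<in> realization S K" and b: "\<beta> \<in> prob_simplex S" "{s. \<beta> s \<noteq> 0} \<subseteq> {s. \<alpha> s \<noteq> 0}"
  then show "\<beta> \<in> realization S K"
    using assms prob_simplex_support_nonempty[OF b(1)] finite_subset[OF b(2)]
    unfolding realization_eq abstract_simplicial_complex_def by blast
qed (auto simp: realization_eq)

lemma face_closed_completion: "face_closed S (realization1_completion S K)"
  unfolding face_closed_def
proof (intro conjI ballI impI)
  fix \<alpha> \<beta> assume "\<alpha> \<in> realization1_completion S K" "\<beta> \<in> prob_simplex S" "{s. \<beta> s \<noteq> 0} \<subseteq> {s. \<alpha> s \<noteq> 0}"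
  then show "\<beta> \<in> realization1_completion S K"
    unfolding completion_eq by (blast intro: subset_trans)
qed (auto simp: completion_eq)

section \<open>The weak topology\<close>

lemma continuous_map_simplex_component:
  "continuous_map (simplex_top F) euclideanreal (\<lambda>\<alpha>. \<alpha> s)"
proof (cases "s \<in> F")
  case True
  have "continuous_map (product_topology (\<lambda>_. top_of_set {0..1::real}) F) euclideanreal (\<lambda>x. x s)"
    using continuous_map_product_projection[OF True, of "\<lambda>_. top_of_set {0..1::real}"]
      continuous_map_into_fulltopology by blast
  then have "continuous_map (simplex_top F) euclideanreal ((\<lambda>x. x s) \<circ> (\<lambda>\<alpha>. restrict \<alpha> F))"
    unfolding simplex_top_def by (rule continuous_map_pullback)
  then show ?thesis using True by (simp add: o_def)
next
  case False
  have "continuous_map (simplex_top F) euclideanreal (\<lambda>\<alpha>. 0)" by simp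
  then show ?thesis
    by (rule continuous_map_eq) (use False in \<open>auto simp: topspace_simplex_top std_simplex_def\<close>)
qed

lemma limitin_simplex_top:
  assumes "l \<in> std_simplex F" "\<forall>\<^sub>F z in A. f z \<in> std_simplex F"
    and "\<And>s. s \<in> F \<Longrightarrow> ((\<lambda>z. f z s) \<longlongrightarrow> l s) A"
  shows "limitin (simplex_top F) f l A"
  unfolding limitin_def
proof (intro conjI allI impI)
  show "l \<in> topspace (simplex_top F)" using assms(1) by (simp add: topspace_simplex_top)
  fix U assume U: "openin (simplex_top F) U \<and> l \<in> U"
  then obtain V where V: "openin (product_topology (\<lambda>_. top_of_set {0..1::real}) F) V"
    "U = (\<lambda>\<alpha>. restrict \<alpha> F) -` V \<inter> std_simplex F"
    by (auto simp: simplex_top_def openin_pullback_topology)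
  have "limitin (product_topology (\<lambda>_. top_of_set {0..1::real}) F) (\<lambda>z. restrict (f z) F) (restrict l F) A"
    unfolding limitin_componentwise
  proof (intro conjI ballI)
    show "\<forall>\<^sub>F z in A. restrict (f z) F \<in> topspace (product_topology (\<lambda>_. top_of_set {0..1::real}) F)"
      using assms(2) by eventually_elim (auto simp: std_simplex_def)
    fix s assume s: "s \<in> F"
    have "\<forall>\<^sub>F z in A. f z s \<in> {0..1}"
      using assms(2) by eventually_elim (use s in \<open>auto simp: std_simplex_def\<close>)
    then show "limitin (top_of_set {0..1}) (\<lambda>z. restrict (f z) F s) (restrict l F s) A"
      using assms(1,3) s by (auto simp: limitin_subtopology std_simplex_def)
  qed auto
  then have "\<forall>\<^sub>F z in A. restrict (f z) F \<in> V"
    using V U by (auto simp: limitin_def)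
  with assms(2) show "\<forall>\<^sub>F z in A. f z \<in> U"
    by eventually_elim (simp add: V)
qed

lemma continuous_map_into_simplex_top:
  assumes "f \<in> topspace X \<rightarrow> std_simplex F"
    and "\<And>s. s \<in> F \<Longrightarrow> continuous_map X euclideanreal (\<lambda>z. f z s)"
  shows "continuous_map X (simplex_top F) f"
  unfolding continuous_map_atin
proof
  fix x assume x: "x \<in> topspace X"
  have "\<forall>\<^sub>F z in atin X x. f z \<in> std_simplex F"
    by (rule eventually_mono[OF eventually_atin_topspace]) (use assms in auto)
  then show "limitin (simplex_top F) f (f x) (atin X x)"
    using assms x by (intro limitin_simplex_top) (auto simp: continuous_map_atin Pi_iff)
qed

lemma std_simplex_iff:
  assumes "finite F" "F \<subseteq> S"
  shows "\<alpha> \<in> std_simplex F \<longleftrightarrow> \<alpha> \<in> prob_simplex S \<and> {s. \<alpha> s \<noteq> 0} \<subseteq> F"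
proof
  assume a: "\<alpha> \<in> std_simplex F"
  then have "0 \<le> \<alpha> s" for s by (cases "s \<in> F") (auto simp: std_simplex_def)
  with a assms show "\<alpha> \<in> prob_simplex S \<and> {s. \<alpha> s \<noteq> 0} \<subseteq> F"
    using prob_simplexI_finite[of F S \<alpha>] by (auto simp: std_simplex_def)
next
  assume a: "\<alpha> \<in> prob_simplex S \<and> {s. \<alpha> s \<noteq> 0} \<subseteq> F"
  then show "\<alpha> \<in> std_simplex F"
    using prob_simplex_finite_support[of \<alpha> S F] assms prob_simplex_nonneg[of \<alpha> S] prob_simplex_le_1[of \<alpha> S]
    by (auto simp: std_simplex_def)
qed

lemma continuous_map_weak:
  assumes "\<And>F. F \<in> K \<Longrightarrow> continuous_map (simplex_top F) Y f" "f \<in> realization S K \<rightarrow> topspace Y"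
    and K: "abstract_simplicial_complex S K"
  shows "continuous_map (weak_topology S K) Y f"
  unfolding continuous_map_def topspace_weak_topology[OF K]
proof (intro conjI assms allI impI)
  fix U assume U: "openin Y U"
  have "{x \<in> realization S K. f x \<in> U} \<inter> std_simplex F = {x \<in> topspace (simplex_top F). f x \<in> U}"
    if "F \<in> K" for F using simplex_subset_realization[OF K that] by (auto simp: topspace_simplex_top)
  then show "openin (weak_topology S K) {x \<in> realization S K. f x \<in> U}"
    unfolding openin_weak_topology using assms(1) U by (auto simp: continuous_map_def)
qed

lemma continuous_map_simplex_weak:
  assumes K: "abstract_simplicial_complex S K" and F: "F \<in> K"
  shows "continuous_map (simplex_top F) (weak_topology S K) id"
  unfolding continuous_map_def topspace_weak_topology[OF K] topspace_simplex_top
proof (intro conjI allI impI)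
  show "id \<in> std_simplex F \<rightarrow> realization S K" using simplex_subset_realization[OF K F] by auto
  fix U assume "openin (weak_topology S K) U"
  moreover have "{x \<in> std_simplex F. id x \<in> U} = U \<inter> std_simplex F" by auto
  ultimately show "openin (simplex_top F) {x \<in> std_simplex F. id x \<in> U}"
    using F by (simp add: openin_weak_topology)
qed

lemma continuous_map_weak_prob_simplex:
  assumes K: "abstract_simplicial_complex S K"
  shows "continuous_map (weak_topology S K) (prob_simplex_top S) id"
proof (rule continuous_map_weak[OF _ _ K])
  show "id \<in> realization S K \<rightarrow> topspace (prob_simplex_top S)" by (auto simp: realization_eq)
  fix F assume F: "F \<in> K"
  then have "std_simplex F \<subseteq> prob_simplex S"
    using simplex_subset_realization[OF K F] by (auto simp: realization_eq)
  then show "continuous_map (simplex_top F) (prob_simplex_top S) id"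
    by (auto simp: continuous_map_prob_simplex_iff topspace_simplex_top continuous_map_simplex_component)
qed

text \<open>Open sets of the weak topology are tested simplex by simplex, and a metric neighbourhood
  can meet infinitely many simplices. Truncation brings all values near \<open>\<beta>\<close> into
  the finitely many simplices spanned by subsets of \<open>G\<close>, where coordinatewise
  convergence suffices.\<close>

lemma continuous_map_retract_weak:
  assumes K: "abstract_simplicial_complex S K" and E: "finite E"
  shows "continuous_map (subtopology (prob_simplex_top S) (realization1_completion S K)) (weak_topology S K) (retract E)"
    (is "continuous_map ?X _ _")
  unfolding continuous_map_atin
proof
  fix \<beta> assume "\<beta> \<in> topspace ?X"
  then have b: "\<beta> \<in> prob_simplex S" "\<beta> \<in> realization1_completion S K" by auto
  let ?A = "atin ?X \<beta>"
  have "continuous_map ?X (prob_simplex_top S) id" by (simp add: continuous_map_from_subtopology)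
  then have lim: "limitin (prob_simplex_top S) id \<beta> ?A"
    using b by (intro limitin_continuous_map) auto
  obtain G where G: "finite G" "\<forall>\<^sub>F \<alpha> in ?A. {s. truncate E (id \<alpha>) s \<noteq> 0} \<subseteq> G"
    using retract_locally_finite[OF lim E] by metis
  have ev: "\<forall>\<^sub>F \<alpha> in ?A. \<alpha> \<in> prob_simplex S \<and> \<alpha> \<in> realization1_completion S K"
    by (rule eventually_mono[OF eventually_atin_topspace]) auto
  have co: "((\<lambda>\<alpha>. retract E \<alpha> s) \<longlongrightarrow> retract E \<beta> s) ?A" for s
    using limitin_retract[OF lim E] by (auto simp: limitin_prob_simplex_iff)
  have rb: "retract E \<beta> \<in> realization S K" by (rule retract_in_realization[OF b(2) E])
  show "limitin (weak_topology S K) (retract E) (retract E \<beta>) ?A"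
    unfolding limitin_def topspace_weak_topology[OF K]
  proof (intro conjI allI impI rb)
    fix U assume U: "openin (weak_topology S K) U \<and> retract E \<beta> \<in> U"
    have each: "\<forall>\<^sub>F \<alpha> in ?A. retract E \<alpha> \<in> std_simplex H \<longrightarrow> retract E \<alpha> \<in> U" if H: "H \<in> K" for H
    proof (cases "retract E \<beta> \<in> std_simplex H")
      case True
      \<comment> \<open>Values outside the simplex of \<open>H\<close> are replaced by the limit
        itself. The modified map stays in that simplex and still converges coordinatewise, so the
        topology of the simplex applies to it.\<close>
      let ?q = "\<lambda>\<alpha>. if retract E \<alpha> \<in> std_simplex H then retract E \<alpha> else retract E \<beta>"
      have "((\<lambda>\<alpha>. ?q \<alpha> s) \<longlongrightarrow> retract E \<beta> s) ?A" for s
      proof (rule tendstoI)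
        fix e :: real assume "e > 0"
        then show "\<forall>\<^sub>F \<alpha> in ?A. dist (?q \<alpha> s) (retract E \<beta> s) < e"
          by (intro eventually_mono[OF tendstoD[OF co[of s]]]) auto
      qed
      then have "limitin (simplex_top H) ?q (retract E \<beta>) ?A"
        using True by (intro limitin_simplex_top) auto
      moreover have "openin (simplex_top H) (U \<inter> std_simplex H)"
        using U H by (auto simp: openin_weak_topology)
      ultimately have "\<forall>\<^sub>F \<alpha> in ?A. ?q \<alpha> \<in> U \<inter> std_simplex H"
        using True U unfolding limitin_def by blast
      then show ?thesis by eventually_elim auto
    next
      case False
      have HS: "finite H" "H \<subseteq> S" using H K by (auto simp: abstract_simplicial_complex_def)
      \<comment> \<open>The limit charges a coordinate outside \<open>H\<close>; nearby values
        charge it too and so avoid the simplex of \<open>H\<close>.\<close>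
      have "\<not> {s. retract E \<beta> s \<noteq> 0} \<subseteq> H"
        using False std_simplex_iff[OF HS] retract_in[OF b(1) E] by blast
      then obtain s where s: "s \<notin> H" "retract E \<beta> s \<noteq> 0" by blast
      have "\<forall>\<^sub>F \<alpha> in ?A. retract E \<alpha> s \<noteq> 0" by (rule tendsto_imp_eventually_ne[OF co s(2)])
      then show ?thesis by eventually_elim (use s(1) in \<open>auto simp: std_simplex_def\<close>)
    qed
    have "\<forall>\<^sub>F \<alpha> in ?A. \<forall>H\<in>K \<inter> Pow G. retract E \<alpha> \<in> std_simplex H \<longrightarrow> retract E \<alpha> \<in> U"
      using G(1) each by (intro eventually_ball_finite) auto
    with ev G(2) show "\<forall>\<^sub>F \<alpha> in ?A. retract E \<alpha> \<in> U"
    proof eventually_elim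
      case (elim \<alpha>)
      let ?H = "{s. retract E \<alpha> s \<noteq> 0}"
      have "retract E \<alpha> \<in> realization S K" using elim(1) by (intro retract_in_realization[OF _ E]) simp
      then have H: "?H \<in> K" "retract E \<alpha> \<in> prob_simplex S" by (auto simp: realization_eq)
      moreover have "?H \<subseteq> G" using elim(1,2) retract_support[of \<alpha> S E] E by simp
      moreover have "finite ?H" "?H \<subseteq> S" using H(1) K by (auto simp: abstract_simplicial_complex_def)
      ultimately show ?case using elim(3) std_simplex_iff[of ?H S "retract E \<alpha>"] by blast
    qed
  qed
qed

text \<open>The weak topology is a quotient of the disjoint sum of the simplices; as the interval is
  locally compact, the product with the interval is a quotient as well.\<close>

lemma quotient_map_weak:
  assumes K: "abstract_simplicial_complex S K"
  shows "quotient_map (sum_topology simplex_top K) (weak_topology S K) snd"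
  unfolding quotient_map_def
proof (intro conjI allI impI)
  show "snd ` topspace (sum_topology simplex_top K) = topspace (weak_topology S K)"
  proof
    show "snd ` topspace (sum_topology simplex_top K) \<subseteq> topspace (weak_topology S K)"
      using subsetD[OF simplex_subset_realization[OF K]]
      by (auto simp: topspace_simplex_top topspace_weak_topology[OF K])
    show "topspace (weak_topology S K) \<subseteq> snd ` topspace (sum_topology simplex_top K)"
    proof
      fix \<alpha> assume "\<alpha> \<in> topspace (weak_topology S K)"
      then have a: "\<alpha> \<in> prob_simplex S" "{s. \<alpha> s \<noteq> 0} \<in> K"
        by (auto simp: topspace_weak_topology[OF K] realization_eq)
      moreover from this have "finite {s. \<alpha> s \<noteq> 0}" "{s. \<alpha> s \<noteq> 0} \<subseteq> S"
        using K by (auto simp: abstract_simplicial_complex_def)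
      ultimately have "({s. \<alpha> s \<noteq> 0}, \<alpha>) \<in> topspace (sum_topology simplex_top K)"
        by (simp add: topspace_simplex_top std_simplex_iff)
      then show "\<alpha> \<in> snd ` topspace (sum_topology simplex_top K)" by force
    qed
  qed
  fix U assume "U \<subseteq> topspace (weak_topology S K)"
  moreover have "{x. (F, x) \<in> {x \<in> topspace (sum_topology simplex_top K). snd x \<in> U}} = U \<inter> std_simplex F"
    if "F \<in> K" for F using that by (auto simp: topspace_simplex_top)
  ultimately show "openin (sum_topology simplex_top K) {x \<in> topspace (sum_topology simplex_top K). snd x \<in> U}
      \<longleftrightarrow> openin (weak_topology S K) U"
    unfolding openin_sum_topology openin_weak_topology topspace_weak_topology[OF K] by auto
qed

lemma openin_prod_topology_boxE:
  assumes "openin (prod_topology X Y) W" "(x, y) \<in> W"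
  obtains A B where "openin X A" "openin Y B" "x \<in> A" "y \<in> B" "A \<times> B \<subseteq> W"
proof -
  have "\<exists>A B. openin X A \<and> openin Y B \<and> x \<in> A \<and> y \<in> B \<and> A \<times> B \<subseteq> W"
    using iffD1[OF openin_prod_topology_alt assms(1)] assms(2) by (elim allE impE)
  then show thesis using that by (elim exE conjE)
qed

lemma continuous_map_prod_weak:
  assumes K: "abstract_simplicial_complex S K"
    and h: "\<And>F. F \<in> K \<Longrightarrow> continuous_map (prod_topology (top_of_set {0..1::real}) (simplex_top F)) Y h"
  shows "continuous_map (prod_topology (top_of_set {0..1::real}) (weak_topology S K)) Y h"
proof -
  let ?I = "top_of_set {0..1::real}" and ?\<Sigma> = "sum_topology simplex_top K"
  have comp: "compact_space ?I" by (simp add: compact_space_subtopology)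
  have haus: "Hausdorff_space ?I" by (simp add: Hausdorff_space_subtopology)
  have q: "quotient_map (prod_topology ?I ?\<Sigma>) (prod_topology ?I (weak_topology S K)) (\<lambda>(t, y). (t, snd y))"
    by (intro quotient_map_prod_right quotient_map_weak[OF K] compact_imp_locally_compact_space comp disjI1 haus)
  have "continuous_map (prod_topology ?I ?\<Sigma>) Y (h \<circ> (\<lambda>(t, y). (t, snd y)))"
    unfolding continuous_map_def
  proof (intro conjI allI impI)
    show "h \<circ> (\<lambda>(t, y). (t, snd y)) \<in> topspace (prod_topology ?I ?\<Sigma>) \<rightarrow> topspace Y"
      using h by (fastforce simp: continuous_map_def)
    fix U assume U: "openin Y U"
    show "openin (prod_topology ?I ?\<Sigma>) {x \<in> topspace (prod_topology ?I ?\<Sigma>). (h \<circ> (\<lambda>(t, y). (t, snd y))) x \<in> U}"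
      (is "openin _ ?W") unfolding openin_prod_topology_alt
    proof (intro allI impI)
      fix t y assume ty: "(t, y) \<in> ?W"
      obtain F a where y: "y = (F, a)" by (cases y)
      have F: "F \<in> K" and a: "a \<in> topspace (simplex_top F)" and t: "t \<in> topspace ?I" and hU: "h (t, a) \<in> U"
        using ty y by auto
      let ?V = "{x \<in> topspace (prod_topology ?I (simplex_top F)). h x \<in> U}"
      have V: "openin (prod_topology ?I (simplex_top F)) ?V" using h[OF F] U by (simp add: continuous_map_def)
      have ta: "(t, a) \<in> ?V" using a t hU by simp
      obtain A B where AB: "openin ?I A" "openin (simplex_top F) B" "t \<in> A" "a \<in> B" "A \<times> B \<subseteq> ?V"
        using openin_prod_topology_boxE[OF V ta] .
      have BF: "B \<subseteq> topspace (simplex_top F)" using AB(2) by (rule openin_subset)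
      \<comment> \<open>A neighbourhood inside the single summand of \<open>F\<close> is already
        open in the sum, so continuity over one simplex at a time is enough.\<close>
      have "openin ?\<Sigma> (Sigma K (\<lambda>H. if H = F then B else {}))"
        unfolding openin_disjoint_union using AB(2) by auto
      moreover have "Sigma K (\<lambda>H. if H = F then B else {}) = {F} \<times> B"
        using F by (auto split: if_splits)
      ultimately have "openin ?\<Sigma> ({F} \<times> B)" by simp
      moreover have "A \<times> ({F} \<times> B) \<subseteq> ?W" using AB(5) F BF by auto
      ultimately show "\<exists>A B. openin ?I A \<and> openin ?\<Sigma> B \<and> t \<in> A \<and> y \<in> B \<and> A \<times> B \<subseteq> ?W"
        using AB y by (intro exI[of _ A] exI[of _ "{F} \<times> B"]) auto
    qed
  qed
  then show ?thesis by (rule continuous_compose_quotient_map[OF q])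
qed

text \<open>Supports do not grow along the segment, so the homotopy maps each closed simplex into
  itself, and there continuity can be checked by coordinates.\<close>

lemma continuous_map_contraction_weak:
  assumes K: "abstract_simplicial_complex S K" and E: "finite E"
  shows "continuous_map (prod_topology (top_of_set {0..1::real}) (weak_topology S K)) (weak_topology S K)
           (\<lambda>x. contraction E (fst x) (snd x))"
proof (rule continuous_map_prod_weak[OF K])
  fix F assume F: "F \<in> K"
  then have FS: "finite F" "F \<subseteq> S" using K by (auto simp: abstract_simplicial_complex_def)
  let ?P = "prod_topology (top_of_set {0..1::real}) (simplex_top F)"
  have inF: "snd x \<in> prob_simplex S" "{s. snd x s \<noteq> 0} \<subseteq> F" "fst x \<in> {0..1}" if "x \<in> topspace ?P" for x
    using that std_simplex_iff[OF FS] by (auto simp: topspace_simplex_top)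
  have sn: "continuous_map ?P (simplex_top F) snd" by (rule continuous_map_snd)
  have "continuous_map ?P (prob_simplex_top S) snd"
    using inF continuous_map_compose[OF sn continuous_map_simplex_component]
    by (auto simp: continuous_map_prob_simplex_iff o_def)
  then have c: "continuous_map ?P (prob_simplex_top S) (\<lambda>x. contraction E (fst x) (snd x))"
    by (intro continuous_map_contraction E continuous_map_fst)
  have "continuous_map ?P (simplex_top F) (\<lambda>x. contraction E (fst x) (snd x))"
  proof (rule continuous_map_into_simplex_top)
    show "(\<lambda>x. contraction E (fst x) (snd x)) \<in> topspace ?P \<rightarrow> std_simplex F"
    proof
      fix x assume x: "x \<in> topspace ?P"
      show "contraction E (fst x) (snd x) \<in> std_simplex F"
        unfolding std_simplex_iff[OF FS]
        using contraction_in[OF inF(1)[OF x] E inF(3)[OF x]]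
          contraction_support_subset[OF inF(1)[OF x] E] inF(2)[OF x] by blast
    qed
  qed (use c in \<open>simp add: continuous_map_prob_simplex_iff\<close>)
  then have "continuous_map ?P (weak_topology S K) (id \<circ> (\<lambda>x. contraction E (fst x) (snd x)))"
    by (rule continuous_map_compose[OF _ continuous_map_simplex_weak[OF K F]])
  then show "continuous_map ?P (weak_topology S K) (\<lambda>x. contraction E (fst x) (snd x))" by (simp add: o_def)
qed

section \<open>Discrete random variables\<close>

lemma has_sum_nonnegI:
  fixes g :: "'a \<Rightarrow> real"
  assumes nn: "\<And>s. s \<in> A \<Longrightarrow> 0 \<le> g s"
    and le: "\<And>G. finite G \<Longrightarrow> G \<subseteq> A \<Longrightarrow> sum g G \<le> L"
    and ge: "\<And>e. e > 0 \<Longrightarrow> \<exists>G. finite G \<and> G \<subseteq> A \<and> L - e \<le> sum g G"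
  shows "(g has_sum L) A"
proof -
  have summ: "g summable_on A"
    by (rule nonneg_bdd_above_summable_on[OF nn]) (use le in \<open>auto intro!: bdd_aboveI\<close>)
  have "infsum g A \<le> L" by (rule infsum_le_finite_sums[OF summ le])
  moreover have "L \<le> infsum g A"
  proof (rule field_le_epsilon)
    fix e :: real assume "e > 0"
    then obtain G where G: "finite G" "G \<subseteq> A" "L - e \<le> sum g G" using ge by blast
    have "sum g G \<le> infsum g A" by (rule finite_sum_le_infsum[OF summ G(1,2)]) (use nn in auto)
    with G(3) show "L \<le> infsum g A + e" by simp
  qed
  ultimately show ?thesis using summ by (metis has_sum_infsum order_antisym)
qed

text \<open>Isolates the consequence of standardness on which the metric and the law depend; the
  uniform variable enters only in the extension \<open>uniform_rvs\<close>.\<close>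

locale discrete_rvs = prob_space M for M :: "'w measure" +
  fixes S :: "'s set"
  assumes discrete: "f \<in> measurable M (count_space S) \<Longrightarrow> \<exists>C. countable C \<and> C \<subseteq> S \<and> (AE w in M. f w \<in> C)"
begin

abbreviation RV where "RV \<equiv> measurable M (count_space S)"

definition fibre :: "('w \<Rightarrow> 's) \<Rightarrow> 's \<Rightarrow> 'w set" where
  "fibre f s = f -` {s} \<inter> space M"

definition law :: "('w \<Rightarrow> 's) \<Rightarrow> 's \<Rightarrow> real" where
  "law f s = prob (fibre f s)"

lemma RV_range: "f \<in> RV \<Longrightarrow> w \<in> space M \<Longrightarrow> f w \<in> S"
  by (auto dest: measurable_space)

lemma vimage_RV: "f \<in> RV \<Longrightarrow> f -` A \<inter> space M \<in> sets M"
proof -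
  assume f: "f \<in> RV"
  have "f -` (A \<inter> S) \<inter> space M \<in> sets M" using f by (rule measurable_sets) simp
  also have "f -` (A \<inter> S) \<inter> space M = f -` A \<inter> space M" using RV_range[OF f] by auto
  finally show ?thesis .
qed

lemma fibre_sets [measurable]: "f \<in> RV \<Longrightarrow> fibre f s \<in> sets M"
  unfolding fibre_def by (rule vimage_RV)

lemma mem_fibre: "w \<in> fibre f s \<longleftrightarrow> w \<in> space M \<and> f w = s"
  by (auto simp: fibre_def)

lemma law_nonneg: "0 \<le> law f s" by (simp add: law_def)

lemma law_outside: "f \<in> RV \<Longrightarrow> s \<notin> S \<Longrightarrow> law f s = 0"
proof -
  assume "f \<in> RV" "s \<notin> S"
  then have "fibre f s = {}" using RV_range by (auto simp: fibre_def)
  then show ?thesis by (simp add: law_def)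
qed

lemma law_sum:
  assumes "f \<in> RV" "finite F" shows "sum (law f) F = prob (f -` F \<inter> space M)"
proof -
  have "prob (\<Union>s\<in>F. fibre f s) = sum (law f) F"
    unfolding law_def using assms
    by (intro finite_measure_finite_Union) (auto simp: disjoint_family_on_def fibre_def intro!: vimage_RV)
  also have "(\<Union>s\<in>F. fibre f s) = f -` F \<inter> space M" by (auto simp: fibre_def)
  finally show ?thesis ..
qed

text \<open>Tightness: a countable essential range is exhausted by the finite initial segments of an
  enumeration. Later estimates use \<open>discrete\<close> mostly in this form, which reduces them
  to finitely many fibres.\<close>

lemma finite_approx:
  assumes f: "f \<in> RV" and e: "e > 0"
  obtains F where "finite F" "F \<subseteq> S" "1 - e < prob (f -` F \<inter> space M)"
proof -
  obtain C where C: "countable C" "C \<subseteq> S" "AE w in M. f w \<in> C" using discrete[OF f] by blast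
  have p1: "prob (f -` C \<inter> space M) = 1"
    by (rule prob_eq_1[THEN iffD2]) (use C vimage_RV[OF f] in \<open>auto elim: eventually_mono\<close>)
  then have "C \<noteq> {}" by auto
  let ?A = "\<lambda>n. f -` (from_nat_into C ` {..<n}) \<inter> space M"
  have "(\<lambda>n. prob (?A n)) \<longlonglongrightarrow> prob (\<Union>n. ?A n)"
    by (rule finite_Lim_measure_incseq)
      (use vimage_RV[OF f] in \<open>auto intro!: incseq_SucI\<close>)
  also have "(\<Union>n. ?A n) = f -` C \<inter> space M"
  proof -
    have "(\<Union>n. from_nat_into C ` {..<n}) = C"
      unfolding image_UN[symmetric] UN_lessThan_UNIV by (rule range_from_nat_into[OF \<open>C \<noteq> {}\<close> C(1)])
    moreover have "(\<Union>n. ?A n) = f -` (\<Union>n. from_nat_into C ` {..<n}) \<inter> space M" by blast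
    ultimately show ?thesis by simp
  qed
  finally have lim: "(\<lambda>n. prob (?A n)) \<longlonglongrightarrow> 1" by (simp only: p1)
  have "\<forall>\<^sub>F n in sequentially. 1 - e < prob (?A n)"
    by (rule order_tendstoD(1)[OF lim]) (use e in simp)
  then obtain n where "1 - e < prob (?A n)" using eventually_happens'[OF sequentially_bot] by blast
  moreover have "from_nat_into C ` {..<n} \<subseteq> S"
    using C(2) from_nat_into[OF \<open>C \<noteq> {}\<close>] by auto
  ultimately show ?thesis using that[of "from_nat_into C ` {..<n}"] by simp
qed

lemma prob_le_approx:
  assumes f: "f \<in> RV" and F: "1 - e < prob (f -` F \<inter> space M)" and X: "X \<in> sets M"
  shows "prob X \<le> prob (X \<inter> (f -` F \<inter> space M)) + e"
proof -
  let ?G = "f -` F \<inter> space M"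
  have "prob X \<le> prob ((X \<inter> ?G) \<union> (space M - ?G))"
    using X vimage_RV[OF f] sets.sets_into_space[OF X] by (intro finite_measure_mono) auto
  also have "\<dots> \<le> prob (X \<inter> ?G) + prob (space M - ?G)"
    using X vimage_RV[OF f] by (intro measure_Un_le) auto
  also have "prob (space M - ?G) = 1 - prob ?G" using vimage_RV[OF f] by (rule prob_compl)
  finally show ?thesis using F by simp
qed

text \<open>The index set may be uncountable, so additivity of the measure gives only the finite
  sums; tightness shows that they come arbitrarily close to the full probability.\<close>

lemma law_has_sum:
  assumes f: "f \<in> RV" and A: "A \<subseteq> S"
  shows "(law f has_sum prob (f -` A \<inter> space M)) A"
proof (rule has_sum_nonnegI)
  fix G assume G: "finite G" "G \<subseteq> A"
  then show "sum (law f) G \<le> prob (f -` A \<inter> space M)"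
    unfolding law_sum[OF f G(1)] using vimage_RV[OF f] by (intro finite_measure_mono) auto
next
  fix e :: real assume "e > 0"
  then obtain F where F: "finite F" "F \<subseteq> S" "1 - e < prob (f -` F \<inter> space M)"
    using finite_approx[OF f] by blast
  have "prob (f -` A \<inter> space M) \<le> prob ((f -` A \<inter> space M) \<inter> (f -` F \<inter> space M)) + e"
    by (rule prob_le_approx[OF f F(3) vimage_RV[OF f]])
  also have "(f -` A \<inter> space M) \<inter> (f -` F \<inter> space M) = f -` (A \<inter> F) \<inter> space M" by auto
  finally show "\<exists>G. finite G \<and> G \<subseteq> A \<and> prob (f -` A \<inter> space M) - e \<le> sum (law f) G"
    using F by (intro exI[of _ "A \<inter> F"]) (simp add: law_sum[OF f])
qed (rule law_nonneg)

lemma law_in: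
  assumes f: "f \<in> RV" shows "law f \<in> prob_simplex S"
proof -
  have "f -` S \<inter> space M = space M" using RV_range[OF f] by auto
  then have "(law f has_sum 1) S" using law_has_sum[OF f order_refl] prob_space by simp
  then show ?thesis using law_outside[OF f] by (auto simp: prob_simplex_def law_nonneg)
qed

section \<open>The probability of disagreement as a pseudometric\<close>

definition dst :: "('w \<Rightarrow> 's) \<Rightarrow> ('w \<Rightarrow> 's) \<Rightarrow> real" where
  "dst f g = measure (completion M) {w \<in> space M. f w \<noteq> g w}"

sublocale compl: prob_space "completion M" by (rule prob_space_completion)

text \<open>Over a countable essential range of \<open>f\<close>, disagreement is a countable union
  of differences of fibres. What remains lies in a null set of \<open>M\<close> and is measurable
  for the completion.\<close>

lemma neq_sets:
  assumes f: "f \<in> RV" and g: "g \<in> RV"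
  shows "{w \<in> space M. f w \<noteq> g w} \<in> sets (completion M)"
proof -
  obtain C where C: "countable C" "C \<subseteq> S" "AE w in M. f w \<in> C" using discrete[OF f] by blast
  let ?D = "{w \<in> space M. f w \<noteq> g w}" and ?N = "f -` (- C) \<inter> space M"
  have "?N \<in> null_sets M"
    using C(3) vimage_RV[OF f, of "- C"] by (intro AE_iff_null_sets[THEN iffD2]) auto
  then have 1: "?D \<inter> ?N \<in> sets (completion M)"
    using null_sets_completion_iff2 by (metis Int_lower2 null_setsD2)
  have "(\<Union>s\<in>C. fibre f s - fibre g s) \<in> sets M"
    using C(1) f g by (intro sets.countable_UN') (auto intro!: fibre_sets sets.Diff)
  then have 2: "(\<Union>s\<in>C. fibre f s - fibre g s) \<in> sets (completion M)" by (rule sets_completionI_sets)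
  have "?D = (\<Union>s\<in>C. fibre f s - fibre g s) \<union> (?D \<inter> ?N)" by (auto simp: mem_fibre)
  with sets.Un[OF 2 1] show ?thesis by simp
qed

lemma measure_completion': "X \<in> sets M \<Longrightarrow> measure (completion M) X = prob X"
  by (simp add: measure_completion)

lemma prob_le_dst:
  assumes "f \<in> RV" "g \<in> RV" "X \<in> sets M" "\<And>w. w \<in> X \<Longrightarrow> f w \<noteq> g w"
  shows "prob X \<le> dst f g"
proof -
  have "measure (completion M) X \<le> dst f g" unfolding dst_def
    using assms sets.sets_into_space[OF assms(3)]
    by (intro compl.finite_measure_mono neq_sets) auto
  then show ?thesis using assms(3) by (simp add: measure_completion')
qed

text \<open>Disagreement occurs either where \<open>f\<close> leaves \<open>F\<close> or where
  \<open>f\<close> takes a value in \<open>F\<close> that \<open>g\<close> does not share. Only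
  differences of fibres in one direction appear, so it is enough to control how much of each fibre
  of \<open>f\<close> is lost.\<close>

lemma dst_le_finite:
  assumes f: "f \<in> RV" and g: "g \<in> RV" and F: "finite F"
  shows "dst f g \<le> (1 - prob (f -` F \<inter> space M)) + (\<Sum>s\<in>F. prob (fibre f s - fibre g s))"
proof -
  let ?G = "f -` F \<inter> space M" and ?U = "\<Union>s\<in>F. fibre f s - fibre g s"
  have U: "?U \<in> sets M" using F f g by (intro sets.finite_UN) auto
  have G: "?G \<in> sets M" by (rule vimage_RV[OF f])
  have "dst f g \<le> measure (completion M) ((space M - ?G) \<union> ?U)" unfolding dst_def
    using U G by (intro compl.finite_measure_mono sets_completionI_sets) (auto simp: mem_fibre)
  also have "\<dots> = prob ((space M - ?G) \<union> ?U)" using U G by (simp add: measure_completion')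
  also have "\<dots> \<le> prob (space M - ?G) + prob ?U"
    using U G by (intro measure_Un_le) auto
  also have "prob (space M - ?G) = 1 - prob ?G" using G by (rule prob_compl)
  also have "prob ?U \<le> (\<Sum>s\<in>F. prob (fibre f s - fibre g s))"
    using f g by (intro finite_measure_subadditive_finite F) auto
  finally show ?thesis by simp
qed

lemma dst_commute: "dst f g = dst g f"
  unfolding dst_def by (rule arg_cong[where f="measure (completion M)"]) auto

lemma dst_nonneg: "0 \<le> dst f g" by (simp add: dst_def)

lemma dst_triangle:
  assumes "f \<in> RV" "g \<in> RV" "h \<in> RV"
  shows "dst f h \<le> dst f g + dst g h"
proof -
  have "dst f h \<le> measure (completion M) ({w \<in> space M. f w \<noteq> g w} \<union> {w \<in> space M. g w \<noteq> h w})"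
    unfolding dst_def using neq_sets[OF assms(1,2)] neq_sets[OF assms(2,3)]
    by (intro compl.finite_measure_mono) auto
  also have "\<dots> \<le> dst f g + dst g h"
    unfolding dst_def using neq_sets[OF assms(1,2)] neq_sets[OF assms(2,3)]
    by (intro measure_Un_le) auto
  finally show ?thesis .
qed

lemma dst_eq_0_iff:
  assumes "f \<in> RV" "g \<in> RV"
  shows "dst f g = 0 \<longleftrightarrow> (AE w in M. f w = g w)"
proof -
  have "dst f g = 0 \<longleftrightarrow> {w \<in> space M. f w \<noteq> g w} \<in> null_sets (completion M)"
    unfolding dst_def using neq_sets[OF assms] by (auto simp: null_sets_def compl.emeasure_eq_measure)
  also have "\<dots> \<longleftrightarrow> (\<exists>N\<in>null_sets M. {w \<in> space M. f w \<noteq> g w} \<subseteq> N)"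
    by (rule null_sets_completion_iff2)
  also have "\<dots> \<longleftrightarrow> (AE w in M. f w = g w)" by (auto simp: eventually_ae_filter)
  finally show ?thesis .
qed

section \<open>Classes modulo almost everywhere equality\<close>

definition cls :: "('w \<Rightarrow> 's) \<Rightarrow> ('w \<Rightarrow> 's) set" where
  "cls f = ae_eq_rel M S `` {f}"

lemma cls_in: "f \<in> RV \<Longrightarrow> cls f \<in> rv_space M S"
  unfolding cls_def rv_space_def by (rule quotientI)

lemma cls_eq_iff: "f \<in> RV \<Longrightarrow> g \<in> RV \<Longrightarrow> cls f = cls g \<longleftrightarrow> dst f g = 0"
  unfolding cls_def dst_eq_0_iff
  using eq_equiv_class_iff[OF equiv_ae_eq_rel, of f M S g] by (auto simp: ae_eq_rel_def)

lemma rv_spaceE: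
  assumes "F \<in> rv_space M S"
  shows "rv_rep F \<in> RV" "cls (rv_rep F) = F"
proof -
  have r: "rv_rep F \<in> F" using assms by (rule rv_rep_in)
  obtain f where f: "f \<in> RV" "F = ae_eq_rel M S `` {f}"
    using assms unfolding rv_space_def by (rule quotientE)
  with r have fr: "(f, rv_rep F) \<in> ae_eq_rel M S" by simp
  then show "rv_rep F \<in> RV" by (simp add: ae_eq_rel_def)
  show "cls (rv_rep F) = F" unfolding cls_def f(2)
    using equiv_class_eq[OF equiv_ae_eq_rel fr] f(2) by simp
qed

lemma dst_rep_cls: "f \<in> RV \<Longrightarrow> dst (rv_rep (cls f)) f = 0"
  using rv_spaceE[OF cls_in[of f]] by (subst cls_eq_iff[symmetric]) auto

lemma dst_cong:
  assumes "f \<in> RV" "g \<in> RV" "f' \<in> RV" "g' \<in> RV" "dst f f' = 0" "dst g g' = 0"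
  shows "dst f g = dst f' g'"
  using dst_triangle[of f f' g] dst_triangle[of f' g' g] dst_triangle[of f' f g'] dst_triangle[of f g g']
    assms dst_commute[of f' f] dst_commute[of g' g] by simp

lemma rv_dist_eq: "rv_dist M F G = dst (rv_rep F) (rv_rep G)"
  by (simp add: rv_dist_def dst_def)

lemma rv_dist_cls: "f \<in> RV \<Longrightarrow> g \<in> RV \<Longrightarrow> rv_dist M (cls f) (cls g) = dst f g"
  unfolding rv_dist_eq by (intro dst_cong dst_rep_cls rv_spaceE cls_in)

lemma abs_law_diff_le:
  assumes "f \<in> RV" "g \<in> RV"
  shows "\<bar>law f s - law g s\<bar> \<le> dst f g"
proof -
  have *: "law f s \<le> law g s + dst f g" if "f \<in> RV" "g \<in> RV" for f g
  proof -
    have "law f s \<le> prob (fibre g s \<union> (fibre f s - fibre g s))"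
      unfolding law_def using that by (intro finite_measure_mono) auto
    also have "\<dots> \<le> law g s + prob (fibre f s - fibre g s)"
      unfolding law_def using that by (intro measure_Un_le) auto
    also have "prob (fibre f s - fibre g s) \<le> dst f g"
      using that by (intro prob_le_dst) (auto simp: mem_fibre)
    finally show ?thesis by simp
  qed
  show ?thesis using *[OF assms] *[OF assms(2,1)] by (simp add: dst_commute abs_le_iff)
qed

lemma law_cong: "f \<in> RV \<Longrightarrow> g \<in> RV \<Longrightarrow> dst f g = 0 \<Longrightarrow> law f = law g"
  using abs_law_diff_le[of f g] by (intro ext) fastforce

lemma prob_law_eq_law: "prob_law M F = law (rv_rep F)"
  by (auto simp: prob_law_def law_def fibre_def)

lemma prob_law_cls: "f \<in> RV \<Longrightarrow> prob_law M (cls f) = law f"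
  unfolding prob_law_eq_law by (intro law_cong dst_rep_cls rv_spaceE cls_in)

lemma prob_law_in: "F \<in> rv_space M S \<Longrightarrow> prob_law M F \<in> prob_simplex S"
  unfolding prob_law_eq_law by (intro law_in rv_spaceE)

sublocale rv: Metric_space "rv_space M S" "rv_dist M"
proof
  fix F G H :: "('w \<Rightarrow> 's) set"
  show "0 \<le> rv_dist M F G" by (simp add: rv_dist_eq dst_nonneg)
  show "rv_dist M F G = rv_dist M G F" by (simp add: rv_dist_eq dst_commute)
  assume F: "F \<in> rv_space M S" and G: "G \<in> rv_space M S"
  show "rv_dist M F G = 0 \<longleftrightarrow> F = G"
    using cls_eq_iff[of "rv_rep F" "rv_rep G"] rv_spaceE[OF F] rv_spaceE[OF G] by (simp add: rv_dist_eq)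
  assume H: "H \<in> rv_space M S"
  show "rv_dist M F H \<le> rv_dist M F G + rv_dist M G H"
    unfolding rv_dist_eq by (intro dst_triangle rv_spaceE F G H)
qed

lemma topspace_rv [simp]: "topspace (rv_topology M S) = rv_space M S"
  by (simp add: rv_topology_def)

text \<open>Finitely many fibres of the limit \<open>g\<close> carry almost all mass. If each of
  them is asymptotically preserved, nearly all of the space is a region of agreement; no uniformity
  in \<open>s\<close> is required.\<close>

lemma limitin_cls:
  assumes g: "g \<in> RV" and f: "\<forall>\<^sub>F z in A. f z \<in> RV"
    and lim: "\<And>s. s \<in> S \<Longrightarrow> ((\<lambda>z. prob (fibre g s - fibre (f z) s)) \<longlongrightarrow> 0) A"
  shows "limitin (rv_topology M S) (\<lambda>z. cls (f z)) (cls g) A"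
proof -
  have "\<forall>\<^sub>F z in A. cls (f z) \<in> rv_space M S \<and> rv_dist M (cls (f z)) (cls g) < e" if e: "e > 0" for e
  proof -
    obtain F where F: "finite F" "F \<subseteq> S" "1 - e / 2 < prob (g -` F \<inter> space M)"
      using finite_approx[OF g, of "e / 2"] e by auto
    have "((\<lambda>z. \<Sum>s\<in>F. prob (fibre g s - fibre (f z) s)) \<longlongrightarrow> (\<Sum>s\<in>F. 0)) A"
      using lim F(2) by (intro tendsto_sum) auto
    then have "\<forall>\<^sub>F z in A. (\<Sum>s\<in>F. prob (fibre g s - fibre (f z) s)) < e / 2"
      using e by (intro order_tendstoD) auto
    with f show ?thesis
    proof eventually_elim
      case (elim z)
      then have "rv_dist M (cls (f z)) (cls g) = dst g (f z)"
        using g by (simp add: rv_dist_cls dst_commute)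
      also have "\<dots> < e" using dst_le_finite[OF g elim(1) F(1)] F(3) elim(2) by linarith
      finally show ?case using elim(1) by (simp add: cls_in)
    qed
  qed
  then show ?thesis using g by (simp add: rv_topology_def rv.limitin_metric cls_in)
qed

lemma rv_dist_tendsto:
  assumes "limitin (rv_topology M S) f G A"
  shows "((\<lambda>z. rv_dist M (f z) G) \<longlongrightarrow> 0) A"
proof (rule tendstoI)
  fix e :: real assume "e > 0"
  then have "\<forall>\<^sub>F z in A. rv_dist M (f z) G < e"
    using assms by (auto simp: rv_topology_def rv.limitin_metric elim!: eventually_mono)
  then show "\<forall>\<^sub>F z in A. dist (rv_dist M (f z) G) 0 < e" by simp
qed

text \<open>Each atom is a 1-Lipschitz function of the random variable, and convergence of laws is
  coordinatewise.\<close>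

lemma continuous_map_prob_law: "continuous_map (rv_topology M S) (prob_simplex_top S) (prob_law M)"
  unfolding continuous_map_atin limitin_prob_simplex_iff topspace_rv
proof (intro ballI conjI allI)
  fix G s assume G: "G \<in> rv_space M S"
  show "prob_law M G \<in> prob_simplex S" by (rule prob_law_in[OF G])
  have ev: "\<forall>\<^sub>F F in atin (rv_topology M S) G. F \<in> rv_space M S"
    using eventually_atin_topspace[of "rv_topology M S" G] by simp
  then show "\<forall>\<^sub>F F in atin (rv_topology M S) G. prob_law M F \<in> prob_simplex S"
    by eventually_elim (rule prob_law_in)
  have "((\<lambda>F. prob_law M F s - prob_law M G s) \<longlongrightarrow> 0) (atin (rv_topology M S) G)"
  proof (rule Lim_null_comparison)
    show "\<forall>\<^sub>F F in atin (rv_topology M S) G. norm (prob_law M F s - prob_law M G s) \<le> rv_dist M F G"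
      using ev
      by eventually_elim (use abs_law_diff_le rv_spaceE(1) G in \<open>simp add: prob_law_eq_law rv_dist_eq\<close>)
    have "limitin (rv_topology M S) (\<lambda>F. F) G (atin (rv_topology M S) G)"
      using G limitin_continuous_map[of "rv_topology M S" "rv_topology M S" "\<lambda>F. F" G G] by simp
    then show "((\<lambda>F. rv_dist M F G) \<longlongrightarrow> 0) (atin (rv_topology M S) G)" by (rule rv_dist_tendsto)
  qed
  then show "((\<lambda>F. prob_law M F s) \<longlongrightarrow> prob_law M G s) (atin (rv_topology M S) G)"
    by (rule LIM_zero_cancel)
qed

end

section \<open>Transport of a random variable to another law\<close>

text \<open>The order is an arbitrary strict linear order on the values. Its rays give events
  because every subset of \<open>S\<close> is measurable. The variable \<open>u\<close> breaks ties
  inside the fibres and serves as the clock of the patching homotopy.\<close>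

locale uniform_rvs = discrete_rvs M S for M :: "'w measure" and S :: "'s set" +
  fixes u :: "'w \<Rightarrow> real" and prec :: "'s \<Rightarrow> 's \<Rightarrow> bool"  (infix "\<sqsubset>" 50)
  assumes u_meas [measurable]: "u \<in> borel_measurable M"
    and u_unif: "0 \<le> t \<Longrightarrow> t \<le> 1 \<Longrightarrow> prob {w \<in> space M. u w \<le> t} = t"
    and prec_irrefl: "\<not> s \<sqsubset> s"
    and prec_trans: "q \<sqsubset> r \<Longrightarrow> r \<sqsubset> s \<Longrightarrow> q \<sqsubset> s"
    and prec_total: "r \<noteq> s \<Longrightarrow> r \<sqsubset> s \<or> s \<sqsubset> r"
begin

lemma u_between:
  assumes "0 \<le> a" "a \<le> b" "b \<le> 1"
  shows "prob {w \<in> space M. a < u w \<and> u w \<le> b} = b - a"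
proof -
  have "{w \<in> space M. a < u w \<and> u w \<le> b} = {w \<in> space M. u w \<le> b} - {w \<in> space M. u w \<le> a}" by auto
  also have "prob \<dots> = prob {w \<in> space M. u w \<le> b} - prob {w \<in> space M. u w \<le> a}"
    using assms by (intro finite_measure_Diff) auto
  also have "\<dots> = b - a" using assms u_unif by simp
  finally show ?thesis .
qed

lemma u_atomless: "prob {w \<in> space M. u w = y} = 0"
proof -
  have "prob {w \<in> space M. u w = y} \<le> 0 + e" if e: "e > 0" for e
  proof -
    consider "y \<le> 0" | "1 < y" | "0 < y" "y \<le> 1" by linarith
    then show ?thesis
    proof cases
      case 1
      then have "prob {w \<in> space M. u w = y} \<le> prob {w \<in> space M. u w \<le> 0}"
        by (intro finite_measure_mono) auto
      then show ?thesis using u_unif[of 0] e by simp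
    next
      case 2
      then have "prob {w \<in> space M. u w = y} \<le> prob (space M - {w \<in> space M. u w \<le> 1})"
        by (intro finite_measure_mono) auto
      also have "\<dots> = 0" using u_unif[of 1] by (subst prob_compl) auto
      finally show ?thesis using e by simp
    next
      case 3
      define a where "a = max 0 (y - e)"
      have a: "0 \<le> a" "a < y" "y - a \<le> e" using 3 e by (auto simp: a_def)
      then have "prob {w \<in> space M. u w = y} \<le> prob {w \<in> space M. a < u w \<and> u w \<le> y}"
        by (intro finite_measure_mono) auto
      also have "\<dots> = y - a" using a 3 by (intro u_between) auto
      finally show ?thesis using a by simp
    qed
  qed
  then have "prob {w \<in> space M. u w = y} \<le> 0" by (rule field_le_epsilon)
  then show ?thesis by (simp add: measure_le_0_iff)
qed

text \<open>The restriction of \<open>u\<close> to \<open>X\<close> has an atomless law of total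
  mass \<open>prob X\<close>, and the integral transform for finite measures makes its distribution
  function uniform on the interval from 0 to \<open>prob X\<close>.\<close>

lemma restricted_transform:
  assumes X: "X \<in> sets M" and x: "0 \<le> x" "x \<le> prob X"
  shows "prob {w \<in> X. prob {w' \<in> X. u w' \<le> u w} \<le> x} = x"
    and "(\<lambda>y. prob {w' \<in> X. u w' \<le> y}) \<in> borel_measurable borel"
proof -
  let ?N = "distr (restrict_space M X) borel u"
  have XM: "X \<inter> space M = X" using sets.sets_into_space[OF X] by auto
  have ur: "u \<in> borel_measurable (restrict_space M X)" by (rule measurable_restrict_space1[OF u_meas])
  have Nm: "measure ?N B = prob {w \<in> X. u w \<in> B}" if "B \<in> sets borel" for B
  proof -
    have "measure ?N B = measure (restrict_space M X) {w \<in> X. u w \<in> B}"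
      using that XM by (subst measure_distr[OF ur]) (auto simp: space_restrict_space intro!: arg_cong[where f="measure _"])
    also have "\<dots> = prob {w \<in> X. u w \<in> B}"
      using X XM by (intro measure_restrict_space) auto
    finally show ?thesis .
  qed
  have "finite_measure (restrict_space M X)"
    using X by (intro finite_measure_restrict_space finite_measure_axioms) simp
  then have "finite_measure ?N" by (rule finite_measure.finite_measure_distr[OF _ ur])
  then interpret N: finite_borel_measure ?N
    by (intro finite_borel_measure.intro finite_borel_measure_axioms.intro) simp_all
  have atomless: "measure ?N {y} = 0" for y
  proof -
    have "prob {w \<in> X. u w \<in> {y}} \<le> prob {w \<in> space M. u w = y}"
      using XM by (intro finite_measure_mono) auto
    then show ?thesis using u_atomless[of y] by (simp add: Nm measure_le_0_iff)
  qed
  have cdf: "cdf ?N y = prob {w \<in> X. u w \<le> y}" for y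
    unfolding cdf_def by (subst Nm) auto
  show m: "(\<lambda>y. prob {w' \<in> X. u w' \<le> y}) \<in> borel_measurable borel"
    unfolding cdf[symmetric] by (intro borel_measurable_mono monoI N.cdf_nondecreasing)
  have "measure ?N (space ?N) = prob X" using Nm[of UNIV] by simp
  then have t: "measure ?N {y. cdf ?N y \<le> x} = x" using N.cdf_transform[OF atomless] x by simp
  have "{y \<in> space borel. prob {w' \<in> X. u w' \<le> y} \<le> x} \<in> sets borel"
    using m unfolding borel_measurable_iff_le by (rule spec)
  from Nm[OF this] t show "prob {w \<in> X. prob {w' \<in> X. u w' \<le> u w} \<le> x} = x"
    unfolding cdf by simp
qed

text \<open>The distribution function of the pair of \<open>f\<close> and \<open>u\<close> for the lexicographic order, evaluated
  at that pair: a uniformly distributed variable from which \<open>f\<close> can be recovered as a quantile of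
  its law.\<close>

definition lex_rank :: "('w \<Rightarrow> 's) \<Rightarrow> 'w \<Rightarrow> real" where
  "lex_rank f w = prob {w' \<in> space M. f w' \<sqsubset> f w \<or> f w' = f w \<and> u w' \<le> u w}"

section \<open>Cumulative masses of a law\<close>

definition below :: "('s \<Rightarrow> real) \<Rightarrow> 's \<Rightarrow> real" where
  "below \<beta> s = infsum \<beta> {r \<in> S. r \<sqsubset> s}"

lemma prob_simplex_has_sum_subset:
  assumes "\<beta> \<in> prob_simplex S" "A \<subseteq> S" shows "(\<beta> has_sum infsum \<beta> A) A"
proof -
  have "\<beta> summable_on S" by (rule has_sum_imp_summable[OF prob_simplex_has_sum[OF assms(1)]])
  from summable_on_subset_banach[OF this assms(2)] show ?thesis by (rule has_sum_infsum)
qed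

lemma below_nonneg: "\<beta> \<in> prob_simplex S \<Longrightarrow> 0 \<le> below \<beta> s"
  unfolding below_def by (intro infsum_nonneg prob_simplex_nonneg)

lemma below_add:
  assumes b: "\<beta> \<in> prob_simplex S" and s: "s \<in> S"
  shows "below \<beta> s + \<beta> s = infsum \<beta> (insert s {r \<in> S. r \<sqsubset> s})"
proof -
  have "(\<beta> has_sum (\<beta> s + below \<beta> s)) (insert s {r \<in> S. r \<sqsubset> s})"
    unfolding below_def
    by (intro has_sum_insert prob_simplex_has_sum_subset[OF b]) (auto simp: prec_irrefl)
  then show ?thesis by (simp add: infsumI)
qed

lemma infsum_prob_simplex_mono:
  assumes "\<beta> \<in> prob_simplex S" "A \<subseteq> B" "B \<subseteq> S"
  shows "infsum \<beta> A \<le> infsum \<beta> B"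
  by (rule has_sum_mono_neutral[OF prob_simplex_has_sum_subset[OF assms(1)] prob_simplex_has_sum_subset[OF assms(1,3)]])
    (use assms prob_simplex_nonneg[OF assms(1)] in auto)

lemma below_add_le_below:
  assumes b: "\<beta> \<in> prob_simplex S" and "r \<in> S" "r \<sqsubset> s"
  shows "below \<beta> r + \<beta> r \<le> below \<beta> s"
  unfolding below_add[OF assms(1,2)] unfolding below_def
  using assms by (intro infsum_prob_simplex_mono[OF b]) (auto intro: prec_trans)

lemma below_add_le_1:
  assumes b: "\<beta> \<in> prob_simplex S" and s: "s \<in> S"
  shows "below \<beta> s + \<beta> s \<le> 1"
  unfolding below_add[OF assms]
  using infsum_prob_simplex_mono[OF b, of "insert s {r \<in> S. r \<sqsubset> s}" S] s infsumI[OF prob_simplex_has_sum[OF b]]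
  by auto

text \<open>Applied to initial segments of the order, this makes the end points of all slots
  1-Lipschitz in the law.\<close>

lemma infsum_diff_le_d1:
  assumes "\<alpha> \<in> prob_simplex S" "\<beta> \<in> prob_simplex S" "A \<subseteq> S"
  shows "\<bar>infsum \<alpha> A - infsum \<beta> A\<bar> \<le> d1 S \<alpha> \<beta>"
proof -
  note s = summable_prob_simplex[OF assms(1,2)]
  have "((\<lambda>s. \<alpha> s - \<beta> s) has_sum (infsum \<alpha> A - infsum \<beta> A)) A"
    using has_sum_add[OF prob_simplex_has_sum_subset[OF assms(1,3)]
        has_sum_cmult_right[OF prob_simplex_has_sum_subset[OF assms(2,3)], of "- 1"]] by simp
  then have "infsum \<alpha> A - infsum \<beta> A = (\<Sum>\<^sub>\<infinity>s\<in>A. \<alpha> s - \<beta> s)" by (simp add: infsumI)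
  also have "\<bar>\<dots>\<bar> \<le> (\<Sum>\<^sub>\<infinity>s\<in>A. \<bar>\<alpha> s - \<beta> s\<bar>)"
    using norm_infsum_bound[of "\<lambda>s. \<alpha> s - \<beta> s" A] summable_on_subset_banach[OF s assms(3)] by simp
  also have "\<dots> \<le> d1 S \<alpha> \<beta>" unfolding d1_def
    by (intro infsum_mono_neutral s summable_on_subset_banach[OF s assms(3)]) (use assms(3) in auto)
  finally show ?thesis .
qed

text \<open>\<open>slot \<beta> s\<close> is the interval on which the quantile function of \<open>\<beta>\<close> takes the value \<open>s\<close>.\<close>

definition slot :: "('s \<Rightarrow> real) \<Rightarrow> 's \<Rightarrow> real set" where
  "slot \<beta> s = {below \<beta> s<..below \<beta> s + \<beta> s}"

lemma slot_disjoint: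
  assumes b: "\<beta> \<in> prob_simplex S" and "r \<in> S" "s \<in> S" "r \<noteq> s"
  shows "slot \<beta> r \<inter> slot \<beta> s = {}"
  using prec_total[OF assms(4)] below_add_le_below[OF b assms(2), of s] below_add_le_below[OF b assms(3), of r]
  by (auto simp: slot_def)

lemma slot_subset: "\<beta> \<in> prob_simplex S \<Longrightarrow> s \<in> S \<Longrightarrow> slot \<beta> s \<subseteq> {0<..1}"
  using below_nonneg[of \<beta> s] below_add_le_1[of \<beta> s] by (auto simp: slot_def)

section \<open>Measurability and uniform distribution of the lexicographic rank\<close>

lemma below_law: "f \<in> RV \<Longrightarrow> below (law f) s = prob {w \<in> space M. f w \<sqsubset> s}"
proof -
  assume f: "f \<in> RV"
  have "below (law f) s = prob (f -` {r \<in> S. r \<sqsubset> s} \<inter> space M)"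
    unfolding below_def by (intro infsumI law_has_sum f) auto
  also have "f -` {r \<in> S. r \<sqsubset> s} \<inter> space M = {w \<in> space M. f w \<sqsubset> s}" using RV_range[OF f] by auto
  finally show ?thesis .
qed

lemma Collect_RV: "f \<in> RV \<Longrightarrow> {w \<in> space M. P (f w)} \<in> sets M"
  using vimage_RV[of f "{s. P s}"] by (simp add: vimage_def Int_def conj_commute)

lemma fibre_u_sets [measurable]: "f \<in> RV \<Longrightarrow> {w \<in> fibre f s. u w \<le> y} \<in> sets M"
proof -
  assume f: "f \<in> RV"
  have "{w \<in> fibre f s. u w \<le> y} = fibre f s \<inter> {w \<in> space M. u w \<le> y}" by (auto simp: mem_fibre)
  then show ?thesis using f by simp
qed

lemma rank_set_sets:
  assumes f: "f \<in> RV"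
  shows "{w' \<in> space M. f w' \<sqsubset> s \<or> f w' = s \<and> u w' \<le> y} \<in> sets M"
proof -
  have "{w' \<in> space M. f w' \<sqsubset> s \<or> f w' = s \<and> u w' \<le> y}
      = {w' \<in> space M. f w' \<sqsubset> s} \<union> {w' \<in> fibre f s. u w' \<le> y}" by (auto simp: mem_fibre)
  then show ?thesis using Collect_RV[OF f] fibre_u_sets[OF f] by simp
qed

lemma rank_fibre:
  assumes f: "f \<in> RV" and w: "w \<in> fibre f s"
  shows "lex_rank f w = below (law f) s + prob {w' \<in> fibre f s. u w' \<le> u w}"
proof -
  have "lex_rank f w = prob ({w' \<in> space M. f w' \<sqsubset> s} \<union> {w' \<in> fibre f s. u w' \<le> u w})"
    unfolding lex_rank_def using w by (intro arg_cong[where f=prob]) (auto simp: mem_fibre)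
  also have "\<dots> = prob {w' \<in> space M. f w' \<sqsubset> s} + prob {w' \<in> fibre f s. u w' \<le> u w}"
    using prec_irrefl by (intro finite_measure_Union Collect_RV f fibre_u_sets) (auto simp: mem_fibre)
  finally show ?thesis by (simp add: below_law[OF f])
qed

text \<open>The formula of \<open>rank_fibre\<close> is measurable on each fibre, but there may be
  uncountably many fibres. It is used over the countable set \<open>C\<close>; the other fibres are
  null, so there the rank depends on the value of \<open>f\<close> alone, and every condition on
  that value is an event.\<close>

lemma rank_le_sets:
  assumes f: "f \<in> RV"
  shows "{w \<in> space M. lex_rank f w \<le> b} \<in> sets M"
proof -
  obtain C where C: "countable C" "C \<subseteq> S" "AE w in M. f w \<in> C" using discrete[OF f] by blast
  have law0: "law f s = 0" if "s \<notin> C" for s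
    unfolding law_def using C(3) that vimage_RV[OF f]
    by (intro prob_eq_0[THEN iffD2]) (auto simp: fibre_def elim: eventually_mono)
  have sub: "{w \<in> fibre f s. below (law f) s + prob {w' \<in> fibre f s. u w' \<le> u w} \<le> b} \<in> sets M" for s
  proof -
    have [measurable]: "(\<lambda>y. prob {w' \<in> fibre f s. u w' \<le> y}) \<in> borel_measurable borel"
      by (rule restricted_transform(2)[OF fibre_sets[OF f] order_refl measure_nonneg])
    have "{w \<in> space M. below (law f) s + prob {w' \<in> fibre f s. u w' \<le> u w} \<le> b} \<in> sets M"
      by measurable
    then have "fibre f s \<inter> {w \<in> space M. below (law f) s + prob {w' \<in> fibre f s. u w' \<le> u w} \<le> b} \<in> sets M"
      using fibre_sets[OF f] by blast
    also have "fibre f s \<inter> {w \<in> space M. below (law f) s + prob {w' \<in> fibre f s. u w' \<le> u w} \<le> b}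
        = {w \<in> fibre f s. below (law f) s + prob {w' \<in> fibre f s. u w' \<le> u w} \<le> b}"
      by (auto simp: mem_fibre)
    finally show ?thesis .
  qed
  have out: "lex_rank f w = below (law f) (f w)" if "w \<in> space M" "f w \<notin> C" for w
  proof -
    have "prob {w' \<in> fibre f (f w). u w' \<le> u w} \<le> law f (f w)"
      unfolding law_def by (intro finite_measure_mono fibre_sets f) auto
    then have "prob {w' \<in> fibre f (f w). u w' \<le> u w} = 0"
      using law0[OF that(2)] by (simp add: measure_le_0_iff)
    then show ?thesis using rank_fibre[OF f, of w "f w"] that(1) by (simp add: mem_fibre)
  qed
  have "{w \<in> space M. lex_rank f w \<le> b} =
      (\<Union>s\<in>C. {w \<in> fibre f s. below (law f) s + prob {w' \<in> fibre f s. u w' \<le> u w} \<le> b})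
      \<union> {w \<in> space M. f w \<notin> C \<and> below (law f) (f w) \<le> b}" (is "?L = ?R")
  proof (rule set_eqI)
    fix w show "w \<in> ?L \<longleftrightarrow> w \<in> ?R"
    proof (cases "w \<in> space M")
      case True
      then have "w \<in> fibre f (f w)" by (simp add: mem_fibre)
      from rank_fibre[OF f this] True out[OF True] show ?thesis
        by (cases "f w \<in> C") (auto simp: mem_fibre)
    qed (auto simp: mem_fibre)
  qed
  moreover have "{w \<in> space M. f w \<notin> C \<and> below (law f) (f w) \<le> b} \<in> sets M" by (rule Collect_RV[OF f])
  ultimately show ?thesis using sub C(1) by (auto intro!: sets.Un sets.countable_UN')
qed

lemma rank_measurable [measurable]: "f \<in> RV \<Longrightarrow> lex_rank f \<in> borel_measurable M"
  by (simp add: borel_measurable_iff_le rank_le_sets)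

text \<open>On the fibre over \<open>s\<close> the rank starts at the mass below \<open>s\<close>
  and increases with \<open>u\<close> through the mass of the fibre: its distribution there is
  Lebesgue measure on the slot of \<open>s\<close>.\<close>

lemma rank_fibre_le:
  assumes f: "f \<in> RV" and s: "s \<in> S"
  shows "prob {w \<in> fibre f s. lex_rank f w \<le> b} = measure lborel (slot (law f) s \<inter> {..b})"
proof -
  let ?A = "below (law f) s" and ?c = "\<lambda>w. prob {w' \<in> fibre f s. u w' \<le> u w}"
  have c: "0 \<le> ?c w" "?c w \<le> law f s" for w
    unfolding law_def by (auto intro!: finite_measure_mono fibre_sets f)
  have eq: "{w \<in> fibre f s. lex_rank f w \<le> b} = {w \<in> fibre f s. ?c w \<le> b - ?A}"
    using rank_fibre[OF f] by auto
  consider "b < ?A" | "?A \<le> b" "b \<le> ?A + law f s" | "?A + law f s < b" by linarith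
  then show ?thesis
  proof cases
    case 1
    have "\<not> ?c w \<le> b - ?A" for w using 1 c(1)[of w] by linarith
    then have e: "{w \<in> fibre f s. ?c w \<le> b - ?A} = {}" by blast
    have "slot (law f) s \<inter> {..b} = {}" using 1 by (auto simp: slot_def)
    then show ?thesis unfolding eq e by simp
  next
    case 2
    then have "prob {w \<in> fibre f s. ?c w \<le> b - ?A} = b - ?A"
      by (intro restricted_transform fibre_sets f) (auto simp: law_def)
    moreover have "slot (law f) s \<inter> {..b} = {?A<..b}" using 2 by (auto simp: slot_def)
    ultimately show ?thesis using 2 by (simp add: eq)
  next
    case 3
    have "?c w \<le> b - ?A" for w using 3 c(2)[of w] by linarith
    then have e: "{w \<in> fibre f s. ?c w \<le> b - ?A} = fibre f s" by blast
    have "slot (law f) s \<inter> {..b} = {?A<..?A + law f s}" using 3 by (auto simp: slot_def)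
    then show ?thesis unfolding eq e using law_nonneg[of f s] by simp (simp add: law_def)
  qed
qed

lemma prob_finite_fibres:
  assumes f: "f \<in> RV" and F: "finite F" and X: "X \<in> sets M"
  shows "prob (X \<inter> (f -` F \<inter> space M)) = (\<Sum>s\<in>F. prob (X \<inter> fibre f s))"
proof -
  have "prob (\<Union>s\<in>F. X \<inter> fibre f s) = (\<Sum>s\<in>F. prob (X \<inter> fibre f s))"
    using f X by (intro finite_measure_finite_Union F) (auto simp: disjoint_family_on_def mem_fibre)
  also have "(\<Union>s\<in>F. X \<inter> fibre f s) = X \<inter> (f -` F \<inter> space M)" by (auto simp: fibre_def)
  finally show ?thesis .
qed

lemma slots_sum_le:
  assumes b: "\<beta> \<in> prob_simplex S" and F: "finite F" "F \<subseteq> S" and B: "B \<in> sets borel"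
    and le: "x \<le> y" "B \<inter> {0<..1} \<subseteq> {x<..y}"
  shows "(\<Sum>s\<in>F. measure lborel (slot \<beta> s \<inter> B)) \<le> y - x"
proof -
  have fm: "slot \<beta> s \<inter> B \<in> fmeasurable lborel" for s
  proof (rule fmeasurableI2)
    show "slot \<beta> s \<in> fmeasurable lborel" by (simp add: slot_def fmeasurable_def prob_simplex_nonneg[OF b])
  qed (use B in \<open>auto simp: slot_def\<close>)
  have "pairwise (\<lambda>s r. disjnt (slot \<beta> s \<inter> B) (slot \<beta> r \<inter> B)) F"
    unfolding pairwise_def disjnt_def using slot_disjoint[OF b] F(2) by blast
  then have "(\<Sum>s\<in>F. measure lborel (slot \<beta> s \<inter> B)) = measure lborel (\<Union>s\<in>F. slot \<beta> s \<inter> B)"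
    using F(1) fm by (intro measure_UNION'[symmetric])
  also have "\<dots> \<le> measure lborel {x<..y}"
  proof (rule measure_mono_fmeasurable)
    show "(\<Union>s\<in>F. slot \<beta> s \<inter> B) \<subseteq> {x<..y}" using slot_subset[OF b] F le(2) by blast
    show "(\<Union>s\<in>F. slot \<beta> s \<inter> B) \<in> sets lborel" using F(1) fmeasurableD[OF fm] by (intro sets.finite_UN)
    show "{x<..y} \<in> fmeasurable lborel" using le(1) by (simp add: fmeasurable_def)
  qed
  finally show ?thesis using le(1) by simp
qed

text \<open>Finitely many slots, compared with an interval, give only upper bounds up to an error
  \<open>e\<close>. The bounds for the event and for its complement add up to 1, so both are
  equalities in the limit.\<close>

lemma rank_uniform:
  assumes f: "f \<in> RV" and b: "0 \<le> b" "b \<le> 1"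
  shows "prob {w \<in> space M. lex_rank f w \<le> b} = b"
proof -
  let ?X = "{w \<in> space M. lex_rank f w \<le> b}"
  have X: "?X \<in> sets M" by (rule rank_le_sets[OF f])
  note l = law_in[OF f]
  have 1: "prob ?X \<le> b + e" and 2: "prob (space M - ?X) \<le> 1 - b + e" if e: "e > 0" for e
  proof -
    obtain F where F: "finite F" "F \<subseteq> S" "1 - e < prob (f -` F \<inter> space M)"
      using finite_approx[OF f e] .
    have fib: "prob (?X \<inter> fibre f s) = measure lborel (slot (law f) s \<inter> {..b})" if "s \<in> F" for s
    proof -
      have "?X \<inter> fibre f s = {w \<in> fibre f s. lex_rank f w \<le> b}" by (auto simp: mem_fibre)
      then show ?thesis using rank_fibre_le[OF f, of s b] that F(2) by auto
    qed
    have "prob ?X \<le> (\<Sum>s\<in>F. measure lborel (slot (law f) s \<inter> {..b})) + e"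
      using prob_le_approx[OF f F(3) X] prob_finite_fibres[OF f F(1) X] fib by simp
    also have "(\<Sum>s\<in>F. measure lborel (slot (law f) s \<inter> {..b})) \<le> b - 0"
      using b by (intro slots_sum_le l F) auto
    finally show "prob ?X \<le> b + e" by simp
    have fib': "prob ((space M - ?X) \<inter> fibre f s) = measure lborel (slot (law f) s \<inter> {b<..})" if s: "s \<in> F" for s
    proof -
      have "(space M - ?X) \<inter> fibre f s = fibre f s - (?X \<inter> fibre f s)" by (auto simp: mem_fibre)
      then have "prob ((space M - ?X) \<inter> fibre f s) = law f s - measure lborel (slot (law f) s \<inter> {..b})"
        using fib[OF s] X fibre_sets[OF f] by (simp add: finite_measure_Diff law_def)
      moreover have "measure lborel (slot (law f) s) = law f s" by (simp add: slot_def law_nonneg)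
      moreover have "slot (law f) s \<inter> {b<..} = slot (law f) s - slot (law f) s \<inter> {..b}" by auto
      moreover have "measure lborel (slot (law f) s - slot (law f) s \<inter> {..b})
          = measure lborel (slot (law f) s) - measure lborel (slot (law f) s \<inter> {..b})"
        by (intro measure_Diff) (auto simp: slot_def law_nonneg)
      ultimately show ?thesis by simp
    qed
    have "prob (space M - ?X) \<le> (\<Sum>s\<in>F. measure lborel (slot (law f) s \<inter> {b<..})) + e"
      using prob_le_approx[OF f F(3), of "space M - ?X"] prob_finite_fibres[OF f F(1), of "space M - ?X"] X fib'
      by simp
    also have "(\<Sum>s\<in>F. measure lborel (slot (law f) s \<inter> {b<..})) \<le> 1 - b"
      using b by (intro slots_sum_le l F) auto
    finally show "prob (space M - ?X) \<le> 1 - b + e" by simp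
  qed
  have "prob ?X \<le> b" by (rule field_le_epsilon[OF 1])
  moreover have "prob (space M - ?X) \<le> 1 - b" by (rule field_le_epsilon[OF 2])
  ultimately show ?thesis using prob_compl[OF X] by simp
qed

lemma rank_between:
  assumes f: "f \<in> RV" and "0 \<le> a" "a \<le> b" "b \<le> 1"
  shows "prob {w \<in> space M. a < lex_rank f w \<and> lex_rank f w \<le> b} = b - a"
proof -
  have "{w \<in> space M. a < lex_rank f w \<and> lex_rank f w \<le> b}
      = {w \<in> space M. lex_rank f w \<le> b} - {w \<in> space M. lex_rank f w \<le> a}" by auto
  also have "prob \<dots> = prob {w \<in> space M. lex_rank f w \<le> b} - prob {w \<in> space M. lex_rank f w \<le> a}"
    using assms by (intro finite_measure_Diff rank_le_sets) auto
  finally show ?thesis using assms rank_uniform[OF f] by simp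
qed

lemma rank_nonneg: "0 \<le> lex_rank f w" and rank_le_1: "lex_rank f w \<le> 1"
  by (simp_all add: lex_rank_def)

lemma rank_between_le:
  assumes f: "f \<in> RV" and "a \<le> b"
  shows "prob {w \<in> space M. a < lex_rank f w \<and> lex_rank f w \<le> b} \<le> b - a"
proof (cases "b < 0 \<or> 1 \<le> a")
  case True
  then have "\<not> (a < lex_rank f w \<and> lex_rank f w \<le> b)" for w
    using rank_nonneg[of f w] rank_le_1[of f w] by linarith
  then have e: "{w \<in> space M. a < lex_rank f w \<and> lex_rank f w \<le> b} = {}" by blast
  show ?thesis unfolding e using assms(2) by simp
next
  case False
  show ?thesis
  proof (cases "0 \<le> a")
    case True
    have "{w \<in> space M. a < lex_rank f w \<and> lex_rank f w \<le> b}
        = {w \<in> space M. a < lex_rank f w \<and> lex_rank f w \<le> min b 1}" using rank_le_1[of f] by auto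
    then show ?thesis using rank_between[OF f, of a "min b 1"] True False assms(2) by simp
  next
    case neg: False
    have "{w \<in> space M. a < lex_rank f w \<and> lex_rank f w \<le> b}
        = {w \<in> space M. lex_rank f w \<le> min b 1}" using rank_le_1[of f] rank_nonneg[of f] neg
      by (auto intro: less_le_trans[of a 0])
    then show ?thesis using rank_uniform[OF f, of "min b 1"] False neg assms(2) by simp
  qed
qed

text \<open>At a point where \<open>f\<close> and \<open>g\<close> agree, both ranks compare with
  the same pair of value and \<open>u\<close>. The two events that they measure then differ only
  where \<open>f\<close> and \<open>g\<close> disagree.\<close>

lemma rank_diff_le:
  assumes f: "f \<in> RV" and g: "g \<in> RV" and eq: "f w = g w"
  shows "\<bar>lex_rank f w - lex_rank g w\<bar> \<le> dst f g"
proof -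
  have *: "lex_rank f w \<le> lex_rank g w + dst f g" if f: "f \<in> RV" and g: "g \<in> RV" and eq: "f w = g w" for f g
  proof -
    let ?R = "\<lambda>f. {w' \<in> space M. f w' \<sqsubset> f w \<or> f w' = f w \<and> u w' \<le> u w}"
    have R: "?R f \<in> sets M" "?R g \<in> sets M" using rank_set_sets f g by auto
    have "lex_rank f w \<le> prob (?R g \<union> (?R f - ?R g))"
      unfolding lex_rank_def using R by (intro finite_measure_mono) auto
    also have "\<dots> \<le> lex_rank g w + prob (?R f - ?R g)"
      unfolding lex_rank_def using R by (intro measure_Un_le) auto
    also have "prob (?R f - ?R g) \<le> dst f g"
      using f g R eq by (intro prob_le_dst) auto
    finally show ?thesis by simp
  qed
  show ?thesis using *[OF f g eq] *[OF g f] eq by (simp add: dst_commute abs_le_iff)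
qed


text \<open>On the null event where the rank meets no slot, \<open>f w\<close> serves as default: it
  lies in \<open>S\<close> and keeps the map measurable.\<close>

definition transport :: "('w \<Rightarrow> 's) \<Rightarrow> ('s \<Rightarrow> real) \<Rightarrow> 'w \<Rightarrow> 's" where
  "transport f \<beta> w =
     (if \<exists>s\<in>S. lex_rank f w \<in> slot \<beta> s then THE s. s \<in> S \<and> lex_rank f w \<in> slot \<beta> s else f w)"

definition unslotted :: "('w \<Rightarrow> 's) \<Rightarrow> ('s \<Rightarrow> real) \<Rightarrow> 'w set" where
  "unslotted f \<beta> = {w \<in> space M. \<forall>s\<in>S. lex_rank f w \<notin> slot \<beta> s}"

section \<open>The law of the transported variable\<close>

lemma transport_slot:
  assumes "\<beta> \<in> prob_simplex S" "s \<in> S" "lex_rank f w \<in> slot \<beta> s"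
  shows "transport f \<beta> w = s"
proof -
  have "(THE s. s \<in> S \<and> lex_rank f w \<in> slot \<beta> s) = s"
    using assms slot_disjoint[OF assms(1)] by (intro the_equality) blast+
  then show ?thesis using assms by (auto simp: transport_def)
qed

lemma transport_unslotted: "w \<in> unslotted f \<beta> \<Longrightarrow> transport f \<beta> w = f w"
  by (auto simp: transport_def unslotted_def)

lemma slot_sets [measurable]: "f \<in> RV \<Longrightarrow> {w \<in> space M. lex_rank f w \<in> slot \<beta> s} \<in> sets M"
  unfolding slot_def by measurable

lemma prob_slot:
  assumes "f \<in> RV" "\<beta> \<in> prob_simplex S" "s \<in> S"
  shows "prob {w \<in> space M. lex_rank f w \<in> slot \<beta> s} = \<beta> s"
  using rank_between[OF assms(1) below_nonneg[OF assms(2)] _ below_add_le_1[OF assms(2,3)]]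
    prob_simplex_nonneg[OF assms(2), of s] by (simp add: slot_def)

lemma countable_support:
  assumes "\<beta> \<in> prob_simplex S" shows "countable {s \<in> S. \<beta> s \<noteq> 0}"
proof -
  have "\<beta> summable_on S" by (rule has_sum_imp_summable[OF prob_simplex_has_sum[OF assms]])
  then show ?thesis by (rule summable_countable_real)
qed

lemma unslotted_eq:
  "unslotted f \<beta> = space M - (\<Union>s\<in>{s \<in> S. \<beta> s \<noteq> 0}. {w \<in> space M. lex_rank f w \<in> slot \<beta> s})"
  by (auto simp: unslotted_def slot_def)

lemma unslotted_sets: "f \<in> RV \<Longrightarrow> \<beta> \<in> prob_simplex S \<Longrightarrow> unslotted f \<beta> \<in> sets M"
  unfolding unslotted_eq by (intro sets.Diff sets.top sets.countable_UN' countable_support slot_sets) auto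

text \<open>The lengths of the slots are the atoms of \<open>\<beta>\<close>, so finitely many slots
  already capture almost all of the uniformly distributed rank.\<close>

lemma prob_unslotted:
  assumes f: "f \<in> RV" and b: "\<beta> \<in> prob_simplex S"
  shows "prob (unslotted f \<beta>) = 0"
proof -
  have "prob (unslotted f \<beta>) \<le> 0 + e" if e: "e > 0" for e
  proof -
    obtain F where F: "finite F" "F \<subseteq> S" "1 - sum \<beta> F < e" using prob_simplex_finite_approx[OF b e] .
    let ?B = "\<lambda>s. {w \<in> space M. lex_rank f w \<in> slot \<beta> s}"
    have m: "(\<Union>s\<in>F. ?B s) \<in> sets M" using F f by (intro sets.finite_UN slot_sets)
    have "disjoint_family_on ?B F"
      unfolding disjoint_family_on_def using slot_disjoint[OF b] F(2) by blast
    then have "prob (\<Union>s\<in>F. ?B s) = (\<Sum>s\<in>F. prob (?B s))"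
      using F(1) f by (intro finite_measure_finite_Union) auto
    also have "\<dots> = sum \<beta> F" using F(2) prob_slot[OF f b] by (intro sum.cong) auto
    finally have "prob (space M - (\<Union>s\<in>F. ?B s)) = 1 - sum \<beta> F" using prob_compl[OF m] by simp
    moreover have "prob (unslotted f \<beta>) \<le> prob (space M - (\<Union>s\<in>F. ?B s))"
      using m F(2) by (intro finite_measure_mono) (auto simp: unslotted_def)
    ultimately show ?thesis using F(3) by simp
  qed
  then have "prob (unslotted f \<beta>) \<le> 0" by (rule field_le_epsilon)
  then show ?thesis by (simp add: measure_le_0_iff)
qed

lemma transport_RV:
  assumes f: "f \<in> RV" and b: "\<beta> \<in> prob_simplex S"
  shows "transport f \<beta> \<in> RV"
proof (rule measurableI)
  let ?B = "\<lambda>s. {w \<in> space M. lex_rank f w \<in> slot \<beta> s}"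
  have cases: "(\<exists>s\<in>S. w \<in> ?B s \<and> transport f \<beta> w = s) \<or> w \<in> unslotted f \<beta> \<and> transport f \<beta> w = f w"
    if "w \<in> space M" for w
    using that transport_slot[OF b, of _ f w] transport_unslotted[of w f \<beta>] by (auto simp: unslotted_def)
  show "transport f \<beta> w \<in> space (count_space S)" if "w \<in> space M" for w
    using cases[OF that] RV_range[OF f that] by auto
  fix A assume "A \<in> sets (count_space S)"
  then have A: "A \<subseteq> S" by simp
  \<comment> \<open>\<open>A\<close> may be uncountable, but a slot is nonempty only over the
    countable support of \<open>\<beta>\<close>.\<close>
  have "transport f \<beta> -` A \<inter> space M
      = (\<Union>s\<in>A \<inter> {s \<in> S. \<beta> s \<noteq> 0}. ?B s) \<union> ((f -` A \<inter> space M) \<inter> unslotted f \<beta>)" (is "?L = ?R")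
  proof (intro subset_antisym subsetI)
    fix w assume w: "w \<in> ?L"
    then have "w \<in> space M" "transport f \<beta> w \<in> A" by auto
    from cases[OF this(1)] this show "w \<in> ?R"
    proof (elim disjE bexE conjE)
      fix s assume s: "s \<in> S" "w \<in> ?B s" "transport f \<beta> w = s" "transport f \<beta> w \<in> A"
      then have "\<beta> s \<noteq> 0" by (auto simp: slot_def)
      with s show ?thesis by auto
    qed auto
  next
    fix w assume "w \<in> ?R"
    then show "w \<in> ?L" using transport_slot[OF b] transport_unslotted[of w f \<beta>] by auto
  qed
  also have "\<dots> \<in> sets M"
    using f b countable_support[OF b]
    by (intro sets.Un sets.Int vimage_RV unslotted_sets sets.countable_UN') (auto intro: countable_subset)
  finally show "transport f \<beta> -` A \<inter> space M \<in> sets M" .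
qed

lemma slot_subset_fibre:
  assumes "\<beta> \<in> prob_simplex S" "s \<in> S"
  shows "{w \<in> space M. lex_rank f w \<in> slot \<beta> s} \<subseteq> fibre (transport f \<beta>) s"
  using transport_slot[OF assms] by (auto simp: mem_fibre)

lemma fibre_transport_subset:
  assumes b: "\<beta> \<in> prob_simplex S"
  shows "fibre (transport f \<beta>) s \<subseteq> {w \<in> space M. lex_rank f w \<in> slot \<beta> s} \<union> unslotted f \<beta>"
  using transport_slot[OF b] by (auto simp: mem_fibre unslotted_def)

lemma law_transport:
  assumes f: "f \<in> RV" and b: "\<beta> \<in> prob_simplex S"
  shows "law (transport f \<beta>) = \<beta>"
proof
  fix s
  let ?B = "{w \<in> space M. lex_rank f w \<in> slot \<beta> s}"
  show "law (transport f \<beta>) s = \<beta> s"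
  proof (cases "s \<in> S")
    case True
    have "\<beta> s \<le> law (transport f \<beta>) s"
      unfolding law_def prob_slot[OF f b True, symmetric]
      by (intro finite_measure_mono slot_subset_fibre b True fibre_sets transport_RV f)
    moreover have "law (transport f \<beta>) s \<le> prob (?B \<union> unslotted f \<beta>)"
      unfolding law_def
      by (intro finite_measure_mono fibre_transport_subset b sets.Un slot_sets unslotted_sets f)
    moreover have "prob (?B \<union> unslotted f \<beta>) \<le> prob ?B + prob (unslotted f \<beta>)"
      by (intro measure_Un_le slot_sets unslotted_sets f b)
    ultimately show ?thesis using prob_slot[OF f b True] prob_unslotted[OF f b] by linarith
  next
    case False
    then show ?thesis using law_outside[OF transport_RV[OF f b]] prob_simplex_outside[OF b] by simp
  qed
qed

lemma dst_eq_0I: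
  assumes f: "f \<in> RV" and g: "g \<in> RV" and 0: "\<And>s. s \<in> S \<Longrightarrow> prob (fibre f s - fibre g s) = 0"
  shows "dst f g = 0"
proof -
  have "dst f g \<le> 0 + e" if e: "e > 0" for e
  proof -
    obtain F where F: "finite F" "F \<subseteq> S" "1 - e < prob (f -` F \<inter> space M)"
      using finite_approx[OF f e] .
    have "(\<Sum>s\<in>F. prob (fibre f s - fibre g s)) = 0" using 0 F(2) by (intro sum.neutral) auto
    then show ?thesis using dst_le_finite[OF f g F(1)] F(3) by simp
  qed
  then have "dst f g \<le> 0" by (rule field_le_epsilon)
  then show ?thesis using dst_nonneg[of f g] by simp
qed

lemma fibre_rank_sets:
  assumes f: "f \<in> RV"
  shows "{w \<in> fibre f s. prob {w' \<in> fibre f s. u w' \<le> u w} \<le> x} \<in> sets M"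
proof -
  have "{w \<in> fibre f s. prob {w' \<in> fibre f s. u w' \<le> u w} \<le> x}
      = fibre f s \<inter> {w \<in> space M. lex_rank f w \<le> below (law f) s + x}"
    using rank_fibre[OF f, of _ s] by (auto simp: mem_fibre)
  then show ?thesis using rank_le_sets[OF f] fibre_sets[OF f] by simp
qed

text \<open>On the fibre over \<open>s\<close> the rank lies between the end points of the slot of
  \<open>s\<close> for \<open>law f\<close>. It hits the excluded left end point only where the rank
  of \<open>u\<close> within the fibre is 0, which has probability 0 by the integral
  transform.\<close>

lemma transport_law_self:
  assumes f: "f \<in> RV" shows "dst f (transport f (law f)) = 0"
proof (rule dst_eq_0I[OF f transport_RV[OF f law_in[OF f]]])
  fix s assume s: "s \<in> S"
  let ?c = "\<lambda>w. prob {w' \<in> fibre f s. u w' \<le> u w}"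
  have c: "?c w \<le> law f s" for w unfolding law_def by (intro finite_measure_mono fibre_sets f) auto
  have "w \<in> {w \<in> fibre f s. ?c w \<le> 0}" if w: "w \<in> fibre f s - fibre (transport f (law f)) s" for w
  proof (rule ccontr)
    assume "\<not> ?thesis"
    then have "?c w > 0" using w by auto
    then have "lex_rank f w \<in> slot (law f) s" using rank_fibre[OF f, of w s] w c[of w] by (simp add: slot_def)
    then have "w \<in> fibre (transport f (law f)) s"
      using subsetD[OF slot_subset_fibre[OF law_in[OF f] s, of f], of w] w by (simp add: mem_fibre)
    with w show False by simp
  qed
  then have "prob (fibre f s - fibre (transport f (law f)) s) \<le> prob {w \<in> fibre f s. ?c w \<le> 0}"
    using fibre_rank_sets[OF f] by (intro finite_measure_mono) auto
  also have "\<dots> = 0" by (rule restricted_transform(1)[OF fibre_sets[OF f] order_refl measure_nonneg])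
  finally show "prob (fibre f s - fibre (transport f (law f)) s) = 0" by (simp add: measure_le_0_iff)
qed

text \<open>Apart from a null event and the event of disagreement, the rank of \<open>f\<close> lies
  in the slot of \<open>\<alpha>\<close>, that of \<open>g\<close> lies outside the slot of
  \<open>\<beta>\<close>, and the two ranks differ by at most \<open>\<eta>\<close>. So the rank of
  \<open>f\<close> is close to an end point, in one of two intervals of length at most
  \<open>\<eta> + d1 S \<alpha> \<beta>\<close>. With the disagreement itself this makes
  \<open>\<eta>\<close> occur three times.\<close>

lemma transport_estimate:
  assumes f: "f \<in> RV" and g: "g \<in> RV" and a: "\<alpha> \<in> prob_simplex S" and b: "\<beta> \<in> prob_simplex S" and s: "s \<in> S"
  shows "prob (fibre (transport f \<alpha>) s - fibre (transport g \<beta>) s) \<le> 3 * dst f g + 2 * d1 S \<alpha> \<beta>"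
proof -
  define \<eta> where "\<eta> = dst f g"
  define x where "x = below \<alpha> s"
  define x' where "x' = below \<beta> s"
  define y where "y = below \<alpha> s + \<alpha> s"
  define y' where "y' = below \<beta> s + \<beta> s"
  have dx: "\<bar>x - x'\<bar> \<le> d1 S \<alpha> \<beta>"
    unfolding x_def x'_def below_def by (rule infsum_diff_le_d1[OF a b]) auto
  have dy: "\<bar>y - y'\<bar> \<le> d1 S \<alpha> \<beta>"
    unfolding y_def y'_def below_add[OF a s] below_add[OF b s] by (rule infsum_diff_le_d1[OF a b]) (use s in auto)
  have \<eta>: "0 \<le> \<eta>" by (simp add: \<eta>_def dst_nonneg)
  let ?X = "fibre (transport f \<alpha>) s - fibre (transport g \<beta>) s"
  let ?D = "{w \<in> space M. f w \<noteq> g w}"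
  \<comment> \<open>The \<open>max\<close> and \<open>min\<close> keep the intervals correctly
    oriented when \<open>x' + \<eta>\<close> lies to the left of \<open>x\<close> or
    \<open>y' - \<eta>\<close> to the right of \<open>y\<close>.\<close>
  let ?P = "{w \<in> space M. x < lex_rank f w \<and> lex_rank f w \<le> max x (x' + \<eta>)}"
  let ?Q = "{w \<in> space M. min y (y' - \<eta>) < lex_rank f w \<and> lex_rank f w \<le> y}"
  have PQ: "?P \<in> sets M" "?Q \<in> sets M" using f by measurable
  have N: "unslotted f \<alpha> \<in> sets M" by (rule unslotted_sets[OF f a])
  have X: "?X \<in> sets M" using transport_RV f g a b by (intro sets.Diff fibre_sets) auto
  have "?X \<subseteq> unslotted f \<alpha> \<union> (?D \<union> (?P \<union> ?Q))"
  proof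
    fix w assume w: "w \<in> ?X"
    show "w \<in> unslotted f \<alpha> \<union> (?D \<union> (?P \<union> ?Q))"
    proof (cases "w \<in> unslotted f \<alpha> \<or> f w \<noteq> g w")
      case False
      have sp: "w \<in> space M" using w by (auto simp: mem_fibre)
      have 1: "lex_rank f w \<in> slot \<alpha> s" using fibre_transport_subset[OF a, of f s] w False by blast
      have 2: "lex_rank g w \<notin> slot \<beta> s" using slot_subset_fibre[OF b s, of g] w sp by blast
      have "\<bar>lex_rank f w - lex_rank g w\<bar> \<le> \<eta>" unfolding \<eta>_def using False by (intro rank_diff_le f g) auto
      moreover have "x < lex_rank f w" "lex_rank f w \<le> y" using 1 by (auto simp: slot_def x_def y_def)
      moreover have "lex_rank g w \<le> x' \<or> y' < lex_rank g w" using 2 by (auto simp: slot_def x'_def y'_def)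
      ultimately have "lex_rank f w \<le> x' + \<eta> \<or> y' - \<eta> < lex_rank f w" by linarith
      with \<open>x < lex_rank f w\<close> \<open>lex_rank f w \<le> y\<close> sp show ?thesis by (auto simp: less_max_iff_disj)
    qed (use w in \<open>auto simp: mem_fibre\<close>)
  qed
  then have "measure (completion M) ?X \<le> measure (completion M) (unslotted f \<alpha> \<union> (?D \<union> (?P \<union> ?Q)))"
    using N PQ neq_sets[OF f g] by (intro compl.finite_measure_mono) (auto intro: sets_completionI_sets)
  also have "\<dots> \<le> measure (completion M) (unslotted f \<alpha>) + measure (completion M) (?D \<union> (?P \<union> ?Q))"
    using N PQ neq_sets[OF f g] by (intro measure_Un_le) (auto intro: sets_completionI_sets)
  also have "measure (completion M) (?D \<union> (?P \<union> ?Q)) \<le> dst f g + measure (completion M) (?P \<union> ?Q)"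
    unfolding dst_def using PQ neq_sets[OF f g] by (intro measure_Un_le) (auto intro: sets_completionI_sets)
  also have "measure (completion M) (?P \<union> ?Q) \<le> measure (completion M) ?P + measure (completion M) ?Q"
    using PQ by (intro measure_Un_le) (auto intro: sets_completionI_sets)
  finally have "prob ?X \<le> prob (unslotted f \<alpha>) + (dst f g + (prob ?P + prob ?Q))"
    using measure_completion'[OF X] measure_completion'[OF N] measure_completion'[OF PQ(1)]
      measure_completion'[OF PQ(2)] by linarith
  moreover have "prob ?P \<le> max x (x' + \<eta>) - x" by (rule rank_between_le[OF f]) simp
  moreover have "prob ?Q \<le> y - min y (y' - \<eta>)" by (rule rank_between_le[OF f]) simp
  moreover have "max x (x' + \<eta>) - x \<le> \<eta> + d1 S \<alpha> \<beta>" "y - min y (y' - \<eta>) \<le> \<eta> + d1 S \<alpha> \<beta>"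
    using dx dy \<eta> by (auto simp: max_def min_def)
  ultimately show ?thesis using prob_unslotted[OF f a] by (simp add: \<eta>_def)
qed

section \<open>Transport on classes\<close>

definition transport_rv :: "('w \<Rightarrow> 's) set \<Rightarrow> ('s \<Rightarrow> real) \<Rightarrow> ('w \<Rightarrow> 's) set" where
  "transport_rv F \<beta> = cls (transport (rv_rep F) \<beta>)"

lemma transport_rv_in:
  "F \<in> rv_space M S \<Longrightarrow> \<beta> \<in> prob_simplex S \<Longrightarrow> transport_rv F \<beta> \<in> rv_space M S"
  unfolding transport_rv_def by (intro cls_in transport_RV rv_spaceE)

lemma prob_law_transport:
  "F \<in> rv_space M S \<Longrightarrow> \<beta> \<in> prob_simplex S \<Longrightarrow> prob_law M (transport_rv F \<beta>) = \<beta>"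
  unfolding transport_rv_def by (simp add: prob_law_cls transport_RV rv_spaceE law_transport)

lemma transport_rv_prob_law:
  assumes "F \<in> rv_space M S" shows "transport_rv F (prob_law M F) = F"
proof -
  have "cls (rv_rep F) = cls (transport (rv_rep F) (law (rv_rep F)))"
    using rv_spaceE(1)[OF assms] by (simp add: cls_eq_iff transport_law_self transport_RV law_in)
  then show ?thesis using rv_spaceE(2)[OF assms] by (simp add: transport_rv_def prob_law_eq_law)
qed

text \<open>The representatives chosen by \<open>rv_rep\<close> need not vary continuously with
  \<open>z\<close>, but \<open>transport_estimate\<close> involves only the distance between
  them.\<close>

lemma continuous_map_transport:
  assumes F: "continuous_map X (rv_topology M S) F" and b: "continuous_map X (prob_simplex_top S) b"
  shows "continuous_map X (rv_topology M S) (\<lambda>z. transport_rv (F z) (b z))"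
  unfolding continuous_map_atin
proof
  fix x assume x: "x \<in> topspace X"
  have Fin: "F z \<in> rv_space M S" and bin: "b z \<in> prob_simplex S" if "z \<in> topspace X" for z
    using F b that by (auto simp: continuous_map_def)
  have ev: "\<forall>\<^sub>F z in atin X x. z \<in> topspace X" by (rule eventually_atin_topspace)
  show "limitin (rv_topology M S) (\<lambda>z. transport_rv (F z) (b z)) (transport_rv (F x) (b x)) (atin X x)"
    unfolding transport_rv_def
  proof (rule limitin_cls)
    show "transport (rv_rep (F x)) (b x) \<in> RV" using Fin bin x by (intro transport_RV rv_spaceE)
    show "\<forall>\<^sub>F z in atin X x. transport (rv_rep (F z)) (b z) \<in> RV"
      using ev by eventually_elim (intro transport_RV rv_spaceE Fin bin)
    fix s assume s: "s \<in> S"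
    let ?q = "\<lambda>z. prob (fibre (transport (rv_rep (F x)) (b x)) s - fibre (transport (rv_rep (F z)) (b z)) s)"
    show "(?q \<longlongrightarrow> 0) (atin X x)"
    proof (rule Lim_null_comparison)
      show "\<forall>\<^sub>F z in atin X x. norm (?q z) \<le> 3 * rv_dist M (F z) (F x) + 2 * d1 S (b z) (b x)"
        using ev
      proof eventually_elim
        case (elim z)
        have "?q z \<le> 3 * dst (rv_rep (F x)) (rv_rep (F z)) + 2 * d1 S (b x) (b z)"
          by (intro transport_estimate rv_spaceE Fin bin elim x s)
        then show ?case by (simp add: rv_dist_eq dst_commute prob_simplex.commute)
      qed
      have "limitin (rv_topology M S) F (F x) (atin X x)" "limitin (prob_simplex_top S) b (b x) (atin X x)"
        using F b x by (auto simp: continuous_map_atin)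
      then have "((\<lambda>z. 3 * rv_dist M (F z) (F x) + 2 * d1 S (b z) (b x)) \<longlongrightarrow> 3 * 0 + 2 * 0) (atin X x)"
        by (intro tendsto_intros rv_dist_tendsto d1_tendsto)
      then show "((\<lambda>z. 3 * rv_dist M (F z) (F x) + 2 * d1 S (b z) (b x)) \<longlongrightarrow> 0) (atin X x)" by simp
    qed
  qed
qed

section \<open>Paths between two random variables\<close>

definition patch :: "real \<Rightarrow> ('w \<Rightarrow> 's) \<Rightarrow> ('w \<Rightarrow> 's) \<Rightarrow> 'w \<Rightarrow> 's" where
  "patch t f g w = (if u w \<le> t then g w else f w)"

lemma patch_RV:
  assumes "f \<in> RV" "g \<in> RV" shows "patch t f g \<in> RV"
proof -
  have "{w \<in> space M. u w \<le> t} \<in> sets M" by measurable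
  then show ?thesis unfolding patch_def[abs_def] using assms by (intro measurable_If)
qed

lemma dst_patch_le:
  assumes f: "f \<in> RV" "f' \<in> RV" and g: "g \<in> RV" "g' \<in> RV" and t: "t \<in> {0..1}" "t' \<in> {0..1}"
  shows "dst (patch t f g) (patch t' f' g') \<le> dst f f' + (dst g g' + \<bar>t - t'\<bar>)"
proof -
  let ?D = "{w \<in> space M. f w \<noteq> f' w}" and ?E = "{w \<in> space M. g w \<noteq> g' w}"
  let ?U = "{w \<in> space M. min t t' < u w \<and> u w \<le> max t t'}"
  have U: "?U \<in> sets M" by measurable
  have pU: "prob ?U = \<bar>t - t'\<bar>" using u_between[of "min t t'" "max t t'"] t by auto
  have "{w \<in> space M. patch t f g w \<noteq> patch t' f' g' w} \<subseteq> ?D \<union> (?E \<union> ?U)"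
  proof
    fix w assume w: "w \<in> {w \<in> space M. patch t f g w \<noteq> patch t' f' g' w}"
    show "w \<in> ?D \<union> (?E \<union> ?U)"
    proof (cases "u w \<le> t \<longleftrightarrow> u w \<le> t'")
      case True
      with w show ?thesis by (cases "u w \<le> t") (auto simp: patch_def)
    next
      case False
      then have "min t t' < u w \<and> u w \<le> max t t'" by linarith
      with w show ?thesis by blast
    qed
  qed
  then have "dst (patch t f g) (patch t' f' g') \<le> measure (completion M) (?D \<union> (?E \<union> ?U))"
    unfolding dst_def using sets_completionI_sets[OF U] neq_sets[OF f] neq_sets[OF g]
    by (intro compl.finite_measure_mono sets.Un)
  also have "\<dots> \<le> dst f f' + measure (completion M) (?E \<union> ?U)"
    unfolding dst_def using U neq_sets[OF f] neq_sets[OF g]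
    by (intro measure_Un_le) (auto intro: sets_completionI_sets)
  also have "measure (completion M) (?E \<union> ?U) \<le> dst g g' + measure (completion M) ?U"
    unfolding dst_def using U neq_sets[OF g] by (intro measure_Un_le) (auto intro: sets_completionI_sets)
  finally show ?thesis using measure_completion'[OF U] pU by simp
qed

text \<open>Every fibre of the patch is contained in the union of the corresponding fibres of
  \<open>f\<close> and \<open>g\<close>. Equality of their laws turns the two supports into
  one.\<close>

lemma law_patch_support:
  assumes f: "f \<in> RV" and g: "g \<in> RV" and eq: "law f = law g"
  shows "{s. law (patch t f g) s \<noteq> 0} \<subseteq> {s. law f s \<noteq> 0}"
proof -
  have "law (patch t f g) s \<le> law f s + law g s" for s
  proof -
    have "law (patch t f g) s \<le> prob (fibre f s \<union> fibre g s)"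
      unfolding law_def using f g
      by (intro finite_measure_mono) (auto simp: mem_fibre patch_def split: if_splits)
    also have "\<dots> \<le> law f s + law g s" unfolding law_def using f g by (intro measure_Un_le) auto
    finally show ?thesis .
  qed
  then have le: "law (patch t f g) s \<le> law f s + law f s" for s using eq by simp
  show ?thesis
  proof (intro subsetI CollectI notI)
    fix s assume "s \<in> {s. law (patch t f g) s \<noteq> 0}" "law f s = 0"
    then show False using le[of s] law_nonneg[of "patch t f g" s] by simp
  qed
qed

lemma patch_0: "f \<in> RV \<Longrightarrow> g \<in> RV \<Longrightarrow> dst (patch 0 f g) f = 0"
proof -
  assume f: "f \<in> RV" "g \<in> RV"
  have "{w \<in> space M. u w \<le> 0} \<in> sets M" by measurable
  then have "AE w in M. w \<notin> {w \<in> space M. u w \<le> 0}" using u_unif[of 0] by (simp only: prob_eq_0[symmetric])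
  with AE_space have "AE w in M. patch 0 f g w = f w" by eventually_elim (simp add: patch_def)
  then show ?thesis using f by (simp add: dst_eq_0_iff patch_RV)
qed

lemma patch_1: "f \<in> RV \<Longrightarrow> g \<in> RV \<Longrightarrow> dst (patch 1 f g) g = 0"
proof -
  assume f: "f \<in> RV" "g \<in> RV"
  have "{w \<in> space M. u w \<le> 1} \<in> sets M" by measurable
  then have "AE w in M. w \<in> {w \<in> space M. u w \<le> 1}" using u_unif[of 1] by (simp only: prob_eq_1[symmetric])
  then have "AE w in M. patch 1 f g w = g w" by eventually_elim (simp add: patch_def)
  then show ?thesis using f by (simp add: dst_eq_0_iff patch_RV)
qed

definition patch_rv :: "real \<Rightarrow> ('w \<Rightarrow> 's) set \<Rightarrow> ('w \<Rightarrow> 's) set \<Rightarrow> ('w \<Rightarrow> 's) set" where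
  "patch_rv t F G = cls (patch t (rv_rep F) (rv_rep G))"

lemma patch_rv_in: "F \<in> rv_space M S \<Longrightarrow> G \<in> rv_space M S \<Longrightarrow> patch_rv t F G \<in> rv_space M S"
  unfolding patch_rv_def by (intro cls_in patch_RV rv_spaceE)

lemma patch_rv_0: "F \<in> rv_space M S \<Longrightarrow> G \<in> rv_space M S \<Longrightarrow> patch_rv 0 F G = F"
  using cls_eq_iff[of "patch 0 (rv_rep F) (rv_rep G)" "rv_rep F"]
  by (simp add: patch_rv_def rv_spaceE patch_RV patch_0)

lemma patch_rv_1: "F \<in> rv_space M S \<Longrightarrow> G \<in> rv_space M S \<Longrightarrow> patch_rv 1 F G = G"
  using cls_eq_iff[of "patch 1 (rv_rep F) (rv_rep G)" "rv_rep G"]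
  by (simp add: patch_rv_def rv_spaceE patch_RV patch_1)

text \<open>This keeps the base point fixed during the deformation.\<close>

lemma patch_rv_same: "F \<in> rv_space M S \<Longrightarrow> patch_rv t F F = F"
proof -
  have "patch t f f = f" for f by (auto simp: patch_def)
  then show "F \<in> rv_space M S \<Longrightarrow> ?thesis" by (simp add: patch_rv_def rv_spaceE)
qed

lemma prob_law_patch_support:
  assumes F: "F \<in> rv_space M S" and G: "G \<in> rv_space M S" and eq: "prob_law M F = prob_law M G"
  shows "{s. prob_law M (patch_rv t F G) s \<noteq> 0} \<subseteq> {s. prob_law M F s \<noteq> 0}"
proof -
  have "prob_law M (patch_rv t F G) = law (patch t (rv_rep F) (rv_rep G))"
    unfolding patch_rv_def by (intro prob_law_cls patch_RV rv_spaceE F G)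
  then show ?thesis
    using law_patch_support[OF rv_spaceE(1)[OF F] rv_spaceE(1)[OF G]] eq by (simp add: prob_law_eq_law)
qed

lemma continuous_map_patch:
  assumes t: "continuous_map X (top_of_set {0..1}) t"
    and F: "continuous_map X (rv_topology M S) F" and G: "continuous_map X (rv_topology M S) G"
  shows "continuous_map X (rv_topology M S) (\<lambda>z. patch_rv (t z) (F z) (G z))"
  unfolding continuous_map_atin
proof
  fix x assume x: "x \<in> topspace X"
  have Fin: "F z \<in> rv_space M S" and Gin: "G z \<in> rv_space M S" and tin: "t z \<in> {0..1}"
    if "z \<in> topspace X" for z
    using F G t that by (auto simp: continuous_map_def)
  have ev: "\<forall>\<^sub>F z in atin X x. z \<in> topspace X" by (rule eventually_atin_topspace)
  let ?b = "\<lambda>z. rv_dist M (F z) (F x) + (rv_dist M (G z) (G x) + \<bar>t z - t x\<bar>)"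
  have "limitin (rv_topology M S) F (F x) (atin X x)" "limitin (rv_topology M S) G (G x) (atin X x)"
    using F G x by (auto simp: continuous_map_atin)
  moreover have "continuous_map X euclideanreal t" using t continuous_map_into_fulltopology by blast
  then have "(t \<longlongrightarrow> t x) (atin X x)" using x by (simp add: continuous_map_atin)
  ultimately have "(?b \<longlongrightarrow> 0 + (0 + \<bar>t x - t x\<bar>)) (atin X x)"
    by (intro tendsto_intros rv_dist_tendsto)
  then have lim: "(?b \<longlongrightarrow> 0) (atin X x)" by simp
  have "\<forall>\<^sub>F z in atin X x. patch_rv (t z) (F z) (G z) \<in> rv_space M S \<and>
      rv_dist M (patch_rv (t z) (F z) (G z)) (patch_rv (t x) (F x) (G x)) < e" if e: "e > 0" for e
    using ev order_tendstoD(2)[OF lim e]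
  proof eventually_elim
    case (elim z)
    have "rv_dist M (patch_rv (t z) (F z) (G z)) (patch_rv (t x) (F x) (G x))
        = dst (patch (t z) (rv_rep (F z)) (rv_rep (G z))) (patch (t x) (rv_rep (F x)) (rv_rep (G x)))"
      unfolding patch_rv_def using elim x by (intro rv_dist_cls patch_RV rv_spaceE Fin Gin)
    also have "\<dots> \<le> ?b z"
      unfolding rv_dist_eq using elim x by (intro dst_patch_le rv_spaceE Fin Gin tin)
    finally show ?case using elim patch_rv_in[OF Fin Gin] by simp
  qed
  then show "limitin (rv_topology M S) (\<lambda>z. patch_rv (t z) (F z) (G z)) (patch_rv (t x) (F x) (G x)) (atin X x)"
    using patch_rv_in[OF Fin[OF x] Gin[OF x]] by (simp add: rv_topology_def rv.limitin_metric)
qed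

end

section \<open>The probability law map\<close>

lemma continuous_map_into_subtopologyI:
  "continuous_map X Y f \<Longrightarrow> (\<And>x. x \<in> topspace X \<Longrightarrow> f x \<in> A) \<Longrightarrow> continuous_map X (subtopology Y A) f"
  by (auto simp: continuous_map_in_subtopology)

lemma homotopic_with_pointedI:
  assumes "continuous_map (prod_topology (top_of_set {0..1::real}) X) Y h"
    and "\<And>y. y \<in> topspace X \<Longrightarrow> h (0, y) = f y" "\<And>y. y \<in> topspace X \<Longrightarrow> h (1, y) = g y"
    and "x \<in> topspace X" "\<And>t. t \<in> {0..1} \<Longrightarrow> h (t, x) = z"
  shows "homotopic_with (\<lambda>k. k x = z) X Y f g"
  by (subst homotopic_with) (use assms in auto)

text \<open>Letting \<open>B\<close> be any admissible set between the two realizations compares the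
  weak topology with the metric realization and with its completion at once. The pointed inverse is
  a truncation.\<close>

lemma weak_homotopy_equivalence_weak_topology:
  assumes K: "abstract_simplicial_complex S K"
    and B: "realization S K \<subseteq> B" "B \<subseteq> realization1_completion S K" "face_closed S B"
  shows "weak_homotopy_equivalence (weak_topology S K) (subtopology (prob_simplex_top S) B) id"
proof (rule weak_homotopy_equivalenceI)
  let ?W = "weak_topology S K" and ?B = "subtopology (prob_simplex_top S) B"
  have Bp: "B \<subseteq> prob_simplex S" using B(3) by (simp add: face_closed_def)
  have tB: "topspace ?B = B" using Bp by auto
  have tW: "topspace ?W = realization S K" by (rule topspace_weak_topology[OF K])
  show id: "continuous_map ?W ?B id"
    using B(1) tW by (intro continuous_map_into_subtopologyI continuous_map_weak_prob_simplex K) auto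
  show "topspace ?B = {}" if "topspace ?W = {}"
  proof -
    have "realization S K = {}" using that tW by simp
    then show ?thesis using retract_in_realization[of _ S K "{}"] B(2) tB by auto
  qed
  fix x assume "x \<in> topspace ?W"
  then have x: "x \<in> realization S K" by (simp add: tW)
  \<comment> \<open>Sparing the coordinates charged by the base point makes the whole segment at
    that point constant.\<close>
  define E where "E = {s. x s \<noteq> 0}"
  have xp: "x \<in> prob_simplex S" and "E \<in> K" using x by (auto simp: realization_eq E_def)
  then have E: "finite E" using K by (auto simp: abstract_simplicial_complex_def)
  have fixed: "contraction E t x = x" for t by (rule contraction_fixed[OF xp E]) (simp add: E_def)
  have "continuous_map ?B (subtopology (prob_simplex_top S) (realization1_completion S K)) id"
    using B(2) Bp by (intro continuous_map_into_subtopologyI) (auto simp: continuous_map_from_subtopology)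
  from continuous_map_compose[OF this continuous_map_retract_weak[OF K E]]
  have r: "continuous_map ?B ?W (retract E)" by simp
  have "homotopic_with (\<lambda>k. k x = x) ?W ?W id (retract E \<circ> id)"
    by (rule homotopic_with_pointedI[OF continuous_map_contraction_weak[OF K E]]) (use fixed x tW in auto)
  moreover have "homotopic_with (\<lambda>k. k (id x) = id x) ?B ?B id (id \<circ> retract E)"
  proof (rule homotopic_with_pointedI)
    let ?P = "prod_topology (top_of_set {0..1::real}) ?B"
    have "continuous_map ?P (prob_simplex_top S) snd"
      using continuous_map_snd continuous_map_into_fulltopology by blast
    then have c: "continuous_map ?P (prob_simplex_top S) (\<lambda>y. contraction E (fst y) (snd y))"
      by (intro continuous_map_contraction E continuous_map_fst)
    show "continuous_map ?P ?B (\<lambda>y. contraction E (fst y) (snd y))"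
    proof (rule continuous_map_into_subtopologyI[OF c])
      fix y assume "y \<in> topspace ?P"
      then have y: "fst y \<in> {0..1}" "snd y \<in> B" "snd y \<in> prob_simplex S" by auto
      show "contraction E (fst y) (snd y) \<in> B"
        using B(3) y(2) contraction_in[OF y(3) E y(1)] contraction_support_subset[OF y(3) E]
        unfolding face_closed_def by blast
    qed
  qed (use fixed x tB B(1) in auto)
  ultimately show "\<exists>g. continuous_map ?B ?W g \<and> homotopic_with (\<lambda>k. k x = x) ?W ?W (g \<circ> id) id \<and>
      homotopic_with (\<lambda>k. k (id x) = id x) ?B ?B (id \<circ> g) id"
    using r homotopic_with_symD by blast
qed

context uniform_rvs
begin

text \<open>Both \<open>L_top\<close> and \<open>Lbar_top\<close> turn out to be of this form, so
  the law map is studied over a general set \<open>B\<close> of laws.\<close>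

abbreviation rvs_over :: "('s \<Rightarrow> real) set \<Rightarrow> ('w \<Rightarrow> 's) set topology" where
  "rvs_over B \<equiv> subtopology (rv_topology M S) {F. prob_law M F \<in> B}"

abbreviation laws :: "('s \<Rightarrow> real) set \<Rightarrow> ('s \<Rightarrow> real) topology" where
  "laws B \<equiv> subtopology (prob_simplex_top S) B"

lemma continuous_map_law: "continuous_map (rvs_over B) (laws B) (prob_law M)"
  by (intro continuous_map_into_subtopologyI continuous_map_from_subtopology continuous_map_prob_law) auto

lemma continuous_map_transport_rvs_over:
  assumes B: "B \<subseteq> prob_simplex S" and F: "continuous_map X (rv_topology M S) F" and b: "continuous_map X (laws B) b"
  shows "continuous_map X (rvs_over B) (\<lambda>z. transport_rv (F z) (b z))"
proof (rule continuous_map_into_subtopologyI)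
  show "continuous_map X (rv_topology M S) (\<lambda>z. transport_rv (F z) (b z))"
    using b continuous_map_into_fulltopology by (intro continuous_map_transport F) blast
  fix x assume "x \<in> topspace X"
  then have "F x \<in> rv_space M S" "b x \<in> B" "b x \<in> prob_simplex S"
    using F b by (auto simp: continuous_map_def Pi_iff)
  then show "transport_rv (F x) (b x) \<in> {F. prob_law M F \<in> B}" by (simp add: prob_law_transport)
qed

lemma serre_fibration_law:
  assumes B: "B \<subseteq> prob_simplex S"
  shows "serre_fibration (rvs_over B) (laws B) (prob_law M)"
  unfolding serre_fibration_def homotopy_lifting_property_def
proof (intro conjI continuous_map_law allI impI; elim conjE)
  fix n g H
  let ?Z = "nsphere n" and ?P = "prod_topology (top_of_set {0..1::real}) (nsphere n)"
  assume g: "continuous_map ?Z (rvs_over B) g" and H: "continuous_map ?P (laws B) H"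
    and start: "\<forall>z\<in>topspace ?Z. H (0, z) = prob_law M (g z)"
  have gin: "g z \<in> rv_space M S" if "z \<in> topspace ?Z" for z using g that by (auto simp: continuous_map_def)
  have Hin: "H (t, z) \<in> prob_simplex S" if "t \<in> {0..1}" "z \<in> topspace ?Z" for t z
    using H that by (auto simp: continuous_map_def)
  have "continuous_map ?Z (rv_topology M S) g" using g continuous_map_into_fulltopology by blast
  then have "continuous_map ?P (rv_topology M S) (g \<circ> snd)"
    by (rule continuous_map_compose[OF continuous_map_snd])
  then have "continuous_map ?P (rvs_over B) (\<lambda>x. transport_rv ((g \<circ> snd) x) (H x))"
    by (intro continuous_map_transport_rvs_over B H)
  moreover have "transport_rv ((g \<circ> snd) (0, z)) (H (0, z)) = g z" if "z \<in> topspace ?Z" for z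
    using start that gin by (simp add: transport_rv_prob_law)
  moreover have "prob_law M (transport_rv ((g \<circ> snd) (t, z)) (H (t, z))) = H (t, z)"
    if "t \<in> {0..1}" "z \<in> topspace ?Z" for t z
    using that gin Hin by (simp add: prob_law_transport)
  ultimately show "\<exists>G. continuous_map ?P (rvs_over B) G \<and> (\<forall>z\<in>topspace ?Z. G (0, z) = g z) \<and>
      (\<forall>t\<in>{0..1}. \<forall>z\<in>topspace ?Z. prob_law M (G (t, z)) = H (t, z))" by blast
qed

lemma rv_space_nonempty:
  assumes "\<beta> \<in> prob_simplex S" obtains F where "F \<in> rv_space M S"
proof -
  obtain s where "\<beta> s \<noteq> 0" using prob_simplex_support_nonempty[OF assms] by blast
  then have "s \<in> S" using prob_simplex_outside[OF assms] by blast
  then have "(\<lambda>_. s) \<in> RV" by simp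
  then show ?thesis using that cls_in by blast
qed

lemma has_continuous_section_law:
  assumes B: "B \<subseteq> prob_simplex S"
  shows "has_continuous_section (rvs_over B) (laws B) (prob_law M)"
\<comment> \<open>Transport needs some random variable to start from. As soon as a law exists,
  \<open>S\<close> is nonempty and a constant map provides one.\<close>
proof (cases "B = {}")
  case True
  then show ?thesis by (auto simp: has_continuous_section_def continuous_map_def)
next
  case False
  then obtain F where F: "F \<in> rv_space M S" using B rv_space_nonempty by blast
  have "continuous_map (laws B) (rvs_over B) (\<lambda>\<beta>. transport_rv F \<beta>)"
    using F by (intro continuous_map_transport_rvs_over B) auto
  moreover have "prob_law M (transport_rv F \<beta>) = \<beta>" if "\<beta> \<in> topspace (laws B)" for \<beta>
    using that F by (intro prob_law_transport) auto
  ultimately show ?thesis unfolding has_continuous_section_def by blast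
qed

text \<open>\<open>prob_law M \<circ> transport_rv x\<close> is the identity on \<open>B\<close>, so
  only the other composite needs a homotopy. It joins \<open>F\<close> to
  \<open>transport_rv x (prob_law M F)\<close>, a variable with the same law, by patching.\<close>

lemma weak_homotopy_equivalence_law:
  assumes B: "face_closed S B"
  shows "weak_homotopy_equivalence (rvs_over B) (laws B) (prob_law M)"
proof (rule weak_homotopy_equivalenceI)
  let ?E = "rvs_over B" and ?B = "laws B"
  have Bp: "B \<subseteq> prob_simplex S" using B by (simp add: face_closed_def)
  show "continuous_map ?E ?B (prob_law M)" by (rule continuous_map_law)
  have tr: "transport_rv F \<beta> \<in> topspace ?E" if "F \<in> rv_space M S" "\<beta> \<in> B" for F \<beta>
    using that Bp by (auto simp: transport_rv_in prob_law_transport subset_iff)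
  show "topspace ?B = {}" if "topspace ?E = {}"
  proof (rule ccontr)
    assume "topspace ?B \<noteq> {}"
    then obtain \<beta> where "\<beta> \<in> B" "\<beta> \<in> prob_simplex S" by auto
    moreover obtain F where "F \<in> rv_space M S" using rv_space_nonempty \<open>\<beta> \<in> prob_simplex S\<close> .
    ultimately show False using tr that by blast
  qed
  fix x assume "x \<in> topspace ?E"
  then have x: "x \<in> rv_space M S" "prob_law M x \<in> B" by auto
  have g: "continuous_map X ?E (\<lambda>z. transport_rv x (b z))" if "continuous_map X ?B b" for X b
    using x that by (intro continuous_map_transport_rvs_over Bp) auto
  have "homotopic_with (\<lambda>k. k x = x) ?E ?E id (transport_rv x \<circ> prob_law M)"
  proof (rule homotopic_with_pointedI)
    let ?P = "prod_topology (top_of_set {0..1::real}) ?E"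
    have s: "continuous_map ?P ?E snd" by (rule continuous_map_snd)
    then have "continuous_map ?P ?B (prob_law M \<circ> snd)" by (rule continuous_map_compose[OF _ continuous_map_law])
    from g[OF this] have "continuous_map ?P (rv_topology M S) (\<lambda>z. transport_rv x (prob_law M (snd z)))"
      using continuous_map_into_fulltopology by (fastforce simp: o_def)
    moreover have "continuous_map ?P (rv_topology M S) snd" using s continuous_map_into_fulltopology by blast
    ultimately have c: "continuous_map ?P (rv_topology M S)
        (\<lambda>z. patch_rv (fst z) (snd z) (transport_rv x (prob_law M (snd z))))"
      by (intro continuous_map_patch continuous_map_fst)
    show "continuous_map ?P ?E (\<lambda>z. patch_rv (fst z) (snd z) (transport_rv x (prob_law M (snd z))))"
    proof (rule continuous_map_into_subtopologyI[OF c])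
      fix z assume "z \<in> topspace ?P"
      then have z: "snd z \<in> rv_space M S" "prob_law M (snd z) \<in> B" by auto
      then have p: "prob_law M (snd z) \<in> prob_simplex S" using Bp by blast
      let ?t = "transport_rv x (prob_law M (snd z))"
      have t: "?t \<in> rv_space M S" "prob_law M (snd z) = prob_law M ?t"
        using x p by (auto simp: transport_rv_in prob_law_transport)
      have "prob_law M (patch_rv (fst z) (snd z) ?t) \<in> prob_simplex S"
        by (intro prob_law_in patch_rv_in z t)
      \<comment> \<open>At intermediate times the law can differ from that of \<open>snd z\<close>;
        the inclusion of supports and \<open>face_closed\<close> keep it in
        \<open>B\<close>.\<close>
      then show "patch_rv (fst z) (snd z) ?t \<in> {F. prob_law M F \<in> B}"
        using B z(2) prob_law_patch_support[OF z(1) t] unfolding face_closed_def by blast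
    qed
  qed (use x Bp in \<open>auto simp: patch_rv_0 patch_rv_1 patch_rv_same transport_rv_in transport_rv_prob_law subset_iff\<close>)
  moreover have "homotopic_with (\<lambda>k. k (prob_law M x) = prob_law M x) ?B ?B (prob_law M \<circ> transport_rv x) id"
  proof (rule homotopic_with_equal)
    show "continuous_map ?B ?B (prob_law M \<circ> transport_rv x)"
      using g[of ?B id] continuous_map_law by (intro continuous_map_compose) (auto simp: id_def)
  qed (use x Bp in \<open>auto simp: prob_law_transport subset_iff\<close>)
  ultimately show "\<exists>g. continuous_map ?B ?E g \<and> homotopic_with (\<lambda>k. k x = x) ?E ?E (g \<circ> prob_law M) id \<and>
      homotopic_with (\<lambda>k. k (prob_law M x) = prob_law M x) ?B ?B (prob_law M \<circ> g) id"
    using g[of ?B id] homotopic_with_symD by (intro exI[of _ "transport_rv x"]) (auto simp: id_def)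
qed

text \<open>One formula \<open>h\<close> deforms the random variables over any face closed set of
  laws, so it supplies the homotopies for both composites. At time 1 it lands over finitely
  supported laws, which gives the inverse.\<close>

lemma weak_homotopy_equivalence_inclusion:
  assumes K: "abstract_simplicial_complex S K"
  shows "weak_homotopy_equivalence (rvs_over (realization S K)) (rvs_over (realization1_completion S K)) id"
proof (rule weak_homotopy_equivalenceI)
  let ?R = "realization S K" and ?C = "realization1_completion S K"
  have RC: "?R \<subseteq> ?C" by (rule realization_subset_completion[OF K])
  have Cp: "?C \<subseteq> prob_simplex S" by (rule completion_subset_prob_simplex)
  have Rp: "?R \<subseteq> prob_simplex S" using RC Cp by blast
  show "continuous_map (rvs_over ?R) (rvs_over ?C) id"
    using RC by (intro continuous_map_into_subtopologyI continuous_map_from_subtopology) auto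
  have tin: "transport_rv F (retract {} (prob_law M F)) \<in> topspace (rvs_over ?R)"
    if "F \<in> topspace (rvs_over ?C)" for F
    using that retract_in_realization[of "prob_law M F" S K "{}"] Rp
    by (auto simp: transport_rv_in prob_law_transport subset_iff)
  then show "topspace (rvs_over ?R) = {} \<Longrightarrow> topspace (rvs_over ?C) = {}" by blast
  fix x assume "x \<in> topspace (rvs_over ?R)"
  then have x: "x \<in> rv_space M S" "prob_law M x \<in> ?R" by auto
  define E where "E = {s. prob_law M x s \<noteq> 0}"
  have xp: "prob_law M x \<in> prob_simplex S" and "E \<in> K" using x by (auto simp: realization_eq E_def)
  then have E: "finite E" using K by (auto simp: abstract_simplicial_complex_def)
  have fixed: "contraction E t (prob_law M x) = prob_law M x" for t
    by (rule contraction_fixed[OF xp E]) (simp add: E_def)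
  define h where "h z = transport_rv (snd z) (contraction E (fst z) (prob_law M (snd z)))" for z
  have h: "continuous_map (prod_topology (top_of_set {0..1::real}) (rvs_over B)) (rvs_over B) h"
    if B: "face_closed S B" for B
  proof -
    let ?P = "prod_topology (top_of_set {0..1::real}) (rvs_over B)"
    have Bp: "B \<subseteq> prob_simplex S" using B by (simp add: face_closed_def)
    have s: "continuous_map ?P (rvs_over B) snd" by (rule continuous_map_snd)
    then have s': "continuous_map ?P (rv_topology M S) snd" using continuous_map_into_fulltopology by blast
    from continuous_map_compose[OF this continuous_map_prob_law]
    have "continuous_map ?P (prob_simplex_top S) (\<lambda>z. prob_law M (snd z))" by (simp add: o_def)
    then have c: "continuous_map ?P (prob_simplex_top S) (\<lambda>z. contraction E (fst z) (prob_law M (snd z)))"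
      by (intro continuous_map_contraction E continuous_map_fst)
    have "continuous_map ?P (laws B) (\<lambda>z. contraction E (fst z) (prob_law M (snd z)))"
    proof (rule continuous_map_into_subtopologyI[OF c])
      fix z assume "z \<in> topspace ?P"
      then have z: "fst z \<in> {0..1}" "prob_law M (snd z) \<in> B" by auto
      then have p: "prob_law M (snd z) \<in> prob_simplex S" using Bp by blast
      show "contraction E (fst z) (prob_law M (snd z)) \<in> B"
        using B z(2) contraction_in[OF p E z(1)] contraction_support_subset[OF p E]
        unfolding face_closed_def by blast
    qed
    then show ?thesis unfolding h_def[abs_def] by (intro continuous_map_transport_rvs_over Bp s')
  qed
  define g where "g F = transport_rv F (retract E (prob_law M F))" for F
  have h01: "h (0, F) = id F" "h (1, F) = g F" if "F \<in> rv_space M S" for F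
    using that by (auto simp: h_def g_def transport_rv_prob_law)
  have hx: "h (t, x) = x" for t using x by (simp add: h_def fixed transport_rv_prob_law)
  have 1: "homotopic_with (\<lambda>k. k x = x) (rvs_over ?R) (rvs_over ?R) id (g \<circ> id)"
    by (rule homotopic_with_pointedI[OF h[OF face_closed_realization[OF K]]]) (use x h01 hx in auto)
  have 2: "homotopic_with (\<lambda>k. k (id x) = id x) (rvs_over ?C) (rvs_over ?C) id (id \<circ> g)"
    by (rule homotopic_with_pointedI[OF h[OF face_closed_completion]]) (use x RC h01 hx in auto)
  have "continuous_map (rvs_over ?C) (rv_topology M S) g"
    using homotopic_with_imp_continuous_maps[OF 2] continuous_map_into_fulltopology by fastforce
  then have "continuous_map (rvs_over ?C) (rvs_over ?R) g"
  proof (rule continuous_map_into_subtopologyI)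
    fix F assume "F \<in> topspace (rvs_over ?C)"
    then have F: "F \<in> rv_space M S" "prob_law M F \<in> ?C" by auto
    then have "retract E (prob_law M F) \<in> ?R" by (intro retract_in_realization E)
    then show "g F \<in> {F. prob_law M F \<in> ?R}"
      using Rp F(1) by (auto simp: g_def prob_law_transport subset_iff)
  qed
  then show "\<exists>g. continuous_map (rvs_over ?C) (rvs_over ?R) g \<and>
      homotopic_with (\<lambda>k. k x = x) (rvs_over ?R) (rvs_over ?R) (g \<circ> id) id \<and>
      homotopic_with (\<lambda>k. k (id x) = id x) (rvs_over ?C) (rvs_over ?C) (id \<circ> g) id"
    using 1 2 homotopic_with_symD by blast
qed

section \<open>The spaces of random variables as preimages of sets of laws\<close>

lemma ess_image_eq:
  assumes "F \<in> rv_space M S" shows "ess_image M S F = {s. prob_law M F s \<noteq> 0}"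
proof -
  have "prob_law M F s = 0" if "s \<notin> S" for s
    using prob_simplex_outside[OF prob_law_in[OF assms] that] .
  moreover have "0 \<le> prob_law M F s" for s using prob_simplex_nonneg[OF prob_law_in[OF assms]] .
  ultimately show ?thesis unfolding ess_image_def prob_law_def by (auto simp: less_le)
qed

lemma rv_complex_eq: "rv_complex M S K = {F \<in> rv_space M S. prob_law M F \<in> realization S K}"
  by (auto simp: rv_complex_def ess_image_eq realization_eq prob_law_in)

text \<open>If \<open>G\<close> is closer to \<open>F\<close> than the smallest atom of
  \<open>F\<close> on a finite set \<open>A\<close>, then \<open>G\<close> charges all of
  \<open>A\<close>, which forces \<open>A\<close> into \<open>K\<close>. Conversely, density of
  \<open>realization S K\<close> among the admissible laws is carried over by the continuous map
  \<open>transport_rv F\<close>, which sends the law of \<open>F\<close> to \<open>F\<close>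
  itself.\<close>

lemma closure_of_rv_complex:
  assumes K: "abstract_simplicial_complex S K"
  shows "rv_topology M S closure_of rv_complex M S K
           = {F \<in> rv_space M S. prob_law M F \<in> realization1_completion S K}" (is "?L = ?R")
proof (intro subset_antisym subsetI)
  let ?C = "realization1_completion S K"
  fix F assume F: "F \<in> ?L"
  then have Fin: "F \<in> rv_space M S" using closure_of_subset_topspace by fastforce
  have near: "\<exists>G\<in>rv_complex M S K. rv_dist M F G < r" if "r > 0" for r
    using F that unfolding rv_topology_def rv.metric_closure_of by (auto simp: Bex_def)
  have "A \<in> K" if A: "finite A" "A \<noteq> {}" "A \<subseteq> {s. prob_law M F s \<noteq> 0}" for A
  proof -
    have pos: "prob_law M F s > 0" if "s \<in> A" for s
      using A that prob_simplex_nonneg[OF prob_law_in[OF Fin], of s] by (auto simp: less_le)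
    define r where "r = Min (prob_law M F ` A)"
    have r: "r > 0" "\<And>s. s \<in> A \<Longrightarrow> r \<le> prob_law M F s" using A pos by (auto simp: r_def)
    obtain G where G: "G \<in> rv_complex M S K" "rv_dist M F G < r" using near[OF r(1)] by blast
    then have Gin: "G \<in> rv_space M S" "{s. prob_law M G s \<noteq> 0} \<in> K"
      by (auto simp: rv_complex_eq realization_eq)
    have "prob_law M G s \<noteq> 0" if "s \<in> A" for s
      using abs_law_diff_le[OF rv_spaceE(1)[OF Fin] rv_spaceE(1)[OF Gin(1)], of s] G(2) r(2)[OF that]
      by (simp add: prob_law_eq_law rv_dist_eq)
    then have "A \<subseteq> {s. prob_law M G s \<noteq> 0}" by blast
    then show ?thesis using K Gin(2) A unfolding abstract_simplicial_complex_def by blast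
  qed
  then show "F \<in> ?R" using Fin prob_law_in[OF Fin] by (simp add: completion_eq)
next
  let ?C = "realization1_completion S K"
  fix F assume "F \<in> ?R"
  then have F: "F \<in> rv_space M S" "prob_law M F \<in> ?C" by auto
  have c: "continuous_map (laws ?C) (rv_topology M S) (transport_rv F)"
    using continuous_map_transport_rvs_over[OF completion_subset_prob_simplex, of "laws ?C" "\<lambda>_. F" K id] F
      continuous_map_into_fulltopology by (fastforce simp: id_def)
  have "prob_law M F \<in> laws ?C closure_of realization S K"
    using realization_dense_in_completion[OF K] F(2) by (simp add: completion_top_eq)
  then have "transport_rv F (prob_law M F) \<in> rv_topology M S closure_of (transport_rv F ` realization S K)"
    using continuous_map_image_closure_subset[OF c] by blast
  moreover have "transport_rv F ` realization S K \<subseteq> rv_complex M S K"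
    using F(1) by (auto simp: rv_complex_eq realization_eq transport_rv_in prob_law_transport)
  ultimately show "F \<in> ?L" using closure_of_mono transport_rv_prob_law[OF F(1)] by fastforce
qed

lemma L_top_eq: "L_top M S K = rvs_over (realization S K)"
proof -
  have "rv_complex M S K = topspace (rv_topology M S) \<inter> {F. prob_law M F \<in> realization S K}"
    by (auto simp: rv_complex_eq)
  then show ?thesis unfolding L_top_def by (simp only: subtopology_restrict)
qed

lemma Lbar_top_eq:
  assumes "abstract_simplicial_complex S K"
  shows "Lbar_top M S K = rvs_over (realization1_completion S K)"
proof -
  have "rv_topology M S closure_of rv_complex M S K
      = topspace (rv_topology M S) \<inter> {F. prob_law M F \<in> realization1_completion S K}"
    using closure_of_rv_complex[OF assms] by auto
  then show ?thesis unfolding Lbar_top_def by (simp only: subtopology_restrict)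
qed

end

section \<open>Nonatomic standard probability spaces\<close>

text \<open>The isomorphism without restricted measure spaces: \<open>\<phi>\<close> and
  \<open>\<psi>\<close> are mutually inverse off null sets, and measurability is stated pointwise
  for the completion of \<open>M\<close> and for Lebesgue sets of the line.\<close>

locale unit_interval_model = prob_space M for M :: "'w measure" +
  fixes A :: "'w set" and B :: "real set" and \<phi> :: "'w \<Rightarrow> real" and \<psi> :: "real \<Rightarrow> 'w"
  assumes A: "A \<in> null_sets (completion M)" and B: "B \<in> null_sets lebesgue" "B \<subseteq> {0..1}"
    and \<phi>: "w \<in> space M - A \<Longrightarrow> \<phi> w \<in> {0..1} - B \<and> \<psi> (\<phi> w) = w"
    and \<psi>: "y \<in> {0..1} - B \<Longrightarrow> \<psi> y \<in> space M - A \<and> \<phi> (\<psi> y) = y"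
    and \<phi>m: "X \<in> sets lebesgue \<Longrightarrow> {w \<in> space M - A. \<phi> w \<in> X} \<in> sets (completion M)"
    and \<psi>m: "W \<in> sets (completion M) \<Longrightarrow> {y \<in> {0..1} - B. \<psi> y \<in> W} \<in> sets lebesgue"
    and \<phi>e: "X \<in> sets lebesgue \<Longrightarrow> X \<subseteq> {0..1} - B \<Longrightarrow>
      emeasure (completion M) {w \<in> space M - A. \<phi> w \<in> X} = emeasure lebesgue X"

lemma nonatomic_standard_unit_interval_model:
  fixes M :: "'w measure"
  assumes M: "nonatomic_standard_prob_space M"
  shows "\<exists>A B \<phi> \<psi>. unit_interval_model M A B \<phi> \<psi>"
proof -
  let ?N = "lebesgue_on {0..1::real}" and ?M = "completion M"
  obtain A B \<phi> where A: "A \<in> null_sets ?M" and B: "B \<in> null_sets ?N"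
    and bij: "bij_betw \<phi> (space ?M - A) (space ?N - B)"
    and m1: "\<phi> \<in> measurable (restrict_space ?M (space ?M - A)) (restrict_space ?N (space ?N - B))"
    and m2: "the_inv_into (space ?M - A) \<phi>
               \<in> measurable (restrict_space ?N (space ?N - B)) (restrict_space ?M (space ?M - A))"
    and em: "\<And>E. E \<in> sets ?N \<Longrightarrow> E \<subseteq> space ?N - B \<Longrightarrow> emeasure ?M (\<phi> -` E \<inter> (space ?M - A)) = emeasure ?N E"
    using M unfolding nonatomic_standard_prob_space_def isomorphic_mod_null_def by blast
  define \<psi> where "\<psi> = the_inv_into (space M - A) \<phi>"
  have inj: "inj_on \<phi> (space M - A)" and im: "\<phi> ` (space M - A) = {0..1} - B"
    using bij by (auto simp: bij_betw_def)
  have BN: "B \<in> sets ?N" "emeasure ?N B = 0" using B by auto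
  then have B01: "B \<subseteq> {0..1}" using sets.sets_into_space[of B ?N] by simp
  have sN: "X \<in> sets ?N \<longleftrightarrow> X \<in> sets lebesgue \<and> X \<subseteq> {0..1}" for X
    by (subst sets_restrict_space_iff) auto
  have eN: "emeasure ?N X = emeasure lebesgue X" if "X \<subseteq> {0..1}" for X
    by (subst emeasure_restrict_space) (use that in auto)
  have Bl: "B \<in> null_sets lebesgue" using BN eN[OF B01] sN by (auto intro: null_setsI)
  have SA: "space M - A \<in> sets ?M" using sets.compl_sets[OF null_setsD2[OF A]] by simp
  have IB: "{0..1} - B \<in> sets ?N" using sN Bl by auto
  have sp1: "space (restrict_space ?M (space ?M - A)) = space M - A" by (auto simp: space_restrict_space)
  have sp2: "space (restrict_space ?N (space ?N - B)) = {0..1} - B" by (auto simp: space_restrict_space)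
  have 1: "{w \<in> space M - A. \<phi> w \<in> X} \<in> sets ?M" if X: "X \<in> sets lebesgue" for X
  proof -
    have "X \<inter> ({0..1} - B) \<in> sets (restrict_space ?N (space ?N - B))"
      using X Bl IB sN by (subst sets_restrict_space_iff) auto
    from measurable_sets[OF m1 this]
    have "\<phi> -` (X \<inter> ({0..1} - B)) \<inter> (space M - A) \<in> sets ?M"
      unfolding sp1 using SA by (subst (asm) sets_restrict_space_iff) auto
    also have "\<phi> -` (X \<inter> ({0..1} - B)) \<inter> (space M - A) = {w \<in> space M - A. \<phi> w \<in> X}" using im by blast
    finally show ?thesis .
  qed
  have p: "\<phi> w \<in> {0..1} - B \<and> \<psi> (\<phi> w) = w" if "w \<in> space M - A" for w
    using that im the_inv_into_f_f[OF inj that] unfolding \<psi>_def by blast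
  have q: "\<psi> y \<in> space M - A \<and> \<phi> (\<psi> y) = y" if "y \<in> {0..1} - B" for y
    using that im f_the_inv_into_f[OF inj, of y] the_inv_into_into[OF inj, of y "space M - A"]
    unfolding \<psi>_def by auto
  have 2: "{y \<in> {0..1} - B. \<psi> y \<in> W} \<in> sets lebesgue" if W: "W \<in> sets ?M" for W
  proof -
    have "W \<inter> (space M - A) \<in> sets (restrict_space ?M (space ?M - A))"
      using W SA by (subst sets_restrict_space_iff) auto
    from measurable_sets[OF m2 this]
    have "\<psi> -` (W \<inter> (space M - A)) \<inter> ({0..1} - B) \<in> sets ?N"
      unfolding sp2 \<psi>_def using IB by (subst (asm) sets_restrict_space_iff) auto
    also have "\<psi> -` (W \<inter> (space M - A)) \<inter> ({0..1} - B) = {y \<in> {0..1} - B. \<psi> y \<in> W}" using q by blast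
    finally show ?thesis using sN by blast
  qed
  have 3: "emeasure ?M {w \<in> space M - A. \<phi> w \<in> X} = emeasure lebesgue X"
    if X: "X \<in> sets lebesgue" "X \<subseteq> {0..1} - B" for X
  proof -
    have X01: "X \<subseteq> {0..1}" using X(2) by blast
    then have "emeasure ?M (\<phi> -` X \<inter> (space M - A)) = emeasure ?N X"
      using em[of X] X sN by simp
    moreover have "\<phi> -` X \<inter> (space M - A) = {w \<in> space M - A. \<phi> w \<in> X}" by blast
    ultimately show ?thesis using eN[OF X01] by simp
  qed
  have "prob_space M" using M by (simp add: nonatomic_standard_prob_space_def)
  then have "unit_interval_model M A B \<phi> \<psi>"
    by (intro unit_interval_model.intro unit_interval_model_axioms.intro A Bl B01 p q 1 2 3)
  then show ?thesis by blast
qed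

context unit_interval_model
begin

text \<open>The map \<open>\<phi>\<close> has uniform law, but it is controlled only off a null set
  and is measurable only for the completion. Setting it to 0 on \<open>A\<close> and then modifying
  it on a null set gives measurability for \<open>M\<close> and keeps the law.\<close>

lemma ex_uniform: "\<exists>u\<in>borel_measurable M. \<forall>t\<in>{0..1::real}. measure M {w \<in> space M. u w \<le> t} = t"
proof -
  have SA: "space M - A \<in> sets (completion M)" using sets.compl_sets[OF null_setsD2[OF A]] by simp
  define u0 where "u0 w = (if w \<in> space M - A then \<phi> w else 0)" for w
  have "u0 \<in> borel_measurable (completion M)"
  proof (rule measurableI)
    fix X :: "real set" assume "X \<in> sets borel"
    then have "{w \<in> space M - A. \<phi> w \<in> X} \<in> sets (completion M)" by (intro \<phi>m) simp
    moreover have "A \<inter> space M \<in> sets (completion M)" using null_setsD2[OF A] by (metis sets.Int sets.top space_completion)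
    moreover have "u0 -` X \<inter> space (completion M) = {w \<in> space M - A. \<phi> w \<in> X} \<union> (if 0 \<in> X then A \<inter> space M else {})"
      by (auto simp: u0_def split: if_splits)
    ultimately show "u0 -` X \<inter> space (completion M) \<in> sets (completion M)"
      by (cases "0 \<in> X") auto
  qed simp
  then obtain u where u: "u \<in> borel_measurable M" and ae: "AE w in M. u0 w = u w"
    using completion_ex_borel_measurable_real by blast
  have "measure M {w \<in> space M. u w \<le> t} = t" if t: "t \<in> {0..1}" for t
  proof -
    let ?E = "{0..t} - B"
    have E: "?E \<in> sets lebesgue" "?E \<subseteq> {0..1} - B" using t B by auto
    have U: "{w \<in> space M. u w \<le> t} \<in> sets M" using u by measurable
    have "emeasure M {w \<in> space M. u w \<le> t} = emeasure (completion M) {w \<in> space M. u w \<le> t}"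
      using U by simp
    also have "\<dots> = emeasure (completion M) {w \<in> space M - A. \<phi> w \<in> ?E}"
    proof (rule emeasure_eq_AE)
      have "AE w in completion M. u0 w = u w" using ae by (rule AE_completion)
      with AE_not_in[OF A] AE_space
      show "AE w in completion M. w \<in> {w \<in> space M. u w \<le> t} \<longleftrightarrow> w \<in> {w \<in> space M - A. \<phi> w \<in> ?E}"
      proof eventually_elim
        case (elim w)
        then show ?case using \<phi>[of w] by (auto simp: u0_def)
      qed
    qed (use U \<phi>m[OF E(1)] in auto)
    also have "\<dots> = emeasure lebesgue ?E" by (rule \<phi>e[OF E])
    also have "\<dots> = emeasure lebesgue {0..t}" using B(1) by (intro emeasure_Diff_null_set) auto
    also have "\<dots> = ennreal t" using t by simp
    finally show ?thesis using t by (simp add: measure_def)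
  qed
  with u show ?thesis by blast
qed

text \<open>The union of all null fibres is transported to a subset of \<open>[0,1]\<close>, and the values of the map there are coded by
  reals by choosing a point in each fibre.\<close>

lemma essentially_countable:
  assumes f: "f \<in> measurable M (count_space S)"
  shows "\<exists>C. countable C \<and> C \<subseteq> S \<and> (AE w in M. f w \<in> C)"
proof -
  have fS: "f w \<in> S" if "w \<in> space M" for w using measurable_space[OF f that] by simp
  have fm: "{w \<in> space M. f w \<in> T} \<in> sets M" for T
  proof -
    have "f -` (T \<inter> S) \<inter> space M \<in> sets M" by (rule measurable_sets[OF f]) simp
    also have "f -` (T \<inter> S) \<inter> space M = {w \<in> space M. f w \<in> T}" using fS by auto
    finally show ?thesis .
  qed
  let ?D = "distr M (count_space S) f"
  interpret D: prob_space ?D using f by (rule prob_space_distr)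
  \<comment> \<open>The atoms of the law, which are countably many. It remains to exclude a part of
    positive measure composed of null fibres.\<close>
  define C where "C = {s \<in> S. measure M {w \<in> space M. f w \<in> {s}} \<noteq> 0}"
  have "measure ?D {s} = measure M {w \<in> space M. f w \<in> {s}}" if "s \<in> S" for s
    using that by (subst measure_distr[OF f]) (auto intro!: arg_cong[where f="measure M"])
  then have "C \<subseteq> {s. measure ?D {s} \<noteq> 0}" by (auto simp: C_def)
  then have C: "countable C" using D.countable_support countable_subset by blast
  \<comment> \<open>The event that \<open>f\<close> lies in \<open>T\<close>, moved to the interval.
    It is Lebesgue measurable for every \<open>T\<close>, and this makes all preimages under
    \<open>k\<close> measurable.\<close>
  define L where "L T = {y \<in> {0..1} - B. \<psi> y \<in> {w \<in> space M. f w \<in> T}}" for T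
  have Lm: "L T \<in> sets lebesgue" for T
    unfolding L_def by (rule \<psi>m) (rule sets_completionI_sets[OF fm])
  have LT: "L T \<subseteq> {0..1} - B" for T by (auto simp: L_def)
  have Le: "measure lebesgue (L T) = measure M {w \<in> space M. f w \<in> T}" for T
  proof -
    have "{w \<in> space M - A. \<phi> w \<in> L T} = {w \<in> space M. f w \<in> T} - A"
      using \<phi> by (auto simp: L_def)
    then have "emeasure lebesgue (L T) = emeasure (completion M) ({w \<in> space M. f w \<in> T} - A)"
      by (simp only: \<phi>e[OF Lm LT, symmetric])
    also have "\<dots> = emeasure (completion M) {w \<in> space M. f w \<in> T}"
      using A fm by (intro emeasure_Diff_null_set sets_completionI_sets)
    also have "\<dots> = emeasure M {w \<in> space M. f w \<in> T}" using fm by simp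
    finally show ?thesis by (simp add: measure_def)
  qed
  define rep where "rep s = (SOME w. w \<in> space M - A \<and> f w = s)" for s
  have rep: "rep (f w) \<in> space M - A \<and> f (rep (f w)) = f w" if "w \<in> space M - A" for w
    unfolding rep_def by (rule someI[of _ w]) (use that in auto)
  \<comment> \<open>\<open>k\<close> sees \<open>y\<close> only through \<open>f (\<psi> y)\<close>,
    and it separates these values because \<open>rep\<close> picks a point of the fibre and
    \<open>\<phi>\<close> is injective off \<open>A\<close>. Its nonempty level sets in
    \<open>L (- C)\<close> are therefore transported null fibres.\<close>
  define k where "k y = \<phi> (rep (f (\<psi> y)))" for y
  have "measure lebesgue (L (- C)) = 0"
  proof (rule null_of_all_preimages_measurable[where k=k])
    show "L (- C) \<in> sets lebesgue" by (rule Lm)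
    show "L (- C) \<subseteq> {0..1}" by (auto simp: L_def)
    show "{y \<in> L (- C). k y \<in> X} \<in> sets lebesgue" for X
    proof -
      have "{y \<in> L (- C). k y \<in> X} = L {s \<in> - C. \<phi> (rep s) \<in> X}" by (auto simp: L_def k_def)
      then show ?thesis using Lm by simp
    qed
    show "measure lebesgue {y \<in> L (- C). k y = x} = 0" for x
    proof (cases "\<exists>y\<in>L (- C). k y = x")
      case True
      then obtain y where y: "y \<in> L (- C)" "k y = x" by blast
      let ?s = "f (\<psi> y)"
      have inS: "?s \<in> S - C" using y(1) fS by (auto simp: L_def)
      have "{y \<in> L (- C). k y = x} = L {?s}"
      proof (intro subset_antisym subsetI)
        fix z assume z: "z \<in> {y \<in> L (- C). k y = x}"
        then have in': "\<psi> z \<in> space M - A" "\<psi> y \<in> space M - A" using \<psi> y(1) by (auto simp: L_def)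
        have "\<phi> (rep (f (\<psi> z))) = \<phi> (rep ?s)" using z y(2) by (simp add: k_def)
        then have "rep (f (\<psi> z)) = rep ?s" using \<phi> rep in' by metis
        then have "f (\<psi> z) = ?s" using rep in' by metis
        then show "z \<in> L {?s}" using z by (auto simp: L_def)
      next
        fix z assume "z \<in> L {?s}"
        then show "z \<in> {y \<in> L (- C). k y = x}" using y inS by (auto simp: L_def k_def)
      qed
      then show ?thesis using inS Le[of "{?s}"] by (simp add: C_def)
    next
      case False
      then have e: "{y \<in> L (- C). k y = x} = {}" by blast
      show ?thesis unfolding e by simp
    qed
  qed
  then have "measure M {w \<in> space M. f w \<in> - C} = 0" by (simp only: Le)
  then have "AE w in M. w \<notin> {w \<in> space M. f w \<in> - C}" by (simp only: prob_eq_0[OF fm])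
  with AE_space have "AE w in M. f w \<in> C" by eventually_elim auto
  moreover have "C \<subseteq> S" by (auto simp: C_def)
  ultimately show ?thesis using C by blast
qed

end

lemma strict_linear_order_exists:
  obtains prec :: "'a \<Rightarrow> 'a \<Rightarrow> bool" where
    "\<And>s. \<not> prec s s" "\<And>q r s. prec q r \<Longrightarrow> prec r s \<Longrightarrow> prec q s" "\<And>r s. r \<noteq> s \<Longrightarrow> prec r s \<or> prec s r"
proof -
  obtain R :: "'a rel" where R: "well_order_on UNIV R" using well_order_on by blast
  then have "trans R" "antisym R" "total_on UNIV R"
    by (auto simp: well_order_on_def linear_order_on_def partial_order_on_def preorder_on_def)
  then show ?thesis
    by (intro that[of "\<lambda>a b. (a, b) \<in> R \<and> a \<noteq> b"]) (auto simp: total_on_def dest: transD antisymD)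
qed

theorem theorem1p1:
  fixes \<Omega> :: "'w measure" and S :: "'s set" and K :: "'s set set"
  assumes "nonatomic_standard_prob_space \<Omega>"
    and "abstract_simplicial_complex S K"
  shows
    "weak_homotopy_equivalence (L_top \<Omega> S K) (Lbar_top \<Omega> S K) id
     \<and>
     (serre_fibration (L_top \<Omega> S K) (realization1_top S K) (prob_law \<Omega>) \<and>
      weak_homotopy_equivalence (L_top \<Omega> S K) (realization1_top S K) (prob_law \<Omega>) \<and>
      has_continuous_section (L_top \<Omega> S K) (realization1_top S K) (prob_law \<Omega>))
     \<and>
     (serre_fibration (Lbar_top \<Omega> S K) (realization1_completion_top S K) (prob_law \<Omega>) \<and>
      weak_homotopy_equivalence (Lbar_top \<Omega> S K) (realization1_completion_top S K) (prob_law \<Omega>) \<and>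
      has_continuous_section (Lbar_top \<Omega> S K) (realization1_completion_top S K) (prob_law \<Omega>))
     \<and>
     (same_weak_homotopy_type TYPE('s \<Rightarrow> real) (L_top \<Omega> S K) (weak_topology S K) \<and>
      same_weak_homotopy_type TYPE('s \<Rightarrow> real) (Lbar_top \<Omega> S K) (weak_topology S K))"
proof -
  obtain A B \<phi> \<psi> where "unit_interval_model \<Omega> A B \<phi> \<psi>"
    using nonatomic_standard_unit_interval_model[OF assms(1)] by blast
  then interpret \<Omega>: unit_interval_model \<Omega> A B \<phi> \<psi> .
  obtain u where u: "u \<in> borel_measurable \<Omega>" "\<And>t. t \<in> {0..1::real} \<Longrightarrow> measure \<Omega> {w \<in> space \<Omega>. u w \<le> t} = t"
    using \<Omega>.ex_uniform by blast
  obtain prec :: "'s \<Rightarrow> 's \<Rightarrow> bool" where prec: "\<And>s. \<not> prec s s"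
    "\<And>q r s. prec q r \<Longrightarrow> prec r s \<Longrightarrow> prec q s" "\<And>r s. r \<noteq> s \<Longrightarrow> prec r s \<or> prec s r"
    using strict_linear_order_exists by blast
  interpret uniform_rvs \<Omega> S u prec
  proof
    show "\<exists>C. countable C \<and> C \<subseteq> S \<and> (AE w in \<Omega>. f w \<in> C)" if "f \<in> measurable \<Omega> (count_space S)" for f
      using that by (rule \<Omega>.essentially_countable)
  qed (use u prec in auto)
  note K = assms(2)
  let ?R = "realization S K" and ?C = "realization1_completion S K"
  have R: "?R \<subseteq> prob_simplex S" and C: "?C \<subseteq> prob_simplex S"
    using completion_subset_prob_simplex by (auto simp: realization_eq)
  have fR: "face_closed S ?R" and fC: "face_closed S ?C"
    using face_closed_realization[OF K] face_closed_completion by auto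
  have LR: "weak_homotopy_equivalence (L_top \<Omega> S K) (realization1_top S K) (prob_law \<Omega>)"
    unfolding L_top_eq realization1_top_eq by (rule weak_homotopy_equivalence_law[OF fR])
  have LC: "weak_homotopy_equivalence (Lbar_top \<Omega> S K) (realization1_completion_top S K) (prob_law \<Omega>)"
    unfolding Lbar_top_eq[OF K] completion_top_eq by (rule weak_homotopy_equivalence_law[OF fC])
  have "weak_homotopy_equivalence (weak_topology S K) (realization1_top S K) id"
    unfolding realization1_top_eq
    by (rule weak_homotopy_equivalence_weak_topology[OF K order_refl realization_subset_completion[OF K] fR])
  \<comment> \<open>The zigzag has one intermediate space, the metric realization: the law map leads
    into it on one side and the identity of the weak realization on the other. For the closure, the
    completed realization plays the same role.\<close>
  then have 4: "same_weak_homotopy_type TYPE('s \<Rightarrow> real) (L_top \<Omega> S K) (weak_topology S K)"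
    unfolding same_weak_homotopy_type_def weakly_equivalent_step_def[abs_def]
    using LR by (intro exI[of _ "realization1_top S K"]) (auto simp: equivclp_refl)
  have "weak_homotopy_equivalence (weak_topology S K) (realization1_completion_top S K) id"
    unfolding completion_top_eq
    by (rule weak_homotopy_equivalence_weak_topology[OF K realization_subset_completion[OF K] order_refl fC])
  then have 5: "same_weak_homotopy_type TYPE('s \<Rightarrow> real) (Lbar_top \<Omega> S K) (weak_topology S K)"
    unfolding same_weak_homotopy_type_def weakly_equivalent_step_def[abs_def]
    using LC by (intro exI[of _ "realization1_completion_top S K"]) (auto simp: equivclp_refl)
  show ?thesis
    using weak_homotopy_equivalence_inclusion[OF K] LR LC 4 5
      serre_fibration_law[OF R] has_continuous_section_law[OF R]
      serre_fibration_law[OF C] has_continuous_section_law[OF C]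
    unfolding L_top_eq Lbar_top_eq[OF K] realization1_top_eq completion_top_eq by blast
qed

end
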